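(* Fix a natural number $N_0\geq1$. For each $N\ge N_0$ let $A_N$ and $B_N$ be independent $N\times N$ Wigner matrices (each real or complex, normalized with $\sigma^2=1$ and satisfying the moment conditions given in the context). Let $m\geq0$ be an integer, let $\alpha$ be a non-zero complex number, and let $$P_N=\alpha\, T_{A_N^m}B_N+\overline{\alpha}\,B_NT_{A_N^m}.$$ Then the limiting distribution of $P_N$ with respect to the partial trace $\psi_N$ is $\mu=\frac12(\delta_{\omega}+\delta_{-\omega})$, i.e. $\lim_{N\to\infty}\psi_N(P_N^k)=\int t^k\,d\mu(t)$ for all integers $k\geq1$, where $\delta$ denotes the Dirac measure, $\omega=\sqrt{|\alpha|D_m}$ and $$D_m=\begin{cases}C_m-C_{m/2}^2&\text{if }m\text{ is even},\\ C_m&\text{if }m\text{ is odd},\end{cases}$$ with $C_k$ the $k$-th Catalan number.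
   Context: Wigner matrices: an $N\times N$ Wigner matrix is a Hermitian random matrix $W_N=\frac1{\sqrt N}(W^{(N)}_{i,j})_{1\le i,j\le N}$ with $W^{(N)}_{i,j}=\overline{W^{(N)}_{j,i}}$ such that, for each $N$, $(W_{i,j}^{(N)})_{1\le i\le j\le N}$ is a family of independent random variables; the diagonal entries are real-valued and centered with common variance $s^2$. In the real case the off-diagonal entries are real-valued with $\mathbb{E}[W_{i,j}^{(N)}]=0$ and $\mathbb{E}[|W_{i,j}^{(N)}|^2]=\sigma^2$ for $i<j$; in the complex case they are complex-valued with the same conditions and in addition $\mathbb{E}[(W_{i,j}^{(N)})^2]=0$ for $i<j$. Here $\sigma^2=1$. Moreover $\mathbb{E}[|W_{i,j}^{(N)}|^4]=\kappa$ for all $i<j$ (a constant not depending on $i,j,N$), and $\sup_{N}\sup_{1\le i\le j\le N}\mathbb{E}[|W_{i,j}^{(N)}|^\ell]<\infty$ for every $\ell\in\mathbb{N}$. Partial trace: write an $N\times N$ random matrix $M$ in block form $M=\begin{bmatrix} M^{(1,1)} & M^{(1,2)} \\ M^{(2,1)} & M^{(2,2)} \end{bmatrix}$ with $M^{(1,1)}$ of size $N_0\times N_0$ and $M^{(2,2)}$ of size $(N-N_0)\times(N-N_0)$. Then $\psi_N(M)=\frac1{N_0}\mathbb{E}[\mathrm{Tr}_{N_0}(M^{(1,1)})]$, where $\mathrm{Tr}_{N_0}$ is the non-normalized trace, and $T_M=\begin{bmatrix} 0 & M^{(1,2)} \\ M^{(2,1)} & 0 \end{bmatrix}$.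
   Formalization: The printed ω = sqrt(|α| D_m) is replaced by ω = sqrt(|α|² D_m) = |α| sqrt(D_m); the printed value is false (for m = 1, α = 2 the second moment tends to 4, not 2) and agrees with the corrected one only when |α| = 1 or D_m = 0. *)

theory Defs
  imports "HOL-Probability.Probability" "Jordan_Normal_Form.Matrix"
begin

section \<open>Wigner matrices\<close>

text \<open>
  \<^term>\<open>W i j\<close> is the unnormalised entry in row \<^term>\<open>i\<close> and column \<^term>\<open>j\<close>; indices start at
  0. The off-diagonal variance is 1. \<^term>\<open>s\<^sup>2\<close> is the common variance of the diagonal entries and
  \<^term>\<open>\<kappa>\<close> the common fourth absolute moment of the off-diagonal ones.
\<close>

definition (in prob_space) wigner_array ::
    "nat \<Rightarrow> real \<Rightarrow> real \<Rightarrow> (nat \<Rightarrow> nat \<Rightarrow> 'a \<Rightarrow> complex) \<Rightarrow> bool" where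
  "wigner_array N s \<kappa> W \<longleftrightarrow>
     (\<forall>i<N. \<forall>j<N. \<forall>x\<in>space M. W i j x = cnj (W j i x)) \<and>
     indep_vars (\<lambda>_. borel) (\<lambda>(i, j). W i j) {(i, j). i \<le> j \<and> j < N} \<and>
     (\<forall>i<N. (\<forall>x\<in>space M. W i i x \<in> \<real>) \<and>
            expectation (W i i) = 0 \<and>
            variance (\<lambda>x. Re (W i i x)) = s\<^sup>2) \<and>
     (\<forall>i j. i < j \<and> j < N \<longrightarrow>
            expectation (W i j) = 0 \<and>
            expectation (\<lambda>x. (cmod (W i j x))\<^sup>2) = 1 \<and>
            expectation (\<lambda>x. (cmod (W i j x)) ^ 4) = \<kappa>)"

definition (in prob_space) real_wigner_array ::
    "nat \<Rightarrow> real \<Rightarrow> real \<Rightarrow> (nat \<Rightarrow> nat \<Rightarrow> 'a \<Rightarrow> complex) \<Rightarrow> bool" where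
  "real_wigner_array N s \<kappa> W \<longleftrightarrow> wigner_array N s \<kappa> W \<and>
     (\<forall>i j. i < j \<and> j < N \<longrightarrow> (\<forall>x\<in>space M. W i j x \<in> \<real>))"

definition (in prob_space) complex_wigner_array ::
    "nat \<Rightarrow> real \<Rightarrow> real \<Rightarrow> (nat \<Rightarrow> nat \<Rightarrow> 'a \<Rightarrow> complex) \<Rightarrow> bool" where
  "complex_wigner_array N s \<kappa> W \<longleftrightarrow> wigner_array N s \<kappa> W \<and>
     (\<forall>i j. i < j \<and> j < N \<longrightarrow> expectation (\<lambda>x. (W i j x)\<^sup>2) = 0)"

text \<open>
  The moments are Lebesgue integrals in \<^typ>\<open>ennreal\<close>, so finiteness of the supremum includes
  integrability of all powers of the entries; in particular the (Bochner) expectations occurring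
  above are those of integrable functions.
\<close>

definition bounded_moments ::
    "nat \<Rightarrow> (nat \<Rightarrow> 'a measure) \<Rightarrow> (nat \<Rightarrow> nat \<Rightarrow> nat \<Rightarrow> 'a \<Rightarrow> complex) \<Rightarrow> bool" where
  "bounded_moments N0 M W \<longleftrightarrow>
     (\<forall>l::nat. (SUP N\<in>{N0..}. SUP (i, j)\<in>{(i, j). i \<le> j \<and> j < N}.
        \<integral>\<^sup>+x. ennreal (cmod (W N i j x) ^ l) \<partial>M N) < \<infinity>)"

definition wigner_sequence ::
    "nat \<Rightarrow> (nat \<Rightarrow> 'a measure) \<Rightarrow> real \<Rightarrow> real \<Rightarrow> (nat \<Rightarrow> nat \<Rightarrow> nat \<Rightarrow> 'a \<Rightarrow> complex) \<Rightarrow> bool" where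
  "wigner_sequence N0 M s \<kappa> W \<longleftrightarrow>
     (\<forall>N\<ge>N0. prob_space.real_wigner_array (M N) N s \<kappa> (W N) \<or>
             prob_space.complex_wigner_array (M N) N s \<kappa> (W N)) \<and>
     bounded_moments N0 M W"

definition wigner_mat :: "nat \<Rightarrow> (nat \<Rightarrow> nat \<Rightarrow> 'a \<Rightarrow> complex) \<Rightarrow> 'a \<Rightarrow> complex mat" where
  "wigner_mat N W x = Matrix.mat N N (\<lambda>(i, j). W i j x / complex_of_real (sqrt (real N)))"

text \<open>Independence of the two arrays as random elements of the product space of all entries.\<close>

definition (in prob_space) indep_arrays ::
    "nat \<Rightarrow> (nat \<Rightarrow> nat \<Rightarrow> 'a \<Rightarrow> complex) \<Rightarrow> (nat \<Rightarrow> nat \<Rightarrow> 'a \<Rightarrow> complex) \<Rightarrow> bool" where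
  "indep_arrays N X Y \<longleftrightarrow>
     (let I = {..<N} \<times> {..<N} in
      indep_var (\<Pi>\<^sub>M _\<in>I. borel) (\<lambda>x. \<lambda>(i, j)\<in>I. X i j x)
                (\<Pi>\<^sub>M _\<in>I. borel) (\<lambda>x. \<lambda>(i, j)\<in>I. Y i j x))"


section \<open>Block structure and partial trace\<close>

definition mat_trace :: "complex mat \<Rightarrow> complex" where
  "mat_trace A = (\<Sum>i<dim_row A. A $$ (i, i))"

definition upper_left_block :: "nat \<Rightarrow> complex mat \<Rightarrow> complex mat" where
  "upper_left_block N0 A = (case split_block A N0 N0 of (A11, A12, A21, A22) \<Rightarrow> A11)"

definition off_diagonal_part :: "nat \<Rightarrow> complex mat \<Rightarrow> complex mat" where
  "off_diagonal_part N0 A = (case split_block A N0 N0 of (A11, A12, A21, A22) \<Rightarrow>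
     four_block_mat (0\<^sub>m N0 N0) A12 A21 (0\<^sub>m (dim_row A - N0) (dim_col A - N0)))"

definition (in prob_space) partial_trace :: "nat \<Rightarrow> ('a \<Rightarrow> complex mat) \<Rightarrow> complex" where
  "partial_trace N0 A = expectation (\<lambda>x. mat_trace (upper_left_block N0 (A x))) / of_nat N0"

definition P_mat :: "nat \<Rightarrow> nat \<Rightarrow> complex \<Rightarrow> complex mat \<Rightarrow> complex mat \<Rightarrow> complex mat" where
  "P_mat N0 m \<alpha> A B =
     \<alpha> \<cdot>\<^sub>m (off_diagonal_part N0 (A ^\<^sub>m m) * B) + cnj \<alpha> \<cdot>\<^sub>m (B * off_diagonal_part N0 (A ^\<^sub>m m))"


section \<open>The limiting distribution\<close>

definition catalan :: "nat \<Rightarrow> real" where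
  "catalan k = real ((2 * k) choose k) / real (k + 1)"

definition D_const :: "nat \<Rightarrow> real" where
  "D_const m = (if even m then catalan m - (catalan (m div 2))\<^sup>2 else catalan m)"

text \<open>
  The source prints \<open>\<omega> = sqrt (\<bar>\<alpha>\<bar> D\<^sub>m)\<close>. As \<^const>\<open>P_mat\<close> is homogeneous in \<open>\<alpha>\<close> under real scaling,
  so must \<open>\<omega>\<close> be, and the second moment is \<open>\<bar>\<alpha>\<bar>\<^sup>2 D\<^sub>m\<close>; the printed value is right only for
  \<open>\<bar>\<alpha>\<bar> = 1\<close> or \<open>D\<^sub>m = 0\<close>. The square on \<open>\<bar>\<alpha>\<bar>\<close> is restored here.
\<close>

definition omega :: "complex \<Rightarrow> nat \<Rightarrow> real" where
  "omega \<alpha> m = sqrt ((cmod \<alpha>)\<^sup>2 * D_const m)"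

text \<open>\<open>\<mu> = (\<delta>\<^sub>a + \<delta>\<^sub>-\<^sub>a) / 2\<close> on the Borel sets of the real line; \<^term>\<open>return borel a\<close> is \<open>\<delta>\<^sub>a\<close>.\<close>

definition symmetric_bernoulli :: "real \<Rightarrow> real measure" where
  "symmetric_bernoulli a = measure_of UNIV (sets borel)
     (\<lambda>S. (emeasure (return borel a) S + emeasure (return borel (- a)) S) / 2)"

lemma symmetric_bernoulli_eq_distr:
  "symmetric_bernoulli a =
     distr (measure_pmf (bernoulli_pmf (1/2))) borel (\<lambda>b. if b then a else - a)"
    (is "_ = ?D")
proof -
  have "emeasure ?D S = (emeasure (return borel a) S + emeasure (return borel (- a)) S) / 2"
    if S: "S \<in> sets borel" for S
  proof -
    have "emeasure ?D S = (\<integral>\<^sup>+t. indicator S t \<partial>?D)"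
      using S by simp
    also have "\<dots> = (\<integral>\<^sup>+b. indicator S (if b then a else - a) \<partial>measure_pmf (bernoulli_pmf (1/2)))"
      by (rule nn_integral_distr) (use S in auto)
    also have "\<dots> = indicator S a * ennreal (1/2) + indicator S (- a) * ennreal (1/2)"
      by (subst nn_integral_bernoulli_pmf) auto
    also have "ennreal (1/2) = 1 / 2"
      using ennreal_divide_numeral[of 1 Num.One] by (simp add: divide_ennreal_def)
    also have "indicator S a * (1 / 2) + indicator S (- a) * (1 / 2) =
        (indicator S a + indicator S (- a)) / (2 :: ennreal)"
      by (simp add: divide_ennreal_def distrib_right)
    finally show ?thesis using S by simp
  qed
  moreover have "?D = measure_of UNIV (sets borel) (emeasure ?D)"
    using measure_of_of_measure[of ?D] by simp
  ultimately show ?thesis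
    unfolding symmetric_bernoulli_def
    by (metis (no_types, lifting) measure_of_eq sets.sigma_sets_eq space_borel top_greatest Pow_UNIV)
qed

lemma integral_symmetric_bernoulli:
  fixes f :: "real \<Rightarrow> real"
  assumes "f \<in> borel_measurable borel"
  shows "(\<integral>t. f t \<partial>symmetric_bernoulli a) = (f a + f (- a)) / 2"
  using assms unfolding symmetric_bernoulli_eq_distr
  by (subst integral_distr) (auto simp: field_simps)

end

theory Submission
  imports Defs
begin

text \<open>
  Let \<open>v\<^sub>j\<close> be row \<open>j < N\<^sub>0\<close> of \<open>A\<^sup>m\<close> with its first \<open>N\<^sub>0\<close> entries erased, so that \<open>T\<close> is built from
  the unit vectors \<open>e\<^sub>j\<close> and the \<open>v\<^sub>j\<close>. The span of the rows \<open>e\<^sub>j\<close>, \<open>v\<^sub>j\<close>, \<open>e\<^sub>j B\<close>, \<open>v\<^sub>j B\<close> is invariant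
  under \<open>P\<close>, and the matrix of \<open>P\<close> on it has entries which are polynomials in finitely many upper left
  entries of words in \<open>A\<close> and \<open>B\<close>. These entries converge, with bounded moments of every order, to
  the free moments of the words; in the limit \<open>P\<close> maps \<open>e\<^sub>j\<close> to \<open>\<alpha> v\<^sub>j B\<close> and \<open>v\<^sub>j B\<close> to the multiple
  of \<open>e\<^sub>j\<close> by \<open>cnj \<alpha> D\<^sub>m\<close>, which gives \<open>P\<^sup>2 = \<bar>\<alpha>\<bar>\<^sup>2 D\<^sub>m\<close> on the \<open>e\<^sub>j\<close>.

  The convergence of the entry \<open>(i, i)\<close> of a word is an induction on its length: splitting a closed
  walk at its first return to \<open>i\<close> produces quadratic forms of the independent column \<open>i\<close> in a shorter
  word of the minor without \<open>i\<close>, and these concentrate around normalised traces. The moment bounds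
  come from counting walks in which no edge is used exactly once.
\<close>

section \<open>Catalan numbers\<close>

text \<open>The block cut is a perturbation of finite rank that nevertheless survives in the limit:
  the entries erased from row j of A^m include the diagonal one, which tends to the m-th semicircle
  moment c_m. The full row has limiting squared norm c_(2m), so D_m = c_(2m) - c_m^2 is a variance.
  The partial trace reads only N0 fixed diagonal entries, for which convergence of normalised traces
  is not enough; limits are needed entry by entry, in a mode of convergence that is stable under
  products. Since T has rank at most 2 N0, the number of coefficients describing a row of P^k does
  not grow with N, whereas expanding P^k into words would leave products with cut inner sums. The
  obstacle in the entrywise limit is that the part of a walk after its first return still depends on
  column i. Cauchy-Schwarz replaces independence there and degrades an L2 bound to an L1 bound;
  interpolation with a bounded third moment restores L2 for the next step of the induction.\<close>

lemma catalan_0: "catalan 0 = 1"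
  by (simp add: catalan_def)

lemma catalan_Suc_ratio: "real (n + 2) * catalan (Suc n) = 2 * real (2 * n + 1) * catalan n"
proof -
  have B: "real ((2 * k) choose k) = fact (2 * k) / (fact k * fact k)" for k
    using binomial_fact[of k "2 * k", where ?'a = real] by simp
  have f: "fact (2 * Suc n) = real (2 * n + 2) * real (2 * n + 1) * fact (2 * n)"
    by (simp add: fact_reduce algebra_simps)
  have "real (n + 2) * catalan (Suc n) = fact (2 * Suc n) / (fact (Suc n) * fact (Suc n))"
    unfolding catalan_def B by (simp del: fact_Suc mult_Suc_right)
  also have "\<dots> = (real (2 * n + 2) * real (2 * n + 1) * fact (2 * n)) / ((real (n + 1) * fact n) * (real (n + 1) * fact n))"
    unfolding f by simp
  also have "real (2 * n + 2) = 2 * real (n + 1)"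
    by simp
  also have "(2 * real (n + 1) * real (2 * n + 1) * fact (2 * n)) / ((real (n + 1) * fact n) * (real (n + 1) * fact n)) =
      2 * real (2 * n + 1) * (fact (2 * n) / (fact n * fact n) / real (n + 1))"
    by (simp del: of_nat_add of_nat_mult of_nat_Suc add: field_simps)
  also have "\<dots> = 2 * real (2 * n + 1) * catalan n"
    unfolding catalan_def B ..
  finally show ?thesis .
qed

text \<open>The generating function of the Catalan numbers is (1 - sqrt (1 - 4 y)) / (2 y), so with
  x = -4 y they are, up to scaling, the coefficients of (1 + x)^(1/2).\<close>

lemma gbinomial_half_Suc: "(1 / 2 :: real) gchoose Suc n = (- 1) ^ n * catalan n / (2 * 4 ^ n)"
proof (induction n)
  case 0
  show ?case by (simp add: catalan_0)
next
  case (Suc n)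
  have "(1 / 2 :: real) gchoose Suc (Suc n) = ((1 / 2 :: real) gchoose Suc n) * (1 / 2 - real (Suc n)) / real (n + 2)"
    using gbinomial_absorb_comp[of "1/2::real" "Suc n"] gbinomial_absorption[of "Suc n" "1/2::real"]
    by (simp add: field_simps)
  also have "\<dots> = - ((- 1) ^ n * (real (2 * n + 1) * catalan n) / (4 * 4 ^ n) / real (n + 2))"
  proof -
    have h: "1 / 2 - real (Suc n) = - (real (2 * n + 1) / 2)"
      by (simp add: field_simps)
    show ?thesis unfolding Suc.IH h by (simp add: mult_ac)
  qed
  also have "real (2 * n + 1) * catalan n = real (n + 2) * catalan (Suc n) / 2"
    using catalan_Suc_ratio[of n] by simp
  also have "- ((- 1) ^ n * (real (n + 2) * catalan (Suc n) / 2) / (4 * 4 ^ n) / real (n + 2)) =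
      (- 1) ^ Suc n * catalan (Suc n) / (2 * 4 ^ Suc n)"
  proof -
    have "real (n + 2) \<noteq> 0" by simp
    moreover define r where "r = real (n + 2)"
    ultimately show ?thesis unfolding r_def[symmetric] by simp
  qed
  finally show ?case .
qed

text \<open>Comparing coefficients in \<open>(1 + x)\<^sup>1\<^sup>/\<^sup>2 (1 + x)\<^sup>1\<^sup>/\<^sup>2 = 1 + x\<close>.\<close>

lemma catalan_Suc: "catalan (Suc n) = (\<Sum>i\<le>n. catalan i * catalan (n - i))"
proof -
  let ?a = "\<lambda>k. (1 / 2 :: real) gchoose k"
  have "(\<Sum>k\<in>{0..n+2}. ?a k * ?a (n + 2 - k)) = (1 :: real) gchoose (n + 2)"
    using gbinomial_Vandermonde[of "1/2::real" "1/2" "n + 2"] by simp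
  also have "\<dots> = 0"
    using binomial_gbinomial[of 1 "n + 2", where ?'a = real] by simp
  finally have 0: "(\<Sum>k\<le>n+2. ?a k * ?a (n + 2 - k)) = 0"
    by (simp add: atMost_atLeast0)
  \<comment> \<open>The two end terms contain \<open>?a 0 = 1\<close> and are split off; in all
    others both indices are successors, as \<open>gbinomial_half_Suc\<close> requires.\<close>
  have "(\<Sum>k\<le>Suc (Suc n). ?a k * ?a (Suc (Suc n) - k)) =
      (\<Sum>k\<le>Suc n. ?a k * ?a (Suc (Suc n) - k)) + ?a (Suc (Suc n))"
    by (simp only: sum.atMost_Suc) simp
  also have "(\<Sum>k\<le>Suc n. ?a k * ?a (Suc (Suc n) - k)) =
      ?a (Suc (Suc n)) + (\<Sum>k\<le>n. ?a (Suc k) * ?a (Suc (n - k)))"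
    by (subst sum.atMost_Suc_shift) (auto intro!: sum.cong simp: Suc_diff_le)
  finally have "(\<Sum>k\<le>n+2. ?a k * ?a (n + 2 - k)) =
      ?a (Suc (Suc n)) + (\<Sum>k\<le>n. ?a (Suc k) * ?a (Suc (n - k))) + ?a (Suc (Suc n))"
    by (simp del: gbinomial_Suc)
  also have "(\<Sum>k\<le>n. ?a (Suc k) * ?a (Suc (n - k))) =
      (\<Sum>k\<le>n. (- 1) ^ n / (4 * 4 ^ n) * (catalan k * catalan (n - k)))"
  proof (intro sum.cong refl)
    fix k assume "k \<in> {..n}"
    then have s: "(- 1 :: real) ^ n = (- 1) ^ k * (- 1) ^ (n - k)" "(4 :: real) ^ n = 4 ^ k * 4 ^ (n - k)"
      by (simp_all flip: power_add)
    show "?a (Suc k) * ?a (Suc (n - k)) = (- 1) ^ n / (4 * 4 ^ n) * (catalan k * catalan (n - k))"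
      unfolding gbinomial_half_Suc s by simp
  qed
  finally have "?a (Suc (Suc n)) + (- 1) ^ n / (4 * 4 ^ n) * (\<Sum>i\<le>n. catalan i * catalan (n - i)) + ?a (Suc (Suc n)) = 0"
    unfolding 0 by (simp only: sum_distrib_left)
  then have "(- 1) ^ n / (4 * 4 ^ n) * ((\<Sum>i\<le>n. catalan i * catalan (n - i)) - catalan (Suc n)) = 0"
    unfolding gbinomial_half_Suc by (simp add: right_diff_distrib)
  then show ?thesis by simp
qed


section \<open>Free moments of words\<close>

text \<open>
  The joint moments of free standard semicircular elements, one for each letter: the first letter is
  paired with an equal later one, and the pairing splits the rest of the word in two.
\<close>

fun free_moment :: "'c list \<Rightarrow> real" where
  "free_moment [] = 1"
| "free_moment (c # w) =
    (\<Sum>k<length w. if w ! k = c then free_moment (take k w) * free_moment (drop (Suc k) w) else 0)"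

definition semicircle_moment :: "nat \<Rightarrow> real" where
  "semicircle_moment n = (if even n then catalan (n div 2) else 0)"

text \<open>\<open>catalan_Suc\<close> with zeros inserted at the odd indices: the form in which
  \<open>free_moment\<close> unfolds on a word with a single letter.\<close>

lemma semicircle_moment_Suc:
  "semicircle_moment (Suc n) = (\<Sum>k<n. semicircle_moment k * semicircle_moment (n - Suc k))"
proof (cases "even n")
  case True
  have "semicircle_moment k * semicircle_moment (n - Suc k) = 0" if "k < n" for k
    using True that by (auto simp: semicircle_moment_def)
  then have "(\<Sum>k<n. semicircle_moment k * semicircle_moment (n - Suc k)) = 0"
    by (intro sum.neutral) auto
  then show ?thesis using True by (simp add: semicircle_moment_def)
next
  case False
  then obtain t where t: "n = Suc (2 * t)" by (auto elim: oddE)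
  have "(\<Sum>k<n. semicircle_moment k * semicircle_moment (n - Suc k)) =
      (\<Sum>k\<in>(\<lambda>i. 2 * i) ` {..t}. semicircle_moment k * semicircle_moment (n - Suc k))"
  proof (rule sum.mono_neutral_right)
    show "\<forall>k\<in>{..<n} - (\<lambda>i. 2 * i) ` {..t}. semicircle_moment k * semicircle_moment (n - Suc k) = 0"
    proof
      fix k assume k: "k \<in> {..<n} - (\<lambda>i. 2 * i) ` {..t}"
      have "odd k"
      proof
        assume "even k"
        then obtain i where "k = 2 * i" by (elim evenE)
        then show False using k t by auto
      qed
      then show "semicircle_moment k * semicircle_moment (n - Suc k) = 0"
        by (simp add: semicircle_moment_def)
    qed
  qed (auto simp: t)
  also have "\<dots> = (\<Sum>i\<le>t. catalan i * catalan (t - i))"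
  proof (subst sum.reindex)
    have "t - i = (2 * t - 2 * i) div 2" for i by simp
    then show "sum ((\<lambda>k. semicircle_moment k * semicircle_moment (n - Suc k)) \<circ> (\<lambda>i. 2 * i)) {..t} =
        (\<Sum>i\<le>t. catalan i * catalan (t - i))"
      by (intro sum.cong) (auto simp: semicircle_moment_def t)
  qed (auto simp: inj_on_def)
  also have "\<dots> = semicircle_moment (Suc n)"
    by (simp add: semicircle_moment_def t catalan_Suc)
  finally show ?thesis by simp
qed

lemma free_moment_replicate: "free_moment (replicate n c) = semicircle_moment n"
proof (induction n rule: less_induct)
  case (less n)
  show ?case
  proof (cases n)
    case 0
    then show ?thesis by (simp add: semicircle_moment_def catalan_0)
  next
    case (Suc n')
    have "free_moment (replicate n c) =
        (\<Sum>k<n'. free_moment (replicate k c) * free_moment (replicate (n' - Suc k) c))"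
      unfolding Suc by (simp add: min_def)
    also have "\<dots> = (\<Sum>k<n'. semicircle_moment k * semicircle_moment (n' - Suc k))"
      by (intro sum.cong refl arg_cong2[of _ _ _ _ "(*)"] less.IH) (auto simp: Suc)
    finally show ?thesis by (simp add: semicircle_moment_Suc Suc)
  qed
qed

lemma count_list_split:
  "k < length w \<Longrightarrow> count_list w b = count_list (take k w) b + (if w ! k = b then 1 else 0) + count_list (drop (Suc k) w) b"
  by (subst id_take_nth_drop[of k w]) (auto simp del: append_take_drop_id)

text \<open>Removing the first letter and its partner deletes either no copy of \<open>b\<close> or
  two of them, so one of the two remaining factors again contains \<open>b\<close> an odd number of
  times.\<close>

lemma free_moment_odd: "odd (count_list w b) \<Longrightarrow> free_moment w = 0"
proof (induction w rule: length_induct)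
  case (1 w)
  show ?case
  proof (cases w)
    case Nil
    then show ?thesis using 1 by simp
  next
    case (Cons c v)
    have "(if v ! k = c then free_moment (take k v) * free_moment (drop (Suc k) v) else 0) = 0"
      if k: "k < length v" for k
    proof (cases "v ! k = c")
      case True
      have "odd (count_list (take k v) b) \<or> odd (count_list (drop (Suc k) v) b)"
        using 1(2) k True unfolding Cons by (auto simp: count_list_split[OF k] split: if_splits)
      then have "free_moment (take k v) = 0 \<or> free_moment (drop (Suc k) v) = 0"
        using 1(1) k unfolding Cons by (elim disj_forward) auto
      then show ?thesis by auto
    qed simp
    then show ?thesis unfolding Cons by simp
  qed
qed

lemma sum_shift_lessThan: "(\<Sum>k<m + n. f k) = (\<Sum>k<m. f k) + (\<Sum>k<n. f (m + k))" for f :: "nat \<Rightarrow> 'a::comm_monoid_add"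
  by (induction n) (simp_all add: add.assoc)

text \<open>The two letters \<open>b\<close> can only be paired with each other and, being adjacent,
  cross nothing; deleting them leaves a word in \<open>a\<close> alone. For positive
  \<open>m\<close>, the block lies in the right factor of the recursion when the partner of the
  first letter precedes it, and in the left factor otherwise.\<close>

lemma free_moment_insert_pair:
  assumes "a \<noteq> b"
  shows "free_moment (replicate m a @ b # b # replicate n a) = semicircle_moment (m + n)"
proof (induction m arbitrary: n rule: less_induct)
  case (less m)
  show ?case
  proof (cases m)
    case 0
    have "(\<Sum>k<Suc n. if (b # replicate n a) ! k = b
        then free_moment (take k (b # replicate n a)) * free_moment (drop (Suc k) (b # replicate n a)) else 0) =
        free_moment (replicate n a)"
      by (subst sum.lessThan_Suc_shift) (use assms in simp)
    then show ?thesis by (simp add: 0 free_moment_replicate)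
  next
    case (Suc m')
    let ?v = "replicate m' a @ b # b # replicate n a"
    let ?f = "\<lambda>k. if ?v ! k = a then free_moment (take k ?v) * free_moment (drop (Suc k) ?v) else 0"
    have 1: "?f k = semicircle_moment k * semicircle_moment (m' + n - Suc k)" if "k < m'" for k
    proof -
      have "drop (Suc k) ?v = replicate (m' - Suc k) a @ b # b # replicate n a"
        using that by simp
      moreover have "take k ?v = replicate k a" using that by (simp add: min_def)
      moreover have "m' - Suc k + n = m' + n - Suc k" using that by simp
      ultimately show ?thesis using that less.IH[of "m' - Suc k" n]
        by (simp add: nth_append free_moment_replicate Suc)
    qed
    have 2: "?f (m' + (2 + k)) = semicircle_moment (m' + k) * semicircle_moment (m' + n - Suc (m' + k))" if "k < n" for k
    proof -
      have "take (m' + (2 + k)) ?v = replicate m' a @ b # b # replicate k a"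
        using that by (simp add: min_def)
      moreover have "drop (Suc (m' + (2 + k))) ?v = replicate (n - Suc k) a"
        by (simp add: eval_nat_numeral)
      ultimately show ?thesis using that less.IH[of m' k]
        by (simp add: nth_append free_moment_replicate Suc)
    qed
    have "free_moment (replicate m a @ b # b # replicate n a) = (\<Sum>k<m' + (2 + n). ?f k)"
      unfolding Suc by simp
    \<comment> \<open>The two positions of \<open>b\<close> contribute nothing, and without them the
      outer pieces fit together to the semicircle recursion over \<open>m' + n\<close>
      positions.\<close>
    also have "\<dots> = (\<Sum>k<m'. ?f k) + ((\<Sum>k<2. ?f (m' + k)) + (\<Sum>k<n. ?f (m' + (2 + k))))"
      by (simp only: sum_shift_lessThan)
    also have "(\<Sum>k<2. ?f (m' + k)) = 0"
      using assms by (simp add: numeral_2_eq_2 nth_append)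
    also have "(\<Sum>k<m'. ?f k) = (\<Sum>k<m'. semicircle_moment k * semicircle_moment (m' + n - Suc k))"
      by (intro sum.cong refl 1) auto
    also have "(\<Sum>k<n. ?f (m' + (2 + k))) =
        (\<Sum>k<n. semicircle_moment (m' + k) * semicircle_moment (m' + n - Suc (m' + k)))"
      by (intro sum.cong refl 2) auto
    also have "(\<Sum>k<m'. semicircle_moment k * semicircle_moment (m' + n - Suc k)) + (0 + \<dots>) =
        semicircle_moment (Suc (m' + n))"
      by (simp add: semicircle_moment_Suc sum_shift_lessThan)
    finally show ?thesis by (simp add: Suc)
  qed
qed


section \<open>Walk sums\<close>

text \<open>The vertex set \<open>S\<close> is an argument because the induction over words deletes
  vertices: shrinking \<open>S\<close> means passing to a principal minor.\<close>

fun wprod :: "('c \<Rightarrow> nat \<Rightarrow> nat \<Rightarrow> complex) \<Rightarrow> nat set \<Rightarrow> 'c list \<Rightarrow> nat \<Rightarrow> nat \<Rightarrow> complex" where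
  "wprod z S [] i j = (if i = j then 1 else 0)"
| "wprod z S (c # w) i j = (\<Sum>l\<in>S. z c i l * wprod z S w l j)"

lemma wprod_append:
  assumes "finite S" "i \<in> S"
  shows "wprod z S (u @ v) i j = (\<Sum>l\<in>S. wprod z S u i l * wprod z S v l j)"
  using assms(2)
proof (induction u arbitrary: i)
  case Nil
  have "(\<Sum>l\<in>S. (if i = l then 1 else 0) * wprod z S v l j) = (\<Sum>l\<in>S. if l = i then wprod z S v l j else 0)"
    by (intro sum.cong) auto
  then show ?case using assms(1) Nil by simp
next
  case (Cons c u)
  have "wprod z S ((c # u) @ v) i j = (\<Sum>k\<in>S. \<Sum>l\<in>S. z c i k * wprod z S u k l * wprod z S v l j)"
    using Cons by (simp add: sum_distrib_left mult.assoc)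
  also have "\<dots> = (\<Sum>l\<in>S. \<Sum>k\<in>S. z c i k * wprod z S u k l * wprod z S v l j)"
    by (rule sum.swap)
  finally show ?case by (simp add: sum_distrib_right)
qed

definition hermitian_on :: "nat set \<Rightarrow> ('c \<Rightarrow> nat \<Rightarrow> nat \<Rightarrow> complex) \<Rightarrow> bool" where
  "hermitian_on S z \<longleftrightarrow> (\<forall>c. \<forall>i\<in>S. \<forall>j\<in>S. cnj (z c i j) = z c j i)"

lemma wprod_cnj:
  assumes "finite S" "hermitian_on S z" "i \<in> S" "j \<in> S"
  shows "cnj (wprod z S w i j) = wprod z S (rev w) j i"
  using assms(3,4)
proof (induction w arbitrary: i)
  case (Cons c w)
  have "cnj (wprod z S (c # w) i j) = (\<Sum>l\<in>S. wprod z S (rev w) j l * z c l i)"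
    using Cons assms(2) by (auto simp: hermitian_on_def mult.commute intro!: sum.cong)
  also have "\<dots> = (\<Sum>l\<in>S. wprod z S (rev w) j l * wprod z S [c] l i)"
  proof (intro sum.cong refl)
    fix l assume "l \<in> S"
    have "wprod z S [c] l i = (\<Sum>k\<in>S. if k = i then z c l k else 0)"
      by (auto intro: sum.cong)
    then have "wprod z S [c] l i = z c l i"
      using assms(1) Cons by simp
    then show "wprod z S (rev w) j l * z c l i = wprod z S (rev w) j l * wprod z S [c] l i"
      by simp
  qed
  finally show ?case using wprod_append[OF assms(1) Cons.prems(2), of z "rev w" "[c]"] by simp
qed auto

lemma wprod_rev_diag:
  assumes "finite S" "hermitian_on S z" "i \<in> S"
  shows "wprod z S (w @ rev w) i i = complex_of_real (\<Sum>l\<in>S. (cmod (wprod z S w i l))\<^sup>2)"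
proof -
  have "wprod z S (w @ rev w) i i = (\<Sum>l\<in>S. wprod z S w i l * wprod z S (rev w) l i)"
    by (rule wprod_append) (use assms in auto)
  also have "\<dots> = (\<Sum>l\<in>S. wprod z S w i l * cnj (wprod z S w i l))"
    using wprod_cnj[OF assms(1,2,3)] by (intro sum.cong refl) simp
  finally show ?thesis
    by (simp only: of_real_sum complex_norm_square)
qed

text \<open>An entry is bounded by the norm of its row, which \<open>wprod_rev_diag\<close>
  identifies with a diagonal entry. This holds at every sample point and converts powers of entries
  into longer words.\<close>

lemma wprod_sq_le:
  assumes "finite S" "hermitian_on S z" "i \<in> S" "j \<in> S"
  shows "(cmod (wprod z S w i j))\<^sup>2 \<le> cmod (wprod z S (w @ rev w) i i)"
proof -
  have "(cmod (wprod z S w i j))\<^sup>2 \<le> (\<Sum>l\<in>S. (cmod (wprod z S w i l))\<^sup>2)"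
    using assms by (intro member_le_sum) auto
  also have "\<dots> = cmod (wprod z S (w @ rev w) i i)"
    unfolding wprod_rev_diag[OF assms(1,2,3)] norm_of_real by (simp add: sum_nonneg)
  finally show ?thesis .
qed

text \<open>A walk from \<open>p\<close> to \<open>i\<close> is cut at its first visit to
  \<open>i\<close>: the \<open>k\<close> steps before the hitting one stay in the minor, and the
  rest of the walk is unrestricted.\<close>

lemma wprod_first_hit:
  assumes "finite S" "i \<in> S" "p \<in> S - {i}"
  shows "wprod z S w p i =
    (\<Sum>k<length w. (\<Sum>q\<in>S - {i}. wprod z (S - {i}) (take k w) p q * z (w ! k) q i) *
       wprod z S (drop (Suc k) w) i i)"
  using assms(3)
proof (induction w arbitrary: p)
  case (Cons c w)
  let ?S = "S - {i}"
  let ?R = "\<lambda>w k. wprod z S (drop (Suc k) w) i i"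
  have "wprod z S (c # w) p i = z c p i * wprod z S w i i + (\<Sum>l\<in>?S. z c p l * wprod z S w l i)"
    using assms by (simp add: sum.remove)
  also have "(\<Sum>l\<in>?S. z c p l * wprod z S w l i) =
      (\<Sum>l\<in>?S. \<Sum>k<length w. \<Sum>q\<in>?S. z c p l * wprod z ?S (take k w) l q * z (w ! k) q i * ?R w k)"
    by (intro sum.cong refl) (simp add: Cons.IH sum_distrib_left sum_distrib_right mult.assoc)
  also have "\<dots> = (\<Sum>k<length w. \<Sum>q\<in>?S. \<Sum>l\<in>?S. z c p l * wprod z ?S (take k w) l q * z (w ! k) q i * ?R w k)"
    by (subst sum.swap, subst (2) sum.swap) simp
  also have "\<dots> = (\<Sum>k<length w. (\<Sum>q\<in>?S. wprod z ?S (take (Suc k) (c # w)) p q * z ((c # w) ! Suc k) q i) * ?R (c # w) (Suc k))"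
    by (simp add: sum_distrib_right)
  also have "z c p i * wprod z S w i i =
      (\<Sum>q\<in>?S. wprod z ?S (take 0 (c # w)) p q * z ((c # w) ! 0) q i) * ?R (c # w) 0"
  proof -
    have "(\<Sum>q\<in>?S. (if p = q then 1 else 0) * z c q i) = (\<Sum>q\<in>?S. if q = p then z c q i else 0)"
      by (intro sum.cong) auto
    then show ?thesis using assms(1) Cons.prems by simp
  qed
  finally show ?case by (simp only: list.size sum.lessThan_Suc_shift add_0_right add_Suc_right)
qed (use assms in auto)

text \<open>The first step is a loop or leaves \<open>i\<close>, and in the second case
  \<open>wprod_first_hit\<close> applies. Only the bracket has coefficients free of column
  \<open>i\<close>; the tail \<open>drop (Suc k) w\<close> may revisit \<open>i\<close>.\<close>

lemma wprod_first_return: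
  assumes "finite S" "i \<in> S"
  shows "wprod z S (c # w) i i = z c i i * wprod z S w i i +
    (\<Sum>k<length w. (\<Sum>p\<in>S - {i}. \<Sum>q\<in>S - {i}. z c i p * z (w ! k) q i * wprod z (S - {i}) (take k w) p q) *
       wprod z S (drop (Suc k) w) i i)"
proof -
  let ?S = "S - {i}"
  have "wprod z S (c # w) i i = z c i i * wprod z S w i i + (\<Sum>l\<in>?S. z c i l * wprod z S w l i)"
    using assms by (simp add: sum.remove)
  also have "(\<Sum>l\<in>?S. z c i l * wprod z S w l i) =
      (\<Sum>l\<in>?S. \<Sum>k<length w. (\<Sum>q\<in>?S. z c i l * z (w ! k) q i * wprod z ?S (take k w) l q) * wprod z S (drop (Suc k) w) i i)"
    by (intro sum.cong refl)
       (simp add: wprod_first_hit[OF assms] sum_distrib_left sum_distrib_right mult.assoc mult.left_commute)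
  also have "\<dots> = (\<Sum>k<length w. (\<Sum>l\<in>?S. \<Sum>q\<in>?S. z c i l * z (w ! k) q i * wprod z ?S (take k w) l q) * wprod z S (drop (Suc k) w) i i)"
    by (subst sum.swap) (simp add: sum_distrib_right)
  finally show ?thesis .
qed


section \<open>Random variables with all moments\<close>

text \<open>The intersection of all L^p spaces is an algebra closed under conjugation, so
  integrability follows from closure rules without tracking exponents.\<close>

definition all_moments :: "'a measure \<Rightarrow> ('a \<Rightarrow> complex) set" where
  "all_moments M = {f \<in> borel_measurable M. \<forall>p::nat. integrable M (\<lambda>x. cmod (f x) ^ p)}"

lemma all_momentsD:
  assumes "f \<in> all_moments M"
  shows all_moments_measurable: "f \<in> borel_measurable M"
    and all_moments_integrable_power: "integrable M (\<lambda>x. cmod (f x) ^ p)"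
    and all_moments_integrable: "integrable M f"
    and all_moments_integrable_norm: "integrable M (\<lambda>x. cmod (f x))"
proof -
  show 1: "f \<in> borel_measurable M" "integrable M (\<lambda>x. cmod (f x) ^ p)" for p
    using assms by (auto simp: all_moments_def)
  show 2: "integrable M (\<lambda>x. cmod (f x))"
    using 1(2)[of 1] by simp
  show "integrable M f"
    using 2 1(1) by (rule integrable_norm_cancel)
qed

lemma all_moments_dominated:
  assumes "f \<in> borel_measurable M" "\<And>p. integrable M (g p)"
    and "\<And>p x. x \<in> space M \<Longrightarrow> cmod (f x) ^ p \<le> (g p x :: real)"
  shows "f \<in> all_moments M"
  unfolding all_moments_def
proof (intro CollectI conjI allI)
  fix p :: nat
  show "integrable M (\<lambda>x. cmod (f x) ^ p)"
  proof (rule Bochner_Integration.integrable_bound[OF assms(2)[of p]])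
    show "AE x in M. norm (cmod (f x) ^ p) \<le> norm (g p x)"
      using assms(3)[of _ p] by (intro AE_I2) (simp add: norm_power order_trans[OF _ abs_ge_self])
  qed (use assms(1) in measurable)
qed fact

lemma power_mult_le_sum: "(a * b) ^ p \<le> a ^ (2 * p) + b ^ (2 * p)" if "0 \<le> a" "0 \<le> b" for a b :: real
proof -
  have "2 * (a ^ p * b ^ p) \<le> (a ^ p)\<^sup>2 + (b ^ p)\<^sup>2"
    using sum_squares_bound[of "a ^ p" "b ^ p"] by (simp add: mult.assoc)
  moreover have "0 \<le> a ^ p * b ^ p" using that by simp
  ultimately show ?thesis by (simp add: power_mult_distrib power_mult[symmetric] mult.commute)
qed

lemma power_add_le_sum: "(a + b) ^ p \<le> 2 ^ p * (a ^ p + b ^ p)" if "0 \<le> a" "0 \<le> b" for a b :: real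
proof -
  have "(a + b) ^ p \<le> (2 * max a b) ^ p"
    using that by (intro power_mono) auto
  also have "\<dots> \<le> 2 ^ p * (a ^ p + b ^ p)"
    using that by (auto simp: power_mult_distrib max_def)
  finally show ?thesis .
qed

lemma all_moments_mult:
  assumes "f \<in> all_moments M" "g \<in> all_moments M"
  shows "(\<lambda>x. f x * g x) \<in> all_moments M"
proof (rule all_moments_dominated[where g = "\<lambda>p x. cmod (f x) ^ (2 * p) + cmod (g x) ^ (2 * p)"])
  show "(\<lambda>x. f x * g x) \<in> borel_measurable M"
    using assms[THEN all_moments_measurable] by measurable
  show "integrable M (\<lambda>x. cmod (f x) ^ (2 * p) + cmod (g x) ^ (2 * p))" for p
    using assms by (intro Bochner_Integration.integrable_add all_moments_integrable_power)
qed (simp add: norm_mult power_mult_le_sum)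

lemma all_moments_add:
  assumes "f \<in> all_moments M" "g \<in> all_moments M"
  shows "(\<lambda>x. f x + g x) \<in> all_moments M"
proof (rule all_moments_dominated[where g = "\<lambda>p x. 2 ^ p * (cmod (f x) ^ p + cmod (g x) ^ p)"])
  show "(\<lambda>x. f x + g x) \<in> borel_measurable M"
    using assms[THEN all_moments_measurable] by measurable
  show "integrable M (\<lambda>x. 2 ^ p * (cmod (f x) ^ p + cmod (g x) ^ p))" for p
    using assms by (intro integrable_mult_right Bochner_Integration.integrable_add all_moments_integrable_power)
  show "cmod (f x + g x) ^ p \<le> 2 ^ p * (cmod (f x) ^ p + cmod (g x) ^ p)" for p x
    by (rule order_trans[OF power_mono[OF norm_triangle_ineq] power_add_le_sum]) auto
qed

lemma all_moments_const: "finite_measure M \<Longrightarrow> (\<lambda>_. c) \<in> all_moments M"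
  by (simp add: all_moments_def finite_measure.integrable_const)

lemma all_moments_cnj: "f \<in> all_moments M \<Longrightarrow> (\<lambda>x. cnj (f x)) \<in> all_moments M"
  by (auto simp: all_moments_def intro: borel_measurable_continuous_onI[THEN measurable_compose[rotated]] continuous_intros)

lemma all_moments_cmult: "finite_measure M \<Longrightarrow> f \<in> all_moments M \<Longrightarrow> (\<lambda>x. c * f x) \<in> all_moments M"
  by (intro all_moments_mult all_moments_const)

lemma all_moments_diff:
  assumes "finite_measure M" "f \<in> all_moments M" "g \<in> all_moments M"
  shows "(\<lambda>x. f x - g x) \<in> all_moments M"
  using all_moments_add[OF assms(2) all_moments_cmult[OF assms(1,3), of "-1"]] by simp

lemma all_moments_sum:
  assumes "finite_measure M" "\<And>i. i \<in> I \<Longrightarrow> f i \<in> all_moments M"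
  shows "(\<lambda>x. \<Sum>i\<in>I. f i x) \<in> all_moments M"
  using assms(2)
  by (induction I rule: infinite_finite_induct) (auto intro: all_moments_const all_moments_add assms(1))

lemma all_moments_cong:
  "(\<And>x. x \<in> space M \<Longrightarrow> f x = g x) \<Longrightarrow> f \<in> all_moments M \<longleftrightarrow> g \<in> all_moments M"
  unfolding all_moments_def
  by (auto cong: measurable_cong Bochner_Integration.integrable_cong)

lemma all_moments_integrable_mult_norm:
  assumes "f \<in> all_moments M" "g \<in> all_moments M"
  shows "integrable M (\<lambda>x. cmod (f x) ^ p * cmod (g x) ^ q)"
proof -
  have "(\<lambda>x. complex_of_real (cmod (f x) ^ p)) \<in> all_moments M" if "f \<in> all_moments M" for f and p :: nat
  proof -
    have "(\<lambda>x. complex_of_real (cmod (f x) ^ p)) \<in> borel_measurable M"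
      using all_moments_measurable[OF that] by measurable
    then show ?thesis using all_moments_integrable_power[OF that]
      by (auto simp: all_moments_def norm_power power_mult[symmetric])
  qed
  from all_moments_integrable_norm[OF all_moments_mult[OF this[OF assms(1)] this[OF assms(2)]]]
  show ?thesis by (simp add: norm_mult norm_power)
qed

section \<open>Cauchy-Schwarz and comparison of moments\<close>

lemma Cauchy_Schwarz_all_moments:
  assumes "f \<in> all_moments M" "g \<in> all_moments M"
  shows "(\<integral>x. cmod (f x) * cmod (g x) \<partial>M) \<le> sqrt (\<integral>x. (cmod (f x))\<^sup>2 \<partial>M) * sqrt (\<integral>x. (cmod (g x))\<^sup>2 \<partial>M)"
proof -
  let ?I = "\<integral>x. cmod (f x) * cmod (g x) \<partial>M"
  have "(\<integral>\<^sup>+x. ennreal (cmod (f x)) * ennreal (cmod (g x)) \<partial>M)\<^sup>2 \<le>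
      (\<integral>\<^sup>+x. ennreal (cmod (f x)) ^ 2 \<partial>M) * (\<integral>\<^sup>+x. ennreal (cmod (g x)) ^ 2 \<partial>M)"
    using assms[THEN all_moments_measurable] by (intro Cauchy_Schwarz_nn_integral; measurable)
  also have "(\<integral>\<^sup>+x. ennreal (cmod (f x)) * ennreal (cmod (g x)) \<partial>M) = ennreal ?I"
    using all_moments_integrable_mult_norm[OF assms, of 1 1]
    by (simp add: ennreal_mult[symmetric] nn_integral_eq_integral)
  also have "(\<integral>\<^sup>+x. ennreal (cmod (f x)) ^ 2 \<partial>M) = ennreal (\<integral>x. (cmod (f x))\<^sup>2 \<partial>M)"
    using all_moments_integrable_power[OF assms(1), of 2]
    by (simp add: ennreal_power nn_integral_eq_integral)
  also have "(\<integral>\<^sup>+x. ennreal (cmod (g x)) ^ 2 \<partial>M) = ennreal (\<integral>x. (cmod (g x))\<^sup>2 \<partial>M)"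
    using all_moments_integrable_power[OF assms(2), of 2]
    by (simp add: ennreal_power nn_integral_eq_integral)
  finally have "?I\<^sup>2 \<le> (\<integral>x. (cmod (f x))\<^sup>2 \<partial>M) * (\<integral>x. (cmod (g x))\<^sup>2 \<partial>M)"
    by (simp add: ennreal_power ennreal_mult[symmetric])
  then have "?I \<le> sqrt ((\<integral>x. (cmod (f x))\<^sup>2 \<partial>M) * (\<integral>x. (cmod (g x))\<^sup>2 \<partial>M))"
    by (rule real_le_rsqrt)
  then show ?thesis by (simp add: real_sqrt_mult)
qed

text \<open>Cauchy-Schwarz for the factorisation of the square into the powers 1/2 and 3/2 of the
  modulus. It upgrades smallness in L1 to smallness in L2 when third moments are bounded.\<close>

lemma second_moment_le:
  assumes "f \<in> all_moments M"
  shows "(\<integral>x. (cmod (f x))\<^sup>2 \<partial>M) \<le> sqrt (\<integral>x. cmod (f x) \<partial>M) * sqrt (\<integral>x. cmod (f x) ^ 3 \<partial>M)"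
proof -
  let ?g = "\<lambda>p x. complex_of_real (sqrt (cmod (f x) ^ p))"
  have "?g p \<in> all_moments M" for p
  proof (rule all_moments_dominated[where g = "\<lambda>q x. cmod (f x) ^ 0 + cmod (f x) ^ (p * q)"])
    show "?g p \<in> borel_measurable M"
      using all_moments_measurable[OF assms] by measurable
    show "integrable M (\<lambda>x. cmod (f x) ^ 0 + cmod (f x) ^ (p * q))" for q
      using assms by (intro Bochner_Integration.integrable_add all_moments_integrable_power)
    show "cmod (?g p x) ^ q \<le> cmod (f x) ^ 0 + cmod (f x) ^ (p * q)" for q x
    proof -
      have "sqrt y \<le> 1 + y" if "y \<ge> 0" for y :: real
        using that by (intro real_le_lsqrt) (auto simp: power2_eq_square algebra_simps)
      from this[of "cmod (f x) ^ (p * q)"] show ?thesis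
        by (simp add: real_sqrt_power[symmetric] power_mult)
    qed
  qed
  from Cauchy_Schwarz_all_moments[OF this this, of 1 3]
  have "(\<integral>x. sqrt (cmod (f x)) * sqrt (cmod (f x) ^ 3) \<partial>M) \<le>
      sqrt (\<integral>x. cmod (f x) \<partial>M) * sqrt (\<integral>x. cmod (f x) ^ 3 \<partial>M)"
    by simp
  also have "(\<lambda>x. sqrt (cmod (f x)) * sqrt (cmod (f x) ^ 3)) = (\<lambda>x. (cmod (f x))\<^sup>2)"
    by (rule ext, subst real_sqrt_mult[symmetric]) (rule real_sqrt_unique, auto simp: power_mult[symmetric] power_numeral_reduce)
  finally show ?thesis .
qed

lemma (in prob_space) moment_le:
  assumes "f \<in> all_moments M" "p \<le> q"
  shows "expectation (\<lambda>x. cmod (f x) ^ p) \<le> 1 + expectation (\<lambda>x. cmod (f x) ^ q)"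
proof -
  have "expectation (\<lambda>x. cmod (f x) ^ p) \<le> expectation (\<lambda>x. 1 + cmod (f x) ^ q)"
  proof (rule integral_mono)
    fix x
    show "cmod (f x) ^ p \<le> 1 + cmod (f x) ^ q"
    proof (cases "cmod (f x) \<le> 1")
      case True
      then show ?thesis by (simp add: power_le_one add_increasing2)
    next
      case False
      then have "cmod (f x) ^ p \<le> cmod (f x) ^ q" by (intro power_increasing assms(2)) simp
      then show ?thesis by simp
    qed
  qed (use assms in \<open>auto intro!: all_moments_integrable_power\<close>)
  also have "\<dots> = 1 + expectation (\<lambda>x. cmod (f x) ^ q)"
    using assms by (subst Bochner_Integration.integral_add) (auto intro!: all_moments_integrable_power simp: prob_space)
  finally show ?thesis .
qed


section \<open>Convergence with bounded moments\<close>

locale prob_sequence =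
  fixes M :: "nat \<Rightarrow> 'a measure" and N0 :: nat
  assumes prob_space_M: "N \<ge> N0 \<Longrightarrow> prob_space (M N)"
begin

lemma finite_measure_M: "N \<ge> N0 \<Longrightarrow> finite_measure (M N)"
  using prob_space_M by (simp add: prob_space_def)

definition moment_bounded :: "(nat \<Rightarrow> 'a \<Rightarrow> complex) \<Rightarrow> bool" where
  "moment_bounded Z \<longleftrightarrow> (\<forall>N\<ge>N0. Z N \<in> all_moments (M N)) \<and>
     (\<forall>p. \<exists>K. \<forall>N\<ge>N0. (\<integral>x. cmod (Z N x) ^ p \<partial>M N) \<le> K)"

text \<open>L1 convergence alone is not preserved by products; together with bounded moments of
  every order it is. The limits are constants, so products of entries factorise in the
  limit.\<close>

definition tends :: "(nat \<Rightarrow> 'a \<Rightarrow> complex) \<Rightarrow> complex \<Rightarrow> bool" where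
  "tends Z z \<longleftrightarrow> moment_bounded Z \<and> (\<lambda>N. \<integral>x. cmod (Z N x - z) \<partial>M N) \<longlonglongrightarrow> 0"

lemma moment_boundedD:
  assumes "moment_bounded Z"
  shows "N \<ge> N0 \<Longrightarrow> Z N \<in> all_moments (M N)"
    and "\<exists>K. \<forall>N\<ge>N0. (\<integral>x. cmod (Z N x) ^ p \<partial>M N) \<le> K"
  using assms by (auto simp: moment_bounded_def)

lemma moment_bounded_const: "moment_bounded (\<lambda>_ _. c)"
  unfolding moment_bounded_def
  using prob_space_M by (auto intro!: all_moments_const finite_measure_M exI[of _ "cmod c ^ _"] simp: prob_space.prob_space)

lemma moment_bounded_dominated:
  assumes "\<And>N. N \<ge> N0 \<Longrightarrow> Z N \<in> all_moments (M N)" "moment_bounded X" "moment_bounded Y"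
    and "\<And>N x. N \<ge> N0 \<Longrightarrow> x \<in> space (M N) \<Longrightarrow> cmod (Z N x) ^ p \<le> C * (cmod (X N x) ^ q + cmod (Y N x) ^ q)" "C \<ge> 0"
  shows "\<exists>K. \<forall>N\<ge>N0. (\<integral>x. cmod (Z N x) ^ p \<partial>M N) \<le> K"
proof -
  obtain K L where KL: "\<And>N. N \<ge> N0 \<Longrightarrow> (\<integral>x. cmod (X N x) ^ q \<partial>M N) \<le> K"
      "\<And>N. N \<ge> N0 \<Longrightarrow> (\<integral>x. cmod (Y N x) ^ q \<partial>M N) \<le> L"
    using moment_boundedD(2)[OF assms(2), of q] moment_boundedD(2)[OF assms(3), of q] by auto
  have "(\<integral>x. cmod (Z N x) ^ p \<partial>M N) \<le> C * (K + L)" if N: "N \<ge> N0" for N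
  proof -
    have i: "integrable (M N) (\<lambda>x. cmod (X N x) ^ q)" "integrable (M N) (\<lambda>x. cmod (Y N x) ^ q)"
      using moment_boundedD(1)[OF assms(2) N] moment_boundedD(1)[OF assms(3) N]
      by (auto intro: all_moments_integrable_power)
    have "(\<integral>x. cmod (Z N x) ^ p \<partial>M N) \<le> (\<integral>x. C * (cmod (X N x) ^ q + cmod (Y N x) ^ q) \<partial>M N)"
      using assms(4)[OF N] by (intro integral_mono all_moments_integrable_power assms(1) N) (auto simp: i)
    also have "\<dots> = C * ((\<integral>x. cmod (X N x) ^ q \<partial>M N) + (\<integral>x. cmod (Y N x) ^ q \<partial>M N))"
      by (simp add: i)
    also have "\<dots> \<le> C * (K + L)"
      using KL[OF N] assms(5) by (intro mult_left_mono add_mono)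
    finally show ?thesis .
  qed
  then show ?thesis by blast
qed

lemma moment_bounded_mult:
  assumes "moment_bounded X" "moment_bounded Y"
  shows "moment_bounded (\<lambda>N x. X N x * Y N x)"
  unfolding moment_bounded_def
proof (intro conjI allI impI)
  show *: "(\<lambda>x. X N x * Y N x) \<in> all_moments (M N)" if "N \<ge> N0" for N
    using assms that by (intro all_moments_mult moment_boundedD)
  show "\<exists>K. \<forall>N\<ge>N0. (\<integral>x. cmod (X N x * Y N x) ^ p \<partial>M N) \<le> K" for p
    by (rule moment_bounded_dominated[OF * assms, where C = 1 and q = "2 * p"])
       (auto simp: norm_mult power_mult_le_sum)
qed

lemma moment_bounded_add:
  assumes "moment_bounded X" "moment_bounded Y"
  shows "moment_bounded (\<lambda>N x. X N x + Y N x)"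
  unfolding moment_bounded_def
proof (intro conjI allI impI)
  show *: "(\<lambda>x. X N x + Y N x) \<in> all_moments (M N)" if "N \<ge> N0" for N
    using assms that by (intro all_moments_add moment_boundedD)
  show "\<exists>K. \<forall>N\<ge>N0. (\<integral>x. cmod (X N x + Y N x) ^ p \<partial>M N) \<le> K" for p
    by (rule moment_bounded_dominated[OF * assms, where C = "2 ^ p" and q = p])
       (auto intro: order_trans[OF power_mono[OF norm_triangle_ineq] power_add_le_sum])
qed

lemma moment_bounded_diff_const: "moment_bounded X \<Longrightarrow> moment_bounded (\<lambda>N x. X N x - c)"
  using moment_bounded_add[OF _ moment_bounded_const[of "-c"], of X] by simp

lemma tendsD:
  assumes "tends Z z"
  shows "moment_bounded Z" "(\<lambda>N. \<integral>x. cmod (Z N x - z) \<partial>M N) \<longlonglongrightarrow> 0"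
  using assms by (auto simp: tends_def)

lemma tends_cong:
  assumes "\<And>N x. N \<ge> N0 \<Longrightarrow> x \<in> space (M N) \<Longrightarrow> Z N x = Y N x" "tends Y z"
  shows "tends Z z"
proof -
  have 1: "(Z N \<in> all_moments (M N)) = (Y N \<in> all_moments (M N))" if "N \<ge> N0" for N
    using assms(1) that by (intro all_moments_cong) auto
  have 2: "(\<integral>x. cmod (Z N x) ^ p \<partial>M N) = (\<integral>x. cmod (Y N x) ^ p \<partial>M N)" if "N \<ge> N0" for N p
    using assms(1) that by (intro Bochner_Integration.integral_cong) auto
  have 3: "(\<integral>x. cmod (Z N x - z) \<partial>M N) = (\<integral>x. cmod (Y N x - z) \<partial>M N)" if "N \<ge> N0" for N
    using assms(1) that by (intro Bochner_Integration.integral_cong) auto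
  have 4: "\<forall>\<^sub>F N in sequentially. (\<integral>x. cmod (Z N x - z) \<partial>M N) = (\<integral>x. cmod (Y N x - z) \<partial>M N)"
    using 3 by (auto simp: eventually_sequentially)
  have "moment_bounded Z"
    using tendsD(1)[OF assms(2)] 1 2 by (simp add: moment_bounded_def)
  then show ?thesis
    using tendsD(2)[OF assms(2)] tendsto_cong[OF 4] by (simp add: tends_def)
qed

lemma tends_const: "tends (\<lambda>_ _. c) c"
  unfolding tends_def by (auto intro: moment_bounded_const)

lemma tends_add:
  assumes "tends X x" "tends Y y"
  shows "tends (\<lambda>N w. X N w + Y N w) (x + y)"
  unfolding tends_def
proof
  note b = assms[THEN tendsD(1)]
  show "moment_bounded (\<lambda>N w. X N w + Y N w)"
    by (intro moment_bounded_add b)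
  show "(\<lambda>N. \<integral>w. cmod (X N w + Y N w - (x + y)) \<partial>M N) \<longlonglongrightarrow> 0"
  proof (rule tendsto_sandwich[where f = "\<lambda>_. 0"])
    show "(\<lambda>N. (\<integral>w. cmod (X N w - x) \<partial>M N) + (\<integral>w. cmod (Y N w - y) \<partial>M N)) \<longlonglongrightarrow> 0"
      using tendsto_add[OF assms[THEN tendsD(2)]] by simp
    show "\<forall>\<^sub>F N in sequentially. (\<integral>w. cmod (X N w + Y N w - (x + y)) \<partial>M N) \<le>
        (\<integral>w. cmod (X N w - x) \<partial>M N) + (\<integral>w. cmod (Y N w - y) \<partial>M N)"
      unfolding eventually_sequentially
    proof (intro exI allI impI)
      fix N assume N: "N \<ge> N0"
      note i = all_moments_integrable_norm[OF moment_boundedD(1)[OF moment_bounded_diff_const[OF b(1)] N]]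
        all_moments_integrable_norm[OF moment_boundedD(1)[OF moment_bounded_diff_const[OF b(2)] N]]
        all_moments_integrable_norm[OF moment_boundedD(1)[OF moment_bounded_diff_const[OF moment_bounded_add[OF b]] N]]
      show "(\<integral>w. cmod (X N w + Y N w - (x + y)) \<partial>M N) \<le>
        (\<integral>w. cmod (X N w - x) \<partial>M N) + (\<integral>w. cmod (Y N w - y) \<partial>M N)"
        unfolding Bochner_Integration.integral_add[OF i(1,2), symmetric]
        by (intro integral_mono Bochner_Integration.integrable_add i)
           (metis add_diff_add norm_triangle_ineq)
    qed
  qed (auto simp: always_eventually)
qed

text \<open>By Cauchy-Schwarz it suffices that \<open>Y\<close> vanishes in L2, and
  \<open>second_moment_le\<close> obtains this from L1 and the third moments.\<close>

lemma tends_mult_zero: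
  assumes "moment_bounded X" "tends Y 0"
  shows "tends (\<lambda>N w. X N w * Y N w) 0"
  unfolding tends_def
proof
  note b = assms(1) tendsD(1)[OF assms(2)]
  show "moment_bounded (\<lambda>N w. X N w * Y N w)"
    by (intro moment_bounded_mult b)
  obtain K L where K: "\<And>N. N \<ge> N0 \<Longrightarrow> (\<integral>w. (cmod (X N w))\<^sup>2 \<partial>M N) \<le> K"
    and L: "\<And>N. N \<ge> N0 \<Longrightarrow> (\<integral>w. cmod (Y N w) ^ 3 \<partial>M N) \<le> L"
    using moment_boundedD(2)[OF b(1), of 2] moment_boundedD(2)[OF b(2), of 3] by auto
  let ?e = "\<lambda>N. \<integral>w. cmod (Y N w) \<partial>M N"
  show "(\<lambda>N. \<integral>w. cmod (X N w * Y N w - 0) \<partial>M N) \<longlonglongrightarrow> 0"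
  proof (rule tendsto_sandwich[where f = "\<lambda>_. 0"])
    have "(\<lambda>N. sqrt K * sqrt (sqrt (?e N) * sqrt L)) \<longlonglongrightarrow> sqrt K * sqrt (sqrt 0 * sqrt L)"
      using tendsD(2)[OF assms(2)] by (intro tendsto_intros) simp
    then show "(\<lambda>N. sqrt K * sqrt (sqrt (?e N) * sqrt L)) \<longlonglongrightarrow> 0" by simp
    show "\<forall>\<^sub>F N in sequentially. (\<integral>w. cmod (X N w * Y N w - 0) \<partial>M N) \<le> sqrt K * sqrt (sqrt (?e N) * sqrt L)"
      unfolding eventually_sequentially
    proof (intro exI allI impI)
      fix N assume N: "N \<ge> N0"
      note m = moment_boundedD(1)[OF b(1) N] moment_boundedD(1)[OF b(2) N]
      have "(\<integral>w. cmod (X N w * Y N w - 0) \<partial>M N) \<le>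
          sqrt (\<integral>w. (cmod (X N w))\<^sup>2 \<partial>M N) * sqrt (\<integral>w. (cmod (Y N w))\<^sup>2 \<partial>M N)"
        using Cauchy_Schwarz_all_moments[OF m] by (simp add: norm_mult)
      also have "\<dots> \<le> sqrt K * sqrt (sqrt (?e N) * sqrt (\<integral>w. cmod (Y N w) ^ 3 \<partial>M N))"
        using K[OF N] second_moment_le[OF m(2)] order_trans[OF integral_nonneg_AE K[OF N]]
        by (intro mult_mono real_sqrt_le_mono) (auto intro!: real_sqrt_ge_zero)
      also have "\<dots> \<le> sqrt K * sqrt (sqrt (?e N) * sqrt L)"
        using L[OF N] order_trans[OF integral_nonneg_AE K[OF N]]
        by (intro mult_mono real_sqrt_le_mono order.refl) (auto intro!: real_sqrt_ge_zero)
      finally show "(\<integral>w. cmod (X N w * Y N w - 0) \<partial>M N) \<le> sqrt K * sqrt (sqrt (?e N) * sqrt L)" .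
    qed
  qed (auto simp: always_eventually)
qed

lemma tends_diff_const: "tends X x \<longleftrightarrow> tends (\<lambda>N w. X N w - x) 0"
proof -
  have "moment_bounded (\<lambda>N w. X N w - x) \<longleftrightarrow> moment_bounded X"
    using moment_bounded_diff_const[of X x] moment_bounded_diff_const[of "\<lambda>N w. X N w - x" "-x"] by auto
  then show ?thesis by (simp add: tends_def)
qed

lemma tends_mult:
  assumes "tends X x" "tends Y y"
  shows "tends (\<lambda>N w. X N w * Y N w) (x * y)"
proof -
  \<comment> \<open>The difference from the limit is split as X Y - x y = X (Y - y) + y (X - x), so
    that each summand has a factor tending to 0.\<close>
  have "tends (\<lambda>N w. X N w * (Y N w - y)) 0"
    by (intro tends_mult_zero tendsD(1)[OF assms(1)] assms(2)[unfolded tends_diff_const[of Y]])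
  moreover have "tends (\<lambda>N w. y * (X N w - x)) 0"
    by (intro tends_mult_zero moment_bounded_const assms(1)[unfolded tends_diff_const[of X]])
  ultimately have "tends (\<lambda>N w. X N w * (Y N w - y) + y * (X N w - x)) (0 + 0)"
    by (rule tends_add)
  then show ?thesis by (subst tends_diff_const) (simp add: algebra_simps)
qed

lemma tends_cmult: "tends X x \<Longrightarrow> tends (\<lambda>N w. c * X N w) (c * x)"
  by (intro tends_mult tends_const)

lemma tends_diff:
  assumes "tends X x" "tends Y y"
  shows "tends (\<lambda>N w. X N w - Y N w) (x - y)"
  using tends_add[OF assms(1) tends_cmult[OF assms(2), of "-1"]] by simp

lemma tends_sum:
  assumes "\<And>i. i \<in> I \<Longrightarrow> tends (\<lambda>N w. X i N w) (x i)"
  shows "tends (\<lambda>N w. \<Sum>i\<in>I. X i N w) (\<Sum>i\<in>I. x i)"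
  using assms by (induction I rule: infinite_finite_induct) (auto intro: tends_const tends_add)

lemma tends_expectation:
  assumes "tends Z z"
  shows "(\<lambda>N. \<integral>x. Z N x \<partial>M N) \<longlonglongrightarrow> z"
proof -
  note b = tendsD(1)[OF assms]
  have "(\<lambda>N. (\<integral>x. Z N x \<partial>M N) - z) \<longlonglongrightarrow> 0"
  proof (rule Lim_null_comparison[OF _ tendsD(2)[OF assms]])
    show "\<forall>\<^sub>F N in sequentially. norm ((\<integral>x. Z N x \<partial>M N) - z) \<le> (\<integral>x. cmod (Z N x - z) \<partial>M N)"
      unfolding eventually_sequentially
    proof (intro exI allI impI)
      fix N assume N: "N \<ge> N0"
      interpret prob_space "M N" by (rule prob_space_M[OF N])
      have "(\<integral>x. Z N x \<partial>M N) - z = (\<integral>x. Z N x - z \<partial>M N)"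
        using all_moments_integrable[OF moment_boundedD(1)[OF b N]] by (simp add: prob_space)
      then show "norm ((\<integral>x. Z N x \<partial>M N) - z) \<le> (\<integral>x. cmod (Z N x - z) \<partial>M N)"
        by simp
    qed
  qed
  then show ?thesis by (simp add: LIM_zero_iff)
qed

end


section \<open>Independent Hermitian arrays\<close>

text \<open>Entries (i, j) and (j, i) are conjugate, so an independent family is indexed by
  unordered edges with a letter. The representative chosen has its smaller index first, as in the
  independence assumption.\<close>

definition edge_key :: "'c \<Rightarrow> nat \<Rightarrow> nat \<Rightarrow> 'c \<times> nat \<times> nat" where
  "edge_key c i j = (c, min i j, max i j)"

lemma edge_key_eq_iff: "edge_key c i j = edge_key c' i' j' \<longleftrightarrow> c = c' \<and> {i, j} = {i', j'}"
  by (auto simp: edge_key_def doubleton_eq_iff min_def max_def)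

fun steps :: "'c list \<Rightarrow> nat \<Rightarrow> nat list \<Rightarrow> ('c \<times> nat \<times> nat) list" where
  "steps (c # w) i (l # ls) = (c, i, l) # steps w l ls"
| "steps _ _ _ = []"

lemma length_steps: "length ls = length w \<Longrightarrow> length (steps w i ls) = length w"
  by (induction w i ls rule: steps.induct) auto

lemma sum_lists_Suc:
  "(\<Sum>ls\<in>{ls. set ls \<subseteq> S \<and> length ls = Suc n}. f ls) =
    (\<Sum>l\<in>S. \<Sum>ls\<in>{ls. set ls \<subseteq> S \<and> length ls = n}. f (l # ls))"
  unfolding sum.cartesian_product
  by (rule sum.reindex_bij_witness[of _ "\<lambda>(l, ls). l # ls" "\<lambda>ls. (hd ls, tl ls)"])
     (auto simp: length_Suc_conv)

lemma wprod_eq_sum_walks: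
  "wprod z S w i j = (\<Sum>ls\<in>{ls. set ls \<subseteq> S \<and> length ls = length w}.
     prod_list (map (\<lambda>(c, i, l). z c i l) (steps w i ls)) * (if last (i # ls) = j then 1 else 0))"
proof (induction w arbitrary: i)
  case Nil
  have "{ls. set ls \<subseteq> S \<and> length ls = length []} = {[]}" by auto
  then show ?case by simp
next
  case (Cons c w)
  show ?case
    unfolding list.size sum_lists_Suc add_0_right add_Suc_right
    by (simp add: Cons.IH sum_distrib_left mult.assoc)
qed

lemma wprod_scale: "wprod (\<lambda>c i j. a * z c i j) S w i j = a ^ length w * wprod z S w i j"
  by (induction w arbitrary: i) (simp_all add: sum_distrib_left mult.assoc mult.left_commute)

text \<open>A walk uses a new edge at each visit to a new vertex.\<close>

lemma card_vertices_le:
  "length ls = length w \<Longrightarrow>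
    card (set (i # ls)) \<le> Suc (card (set (map (\<lambda>(c, i, l). edge_key c i l) (steps w i ls))))"
proof (induction w i ls rule: steps.induct)
  case (1 c w i l ls)
  let ?K = "set (map (\<lambda>(c, i, l). edge_key c i l) (steps w l ls))"
  have IH: "card (set (l # ls)) \<le> Suc (card ?K)" using 1 by simp
  show ?case
  proof (cases "i \<in> set (l # ls)")
    case True
    then have "card (set (i # l # ls)) = card (set (l # ls))"
      by (simp add: insert_absorb)
    also have "\<dots> \<le> Suc (card ?K)" by (rule IH)
    also have "card ?K \<le> card (insert (edge_key c i l) ?K)"
      by (rule card_mono) (simp, rule subset_insertI)
    finally show ?thesis by (simp only: steps.simps list.map list.set prod.case)
  next
    case False
    \<comment> \<open>The walk is consumed from the front, so \<open>i\<close> counts as new when it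
      is not visited later; no later step can then use an edge at \<open>i\<close>.\<close>
    have "{a, b} \<subseteq> set (l # ls)" if "(c', a, b) \<in> set (steps w l ls)" for c' a b
      using that by (induction w l ls rule: steps.induct) auto
    then have "i \<notin> {a, b}" if "(c', a, b) \<in> set (steps w l ls)" for c' a b
      using that False by blast
    then have "edge_key c i l \<notin> ?K"
      by (auto simp: edge_key_eq_iff) blast
    then show ?thesis using IH False by simp
  qed
qed auto

lemma card_set_le_half:
  assumes "\<And>x. x \<in> set xs \<Longrightarrow> count_list xs x \<ge> 2"
  shows "2 * card (set xs) \<le> length xs"
proof -
  have "2 * card (set xs) = (\<Sum>x\<in>set xs. 2)" by simp
  also have "\<dots> \<le> (\<Sum>x\<in>set xs. count_list xs x)"
    using assms by (intro sum_mono)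
  also have "\<dots> = length xs" by (rule sum_count_set) auto
  finally show ?thesis .
qed

text \<open>The vertices other than \<open>i\<close> can be listed in at most N^d ways, and each of
  the \<open>n\<close> positions then has at most \<open>Suc d\<close> choices.\<close>

lemma card_lists_few_vertices:
  assumes "N \<ge> 1" "S \<subseteq> {..<N}"
  shows "card {ls. set ls \<subseteq> S \<and> length ls = n \<and> card (set (i # ls)) \<le> Suc d} \<le> N ^ d * Suc d ^ n"
proof -
  let ?Y = "{ys. set ys \<subseteq> {..<N} \<and> length ys = d}"
  let ?L = "\<lambda>ys. {ls. set ls \<subseteq> insert i (set ys) \<and> length ls = n}"
  have sub: "{ls. set ls \<subseteq> S \<and> length ls = n \<and> card (set (i # ls)) \<le> Suc d} \<subseteq> (\<Union>ys\<in>?Y. ?L ys)"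
  proof
    fix ls assume "ls \<in> {ls. set ls \<subseteq> S \<and> length ls = n \<and> card (set (i # ls)) \<le> Suc d}"
    then have ls: "set ls \<subseteq> S" "length ls = n" "card (set (i # ls)) \<le> Suc d" by auto
    let ?A = "set ls - {i}"
    have "card ?A \<le> d" using ls(3) by (simp add: card_insert_if split: if_splits)
    obtain zs where zs: "set zs = ?A" "length zs = card ?A"
      using finite_distinct_list[of ?A] distinct_card by (metis finite_Diff finite_set)
    \<comment> \<open>Padding with 0, a vertex because N is positive, brings the list to length
      exactly \<open>d\<close> and only enlarges the set of available vertices.\<close>
    let ?ys = "zs @ replicate (d - card ?A) 0"
    have "?ys \<in> ?Y" using zs ls assms \<open>card ?A \<le> d\<close> by auto
    moreover have "ls \<in> ?L ?ys" using zs ls by auto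
    ultimately show "ls \<in> (\<Union>ys\<in>?Y. ?L ys)" by blast
  qed
  have fin: "finite ?Y" "finite (?L ys)" for ys
    by (auto intro: finite_lists_length_eq)
  have "card {ls. set ls \<subseteq> S \<and> length ls = n \<and> card (set (i # ls)) \<le> Suc d} \<le> card (\<Union>ys\<in>?Y. ?L ys)"
    using fin by (intro card_mono sub finite_UN_I) auto
  also have "\<dots> \<le> (\<Sum>ys\<in>?Y. card (?L ys))"
    by (rule card_UN_le) (rule fin)
  also have "\<dots> \<le> (\<Sum>ys\<in>?Y. Suc d ^ n)"
  proof (rule sum_mono)
    fix ys assume "ys \<in> ?Y"
    then have "card (insert i (set ys)) \<le> Suc d"
      using card_length[of ys] by (auto simp: card_insert_if)
    then show "card (?L ys) \<le> Suc d ^ n"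
      by (subst card_lists_length_eq) (auto intro: power_mono)
  qed
  also have "\<dots> = N ^ d * Suc d ^ n"
    using card_lists_length_eq[of "{..<N}" d] by simp
  finally show ?thesis .
qed

text \<open>Each use of \<open>power_mult_le_sum\<close> separates one factor and doubles the order
  of the moments of the rest.\<close>

fun prod_bound :: "(nat \<Rightarrow> real) \<Rightarrow> nat \<Rightarrow> nat \<Rightarrow> real" where
  "prod_bound K 0 p = 1"
| "prod_bound K (Suc n) p = K (2 * p) + prod_bound K n (2 * p)"

text \<open>The first factor counts the shapes of the surviving walks of length \<open>n\<close>,
  the second bounds the expectation along one of them.\<close>

definition walk_bound :: "(nat \<Rightarrow> real) \<Rightarrow> nat \<Rightarrow> real" where
  "walk_bound K n = real (Suc (n div 2) ^ n) * prod_bound K n 1"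

text \<open>The summand 1 is the cost of raising the exponent to a power of 2;
  \<open>2 ^ Suc p * n\<close> is the length of the word after \<open>Suc p\<close>
  doublings.\<close>

definition walk_moment_bound :: "(nat \<Rightarrow> real) \<Rightarrow> nat \<Rightarrow> nat \<Rightarrow> real" where
  "walk_moment_bound K n p = 1 + walk_bound K (2 ^ Suc p * n)"

text \<open>The sample point precedes letter and indices, so that a partial application is a family
  of matrices to which \<open>wprod\<close> applies.\<close>

definition scaled_entry ::
    "nat \<Rightarrow> ('c \<Rightarrow> nat \<Rightarrow> nat \<Rightarrow> 'a \<Rightarrow> complex) \<Rightarrow> 'a \<Rightarrow> 'c \<Rightarrow> nat \<Rightarrow> nat \<Rightarrow> complex" where
  "scaled_entry N Z x c i j = Z c i j x / complex_of_real (sqrt (real N))"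

text \<open>One fixed dimension. The moment bounds \<open>K\<close> are a parameter, so estimates in
  terms of \<open>K\<close> and \<open>N\<close> become uniform along a sequence with a common
  \<open>K\<close>.\<close>

locale wigner_family = prob_space M for M :: "'a measure" +
  fixes N :: nat and Z :: "'c \<Rightarrow> nat \<Rightarrow> nat \<Rightarrow> 'a \<Rightarrow> complex" and K :: "nat \<Rightarrow> real"
  assumes N_pos: "N \<ge> 1"
    and hermitian: "\<And>c i j x. i < N \<Longrightarrow> j < N \<Longrightarrow> x \<in> space M \<Longrightarrow> cnj (Z c i j x) = Z c j i x"
    and indep: "indep_vars (\<lambda>_. borel) (\<lambda>(c, i, j). Z c i j) {(c, i, j). i \<le> j \<and> j < N}"
    and entry_all_moments: "\<And>c i j. i < N \<Longrightarrow> j < N \<Longrightarrow> Z c i j \<in> all_moments M"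
    and entry_moment_le: "\<And>c i j p. i < N \<Longrightarrow> j < N \<Longrightarrow> expectation (\<lambda>x. cmod (Z c i j x) ^ p) \<le> K p"
    and centred: "\<And>c i j. i < N \<Longrightarrow> j < N \<Longrightarrow> expectation (Z c i j) = 0"
    and unit_variance: "\<And>c i j. i < N \<Longrightarrow> j < N \<Longrightarrow> i \<noteq> j \<Longrightarrow> expectation (\<lambda>x. (cmod (Z c i j x))\<^sup>2) = 1"
begin

lemma finite_measure_M: "finite_measure M"
  by (rule finite_measure_axioms)

lemma K_nonneg: "0 \<le> K p"
proof -
  have "0 \<le> expectation (\<lambda>x. cmod (Z undefined 0 0 x) ^ p)"
    by (rule integral_nonneg_AE) simp
  also have "\<dots> \<le> K p"
    using N_pos by (intro entry_moment_le) auto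
  finally show ?thesis .
qed

lemma prod_bound_nonneg: "0 \<le> prod_bound K n p"
  by (induction n arbitrary: p) (auto intro: add_nonneg_nonneg K_nonneg)

lemma walk_bound_nonneg: "0 \<le> walk_bound K n"
  by (simp add: walk_bound_def prod_bound_nonneg)

section \<open>Independence of functions of disjoint sets of edges\<close>

definition edges :: "('c \<times> nat \<times> nat) set" where
  "edges = {(c, i, j). i \<le> j \<and> j < N}"

definition edge_events :: "'c \<times> nat \<times> nat \<Rightarrow> 'a set set" where
  "edge_events e = {(case e of (c, i, j) \<Rightarrow> Z c i j) -` A \<inter> space M | A. A \<in> sets borel}"

text \<open>A product of entries need only be recognised as measurable with respect to the edges it
  uses; disjointness of edge sets then yields independence.\<close>

definition edge_algebra :: "('c \<times> nat \<times> nat) set \<Rightarrow> 'a measure" where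
  "edge_algebra J = sigma (space M) (\<Union>e\<in>J. edge_events e)"

lemma edge_events_Pow: "(\<Union>e\<in>J. edge_events e) \<subseteq> Pow (space M)"
  by (auto simp: edge_events_def)

lemma space_edge_algebra [simp]: "space (edge_algebra J) = space M"
  by (simp add: edge_algebra_def space_measure_of[OF edge_events_Pow])

lemma sets_edge_algebra: "sets (edge_algebra J) = sigma_sets (space M) (\<Union>e\<in>J. edge_events e)"
  by (simp add: edge_algebra_def sets_measure_of[OF edge_events_Pow])

lemma edge_key_edges: "i < N \<Longrightarrow> j < N \<Longrightarrow> edge_key c i j \<in> edges"
  by (auto simp: edge_key_def edges_def)

lemma measurable_edge_algebra_mono:
  assumes "f \<in> borel_measurable (edge_algebra J)" "J \<subseteq> J'"
  shows "f \<in> borel_measurable (edge_algebra J')"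
proof -
  have "sets (edge_algebra J) \<subseteq> sets (edge_algebra J')"
    unfolding sets_edge_algebra using assms(2) by (intro sigma_sets_mono') auto
  then show ?thesis using assms(1) by (auto simp: measurable_def)
qed

lemma entry_measurable_edge_algebra:
  assumes "i < N" "j < N" "edge_key c i j \<in> J"
  shows "Z c i j \<in> borel_measurable (edge_algebra J)"
proof -
  have *: "Z c i j \<in> borel_measurable (edge_algebra J)" if "i \<le> j" "(c, i, j) \<in> J" for i j
  proof (rule measurableI)
    fix A :: "complex set" assume "A \<in> sets borel"
    then have "Z c i j -` A \<inter> space M \<in> edge_events (c, i, j)"
      by (auto simp: edge_events_def)
    with that(2) have "Z c i j -` A \<inter> space M \<in> (\<Union>e\<in>J. edge_events e)"
      by blast
    then show "Z c i j -` A \<inter> space (edge_algebra J) \<in> sets (edge_algebra J)"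
      by (simp add: sets_edge_algebra)
  qed simp
  show ?thesis
  proof (cases "i \<le> j")
    case True
    then show ?thesis using * assms by (simp add: edge_key_def)
  next
    case False
    have "Z c j i \<in> borel_measurable (edge_algebra J)"
      using False assms by (intro *) (auto simp: edge_key_def)
    then have "(\<lambda>x. cnj (Z c j i x)) \<in> borel_measurable (edge_algebra J)"
      by (rule measurable_compose) (intro borel_measurable_continuous_onI continuous_intros)
    moreover have "cnj (Z c j i x) = Z c i j x" if "x \<in> space (edge_algebra J)" for x
      using that assms by (intro hermitian) simp_all
    ultimately show ?thesis
      using measurable_cong[of "edge_algebra J" "\<lambda>x. cnj (Z c j i x)" "Z c i j" borel] by blast
  qed
qed

text \<open>The events of a single entry are stable under intersection, so independence passes to
  the sigma-algebras generated by disjoint groups of entries.\<close>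

lemma indep_var_edge_algebra:
  assumes "f \<in> borel_measurable (edge_algebra J1)" "g \<in> borel_measurable (edge_algebra J2)"
    and "J1 \<subseteq> edges" "J2 \<subseteq> edges" "J1 \<inter> J2 = {}"
    and "f \<in> borel_measurable M" "g \<in> borel_measurable M"
  shows "indep_var borel f borel g"
proof -
  have E: "indep_sets edge_events edges"
    using indep unfolding indep_vars_def2 edge_events_def edges_def by (simp add: case_prod_beta)
  have "indep_sets (\<lambda>b. sigma_sets (space M) (\<Union>e\<in>case_bool J1 J2 b. edge_events e)) UNIV"
  proof (rule indep_sets_collect_sigma)
    show "indep_sets edge_events (\<Union>b\<in>UNIV. case_bool J1 J2 b)"
      by (rule indep_sets_mono_index[OF _ E]) (use assms in \<open>auto simp: UNIV_bool\<close>)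
    show "disjoint_family_on (case_bool J1 J2) UNIV"
      using assms(5) by (auto simp: disjoint_family_on_def split: bool.splits)
    show "Int_stable (edge_events e)" for e
      unfolding edge_events_def Int_stable_def
    proof (safe)
      fix A B :: "complex set" assume "A \<in> sets borel" "B \<in> sets borel"
      then show "\<exists>C. (case e of (c, i, j) \<Rightarrow> Z c i j) -` A \<inter> space M \<inter> ((case e of (c, i, j) \<Rightarrow> Z c i j) -` B \<inter> space M) =
          (case e of (c, i, j) \<Rightarrow> Z c i j) -` C \<inter> space M \<and> C \<in> sets borel"
        by (intro exI[of _ "A \<inter> B"]) auto
    qed
  qed
  then have "indep_sets (\<lambda>b. {case_bool f g b -` A \<inter> space M | A. A \<in> sets (case_bool borel borel b)}) UNIV"
  proof (rule indep_sets_mono_sets)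
    fix b :: bool
    show "{case_bool f g b -` A \<inter> space M | A. A \<in> sets (case_bool borel borel b)} \<subseteq>
        sigma_sets (space M) (\<Union>e\<in>case_bool J1 J2 b. edge_events e)"
      using assms(1,2)[THEN measurable_sets] by (auto simp: sets_edge_algebra split: bool.splits)
  qed
  then show ?thesis
    unfolding indep_var_def indep_vars_def2 using assms(6,7) by (auto split: bool.splits)
qed

lemma expectation_mult_indep:
  assumes "f \<in> borel_measurable (edge_algebra J1)" "g \<in> borel_measurable (edge_algebra J2)"
    and "J1 \<subseteq> edges" "J2 \<subseteq> edges" "J1 \<inter> J2 = {}"
    and "f \<in> all_moments M" "g \<in> all_moments M"
  shows "expectation (\<lambda>x. f x * g x) = expectation f * expectation g"
  using assms(6,7)
  by (intro indep_var_lebesgue_integral indep_var_edge_algebra[OF assms(1-5)] all_moments_integrable all_moments_measurable)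

section \<open>Products along walks and moment bounds for words\<close>

abbreviation step_prod :: "('c \<times> nat \<times> nat) list \<Rightarrow> 'a \<Rightarrow> complex" where
  "step_prod es x \<equiv> prod_list (map (\<lambda>(c, i, l). Z c i l x) es)"

lemma step_prod_all_moments:
  assumes "\<And>c i l. (c, i, l) \<in> set es \<Longrightarrow> i < N \<and> l < N"
  shows "step_prod es \<in> all_moments M"
  using assms
proof (induction es)
  case Nil
  then show ?case by (auto intro: all_moments_const finite_measure_M)
next
  case (Cons e es)
  obtain c i l where e: "e = (c, i, l)" by (cases e)
  have "Z c i l \<in> all_moments M" "step_prod es \<in> all_moments M"
    using Cons e by (auto intro: entry_all_moments)
  from all_moments_mult[OF this] show ?case by (simp add: e)
qed

lemma step_prod_measurable:
  assumes "\<And>c i l. (c, i, l) \<in> set es \<Longrightarrow> i < N \<and> l < N \<and> edge_key c i l \<in> J"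
  shows "step_prod es \<in> borel_measurable (edge_algebra J)"
  using assms
proof (induction es)
  case (Cons e es)
  obtain c i l where e: "e = (c, i, l)" by (cases e)
  have "Z c i l \<in> borel_measurable (edge_algebra J)" "step_prod es \<in> borel_measurable (edge_algebra J)"
    using Cons e by (auto intro: entry_measurable_edge_algebra)
  from borel_measurable_times[OF this] show ?case by (simp add: e)
qed simp

lemma step_prod_moment_le:
  assumes "\<And>c i l. (c, i, l) \<in> set es \<Longrightarrow> i < N \<and> l < N"
  shows "expectation (\<lambda>x. cmod (step_prod es x) ^ p) \<le> prod_bound K (length es) p"
  using assms
proof (induction es arbitrary: p)
  case Nil
  then show ?case by (simp add: prob_space)
next
  case (Cons e es)
  obtain c i l where e: "e = (c, i, l)" by (cases e)
  have m: "Z c i l \<in> all_moments M" "step_prod es \<in> all_moments M"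
    using Cons.prems e by (auto intro!: entry_all_moments step_prod_all_moments)
  have m': "step_prod (e # es) \<in> all_moments M"
    using Cons.prems by (rule step_prod_all_moments)
  have "expectation (\<lambda>x. cmod (step_prod (e # es) x) ^ p) \<le>
      expectation (\<lambda>x. cmod (Z c i l x) ^ (2 * p) + cmod (step_prod es x) ^ (2 * p))"
    by (intro integral_mono Bochner_Integration.integrable_add all_moments_integrable_power m m')
       (simp add: e norm_mult power_mult_le_sum)
  also have "\<dots> = expectation (\<lambda>x. cmod (Z c i l x) ^ (2 * p)) + expectation (\<lambda>x. cmod (step_prod es x) ^ (2 * p))"
    by (intro Bochner_Integration.integral_add all_moments_integrable_power m)
  also have "\<dots> \<le> K (2 * p) + prod_bound K (length es) (2 * p)"
    using Cons e by (intro add_mono entry_moment_le Cons.IH) auto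
  finally show ?case by simp
qed

text \<open>The entry on an edge used exactly once is independent of all other factors and
  centred.\<close>

lemma step_prod_expectation_zero:
  assumes "\<And>c i l. (c, i, l) \<in> set es \<Longrightarrow> i < N \<and> l < N"
    and "k \<in> set (map (\<lambda>(c, i, l). edge_key c i l) es)"
    and "count_list (map (\<lambda>(c, i, l). edge_key c i l) es) k < 2"
  shows "expectation (step_prod es) = 0"
proof -
  let ?key = "\<lambda>(c, i, l). edge_key c i l"
  obtain e where e: "e \<in> set es" "k = ?key e" using assms(2) by auto
  obtain us vs where es: "es = us @ e # vs" using e by (meson split_list)
  obtain c i l where cil: "e = (c, i, l)" by (cases e)
  have il: "i < N" "l < N" using assms(1) e cil by auto
  have uv: "?key a \<noteq> k" if "a \<in> set (us @ vs)" for a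
  proof
    assume "?key a = k"
    then have "count_list (map ?key us) k + count_list (map ?key vs) k \<noteq> 0"
      using that by (auto simp: count_list_0_iff)
    then show False using assms(3) e(2) by (simp add: es)
  qed
  have fg: "step_prod es x = Z c i l x * step_prod (us @ vs) x" for x
    by (simp add: es cil mult.left_commute)
  have "expectation (\<lambda>x. Z c i l x * step_prod (us @ vs) x) =
      expectation (Z c i l) * expectation (step_prod (us @ vs))"
  proof (rule expectation_mult_indep)
    show "Z c i l \<in> borel_measurable (edge_algebra {k})"
      using il e cil by (intro entry_measurable_edge_algebra) auto
    have *: "(c, i, l) \<in> set (us @ vs) \<Longrightarrow> i < N \<and> l < N" for c i l
      using assms(1)[of c i l] by (auto simp: es)
    show "step_prod (us @ vs) \<in> borel_measurable (edge_algebra (edges - {k}))"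
      using * uv by (intro step_prod_measurable) (force intro: edge_key_edges)
    show "step_prod (us @ vs) \<in> all_moments M"
      using * by (rule step_prod_all_moments)
  qed (use il e cil in \<open>auto intro: edge_key_edges entry_all_moments\<close>)
  then show ?thesis using centred[OF il] by (simp add: fg)
qed

abbreviation entry :: "'a \<Rightarrow> 'c \<Rightarrow> nat \<Rightarrow> nat \<Rightarrow> complex" where
  "entry \<equiv> scaled_entry N Z"

abbreviation wp :: "nat set \<Rightarrow> 'c list \<Rightarrow> nat \<Rightarrow> nat \<Rightarrow> 'a \<Rightarrow> complex" where
  "wp S w i j x \<equiv> wprod (entry x) S w i j"

lemma entry_all_moments': "i < N \<Longrightarrow> j < N \<Longrightarrow> (\<lambda>x. entry x c i j) \<in> all_moments M"
  using all_moments_cmult[OF finite_measure_M entry_all_moments, of i j "1 / complex_of_real (sqrt (real N))" c]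
  by (simp add: scaled_entry_def)

lemma hermitian_entry: "x \<in> space M \<Longrightarrow> S \<subseteq> {..<N} \<Longrightarrow> hermitian_on S (entry x)"
  by (auto simp: hermitian_on_def scaled_entry_def hermitian subset_iff)

lemma finite_subset_N: "S \<subseteq> {..<N} \<Longrightarrow> finite S"
  using finite_subset by blast

lemma wp_all_moments:
  assumes "S \<subseteq> {..<N}" "i \<in> S"
  shows "wp S w i j \<in> all_moments M"
  using assms(2)
proof (induction w arbitrary: i)
  case Nil
  then show ?case by (auto intro: all_moments_const finite_measure_M)
next
  case (Cons c w)
  then show ?case using assms(1)
    by (auto intro!: all_moments_sum all_moments_mult entry_all_moments' finite_measure_M)
qed

lemma wp_measurable:
  assumes "S \<subseteq> {..<N}" "i \<in> S" "\<And>c i j. i \<in> S \<Longrightarrow> j \<in> S \<Longrightarrow> edge_key c i j \<in> J"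
  shows "wp S w i j \<in> borel_measurable (edge_algebra J)"
  using assms(2)
proof (induction w arbitrary: i)
  case (Cons c w)
  have "(\<lambda>x. entry x c i l) \<in> borel_measurable (edge_algebra J)" if "l \<in> S" for l
    using entry_measurable_edge_algebra[of i l c J] assms Cons.prems that
    unfolding scaled_entry_def by (intro borel_measurable_divide) auto
  then show ?case using Cons by (auto intro!: borel_measurable_sum borel_measurable_times)
qed simp

text \<open>A walk with nonzero expectation uses each of its edges at least twice, hence has at most
  n/2 edges and at most n/2 vertices besides \<open>i\<close>. The order N^(n/2) of their number is
  balanced by the normalisation; as the start is fixed, no further factor \<open>N\<close>
  appears.\<close>

lemma expectation_wp_le:
  assumes S: "S \<subseteq> {..<N}" "i \<in> S"
  shows "cmod (expectation (wp S w i j)) \<le> walk_bound K (length w)"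
proof -
  let ?n = "length w" and ?d = "length w div 2"
  let ?L = "{ls. set ls \<subseteq> S \<and> length ls = ?n}"
  let ?G = "{ls. set ls \<subseteq> S \<and> length ls = ?n \<and> card (set (i # ls)) \<le> Suc ?d}"
  let ?e = "\<lambda>ls. expectation (step_prod (steps w i ls))"
  have finL: "finite ?L" using finite_lists_length_eq[OF finite_subset_N[OF S(1)]] .
  have st: "i' < N \<and> l' < N" if "(c, i', l') \<in> set (steps w i ls)" "set ls \<subseteq> S" "i \<in> S" for c i' l' ls
    using that S(1) by (induction w i ls rule: steps.induct) auto
  have am: "step_prod (steps w i ls) \<in> all_moments M" if "ls \<in> ?L" for ls
    using that S st by (intro step_prod_all_moments) auto
  have wp_eq: "wp S w i j x = (1 / complex_of_real (sqrt N)) ^ ?n *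
      (\<Sum>ls\<in>?L. step_prod (steps w i ls) x * (if last (i # ls) = j then 1 else 0))" for x
    using wprod_scale[of "1 / complex_of_real (sqrt N)" "\<lambda>c i j. Z c i j x" S w i j]
    unfolding scaled_entry_def wprod_eq_sum_walks[of "\<lambda>c i j. Z c i j x"] by simp
  have "expectation (wp S w i j) = (1 / complex_of_real (sqrt N)) ^ ?n *
      (\<Sum>ls\<in>?L. ?e ls * (if last (i # ls) = j then 1 else 0))"
    unfolding wp_eq using am by (simp add: all_moments_integrable)
  then have "cmod (expectation (wp S w i j)) =
      (1 / sqrt N) ^ ?n * cmod (\<Sum>ls\<in>?L. ?e ls * (if last (i # ls) = j then 1 else 0))"
    by (simp add: norm_mult norm_power norm_divide)
  also have "\<dots> \<le> (1 / sqrt N) ^ ?n * (\<Sum>ls\<in>?L. cmod (?e ls))"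
    by (intro mult_left_mono sum_norm_le) (auto simp: norm_mult)
  also have "(\<Sum>ls\<in>?L. cmod (?e ls)) = (\<Sum>ls\<in>?G. cmod (?e ls))"
  proof (rule sum.mono_neutral_right[OF finL])
    show "\<forall>ls\<in>?L - ?G. cmod (?e ls) = 0"
    proof
      fix ls assume ls: "ls \<in> ?L - ?G"
      let ?k = "map (\<lambda>(c, i, l). edge_key c i l) (steps w i ls)"
      have "\<not> card (set (i # ls)) \<le> Suc ?d" using ls by auto
      then have "\<not> 2 * card (set ?k) \<le> length ?k"
        using card_vertices_le[of ls w i] ls by (auto simp: length_steps)
      then obtain k where "k \<in> set ?k" "count_list ?k k < 2"
        using card_set_le_half[of ?k] by (meson not_le)
      then have "?e ls = 0"
        using st S ls by (intro step_prod_expectation_zero) auto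
      then show "cmod (?e ls) = 0" by simp
    qed
  qed auto
  also have "(\<Sum>ls\<in>?G. cmod (?e ls)) \<le> (\<Sum>ls\<in>?G. prod_bound K ?n 1)"
  proof (rule sum_mono)
    fix ls assume ls: "ls \<in> ?G"
    have "cmod (?e ls) \<le> expectation (\<lambda>x. cmod (step_prod (steps w i ls) x) ^ 1)"
      by simp
    also have "\<dots> \<le> prod_bound K (length (steps w i ls)) 1"
      using ls st S by (intro step_prod_moment_le) auto
    finally show "cmod (?e ls) \<le> prod_bound K ?n 1"
      using ls by (simp add: length_steps)
  qed
  also have "\<dots> = real (card ?G) * prod_bound K ?n 1" by simp
  also have "\<dots> \<le> real (N ^ ?d * Suc ?d ^ ?n) * prod_bound K ?n 1"
  proof (intro mult_right_mono)
    show "real (card ?G) \<le> real (N ^ ?d * Suc ?d ^ ?n)"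
      using card_lists_few_vertices[OF N_pos S(1), of ?n i ?d] by (rule of_nat_mono)
    show "0 \<le> prod_bound K ?n 1" by (rule prod_bound_nonneg)
  qed
  also have "(1 / sqrt N) ^ ?n * (real (N ^ ?d * Suc ?d ^ ?n) * prod_bound K ?n 1) =
      ((1 / sqrt N) ^ ?n * real N ^ ?d) * walk_bound K ?n"
    by (simp add: walk_bound_def)
  also have "\<dots> \<le> 1 * walk_bound K ?n"
  proof (intro mult_right_mono)
    \<comment> \<open>For odd length the count falls short of the normalisation by a factor
      \<open>sqrt N\<close>, which is given away here.\<close>
    have "real N ^ ?d = sqrt N ^ (2 * ?d)" by (simp add: power_mult)
    also have "\<dots> \<le> sqrt N ^ ?n" using N_pos by (intro power_increasing) auto
    finally show "(1 / sqrt N) ^ ?n * real N ^ ?d \<le> 1"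
      using N_pos by (simp add: power_divide divide_simps)
    show "0 \<le> walk_bound K ?n" by (rule walk_bound_nonneg)
  qed
  finally show ?thesis by (simp add: mult_left_mono)
qed

lemma sum_sq_wp_eq:
  assumes S: "S \<subseteq> {..<N}" "i \<in> S" and x: "x \<in> space M"
  shows "wp S (w @ rev w) i i x = complex_of_real (\<Sum>l\<in>S. (cmod (wp S w i l x))\<^sup>2)"
  using wprod_rev_diag[OF finite_subset_N[OF S(1)] hermitian_entry[OF x S(1)] S(2)] .

text \<open>The squared norm of a whole row is one diagonal entry of the word
  \<open>w @ rev w\<close>, so summing over the \<open>N\<close> positions costs no factor
  \<open>N\<close>. All variance estimates below rest on this.\<close>

lemma sum_second_moments_le:
  assumes S: "S \<subseteq> {..<N}" "i \<in> S"
  shows "(\<Sum>l\<in>S. expectation (\<lambda>x. (cmod (wp S w i l x))\<^sup>2)) \<le> walk_bound K (2 * length w)"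
proof -
  have "expectation (wp S (w @ rev w) i i) = expectation (\<lambda>x. complex_of_real (\<Sum>l\<in>S. (cmod (wp S w i l x))\<^sup>2))"
    using sum_sq_wp_eq[OF S] by (intro Bochner_Integration.integral_cong) auto
  also have "\<dots> = complex_of_real (\<Sum>l\<in>S. expectation (\<lambda>x. (cmod (wp S w i l x))\<^sup>2))"
    using wp_all_moments[OF S] by (simp only: integral_complex_of_real) (simp add: all_moments_integrable_power)
  finally have "cmod (expectation (wp S (w @ rev w) i i)) = (\<Sum>l\<in>S. expectation (\<lambda>x. (cmod (wp S w i l x))\<^sup>2))"
    by (simp only: norm_of_real) (simp add: sum_nonneg)
  then show ?thesis
    using expectation_wp_le[OF S, of "w @ rev w" i] by (simp add: mult_2)
qed

text \<open>Iterated \<open>wprod_sq_le\<close>. After the first squaring the entry is diagonal,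
  which is why the column index is \<open>j\<close> only for \<open>q = 0\<close>.\<close>

lemma wp_power_le:
  assumes S: "S \<subseteq> {..<N}" "i \<in> S" "j \<in> S" and x: "x \<in> space M"
  shows "cmod (wp S w i j x) ^ (2 ^ q) \<le> cmod (wp S (((\<lambda>w. w @ rev w) ^^ q) w) i (if q = 0 then j else i) x)"
  using S(3)
proof (induction q arbitrary: w j)
  case (Suc q)
  have "cmod (wp S w i j x) ^ (2 ^ Suc q) = ((cmod (wp S w i j x))\<^sup>2) ^ (2 ^ q)"
    by (simp add: power_mult)
  also have "\<dots> \<le> cmod (wp S (w @ rev w) i i x) ^ (2 ^ q)"
    using wprod_sq_le[OF finite_subset_N[OF S(1)] hermitian_entry[OF x S(1)] S(2) Suc.prems]
    by (intro power_mono) auto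
  also have "\<dots> \<le> cmod (wp S (((\<lambda>w. w @ rev w) ^^ q) (w @ rev w)) i i x)"
    using Suc.IH[OF S(2), of "w @ rev w"] by (simp split: if_splits)
  finally show ?case by (simp only: funpow_Suc_right comp_apply nat.simps if_False)
qed simp

lemma wp_moment_le:
  assumes S: "S \<subseteq> {..<N}" "i \<in> S" "j \<in> S"
  shows "expectation (\<lambda>x. cmod (wp S w i j x) ^ p) \<le> walk_moment_bound K (length w) p"
proof -
  let ?v = "((\<lambda>w. w @ rev w) ^^ p) w"
  have len: "length (((\<lambda>w. w @ rev w) ^^ q) w) = 2 ^ q * length w" for q and w :: "'c list"
    by (induction q) auto
  have "p \<le> 2 ^ Suc p"
    using less_exp[of "Suc p"] by linarith
  then have "expectation (\<lambda>x. cmod (wp S w i j x) ^ p) \<le> 1 + expectation (\<lambda>x. cmod (wp S w i j x) ^ (2 ^ Suc p))"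
    by (intro moment_le wp_all_moments S)
  also have "expectation (\<lambda>x. cmod (wp S w i j x) ^ (2 ^ Suc p)) \<le> expectation (\<lambda>x. cmod (wp S (?v @ rev ?v) i i x))"
    using wp_power_le[OF S, where q = "Suc p" and w = w]
    by (intro integral_mono all_moments_integrable_power all_moments_integrable_norm wp_all_moments S) auto
  also have "\<dots> = expectation (\<lambda>x. \<Sum>l\<in>S. (cmod (wp S ?v i l x))\<^sup>2)"
    using sum_sq_wp_eq[OF S(1,2)] by (intro Bochner_Integration.integral_cong) (auto simp del: of_real_sum simp: sum_nonneg)
  also have "\<dots> = (\<Sum>l\<in>S. expectation (\<lambda>x. (cmod (wp S ?v i l x))\<^sup>2))"
    using S by (intro Bochner_Integration.integral_sum all_moments_integrable_power wp_all_moments)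
  also have "\<dots> \<le> walk_bound K (2 * length ?v)"
    by (rule sum_second_moments_le[OF S(1,2)])
  finally show ?thesis by (simp add: walk_moment_bound_def len mult.assoc)
qed

end


section \<open>Quadratic forms in a column\<close>

text \<open>Only the terms \<open>b = a\<close> and \<open>b = \<sigma> a\<close> of the double sum over \<open>a\<close>, \<open>b\<close> survive.\<close>

lemma (in prob_space) second_moment_form_le:
  fixes \<xi> m :: "'i \<Rightarrow> 'a \<Rightarrow> complex"
  assumes fin: "finite I" and \<sigma>: "bij_betw \<sigma> I I"
    and am: "\<And>a. a \<in> I \<Longrightarrow> \<xi> a \<in> all_moments M" "\<And>a. a \<in> I \<Longrightarrow> m a \<in> all_moments M"
    and fact: "\<And>a b. a \<in> I \<Longrightarrow> b \<in> I \<Longrightarrow>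
      expectation (\<lambda>x. (\<xi> a x * cnj (\<xi> b x)) * (m a x * cnj (m b x))) =
      expectation (\<lambda>x. \<xi> a x * cnj (\<xi> b x)) * expectation (\<lambda>x. m a x * cnj (m b x))"
    and zero: "\<And>a b. a \<in> I \<Longrightarrow> b \<in> I \<Longrightarrow> b \<noteq> a \<Longrightarrow> b \<noteq> \<sigma> a \<Longrightarrow> expectation (\<lambda>x. \<xi> a x * cnj (\<xi> b x)) = 0"
    and bound: "\<And>a b. a \<in> I \<Longrightarrow> b \<in> I \<Longrightarrow> cmod (expectation (\<lambda>x. \<xi> a x * cnj (\<xi> b x))) \<le> B"
    and B: "0 \<le> B"
  shows "expectation (\<lambda>x. (cmod (\<Sum>a\<in>I. \<xi> a x * m a x))\<^sup>2) \<le> 2 * B * (\<Sum>a\<in>I. expectation (\<lambda>x. (cmod (m a x))\<^sup>2))"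
proof -
  let ?e = "\<lambda>a b. expectation (\<lambda>x. \<xi> a x * cnj (\<xi> b x)) * expectation (\<lambda>x. m a x * cnj (m b x))"
  let ?m = "\<lambda>a. expectation (\<lambda>x. (cmod (m a x))\<^sup>2)"
  let ?t = "\<lambda>a b x. (\<xi> a x * cnj (\<xi> b x)) * (m a x * cnj (m b x))"
  have t: "?t a b \<in> all_moments M" if "a \<in> I" "b \<in> I" for a b
    using that by (intro all_moments_mult all_moments_cnj am)
  have sq: "complex_of_real ((cmod (\<Sum>a\<in>I. \<xi> a x * m a x))\<^sup>2) = (\<Sum>a\<in>I. \<Sum>b\<in>I. ?t a b x)" for x
    unfolding complex_norm_square cnj_sum sum_product by (intro sum.cong refl) (simp add: mult_ac)
  have "complex_of_real (expectation (\<lambda>x. (cmod (\<Sum>a\<in>I. \<xi> a x * m a x))\<^sup>2)) =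
      expectation (\<lambda>x. \<Sum>a\<in>I. \<Sum>b\<in>I. ?t a b x)"
    unfolding sq[symmetric] by (rule integral_complex_of_real[symmetric])
  also have "\<dots> = (\<Sum>a\<in>I. \<Sum>b\<in>I. ?e a b)"
    using t fact by (simp add: all_moments_integrable)
  finally have "expectation (\<lambda>x. (cmod (\<Sum>a\<in>I. \<xi> a x * m a x))\<^sup>2) = Re (\<Sum>a\<in>I. \<Sum>b\<in>I. ?e a b)"
    by (metis Re_complex_of_real)
  also have "\<dots> \<le> (\<Sum>a\<in>I. \<Sum>b\<in>I. cmod (?e a b))"
    by (rule order_trans[OF complex_Re_le_cmod], rule sum_norm_le, rule sum_norm_le) simp
  also have "\<dots> \<le> (\<Sum>a\<in>I. B * ?m a + B * ((?m a + ?m (\<sigma> a)) / 2))"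
  proof (rule sum_mono)
    fix a assume a: "a \<in> I"
    have \<sigma>a: "\<sigma> a \<in> I" using \<sigma> a by (rule bij_betwE[rule_format])
    \<comment> \<open>The cross term is bounded by an arithmetic mean so that the values at
      \<open>\<sigma> a\<close> can be reindexed into the same sum afterwards.\<close>
    have g: "cmod (?e a b) \<le> B * ((?m a + ?m b) / 2)" if b: "b \<in> I" for b
    proof -
      have "cmod (expectation (\<lambda>x. m a x * cnj (m b x))) \<le> expectation (\<lambda>x. cmod (m a x * cnj (m b x)))"
        by simp
      also have "\<dots> \<le> expectation (\<lambda>x. ((cmod (m a x))\<^sup>2 + (cmod (m b x))\<^sup>2) / 2)"
      proof (rule integral_mono)
        show "integrable M (\<lambda>x. cmod (m a x * cnj (m b x)))"
          using a b by (intro all_moments_integrable_norm all_moments_mult all_moments_cnj am)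
        show "integrable M (\<lambda>x. ((cmod (m a x))\<^sup>2 + (cmod (m b x))\<^sup>2) / 2)"
          using a b by (intro integrable_divide Bochner_Integration.integrable_add all_moments_integrable_power am)
        show "cmod (m a x * cnj (m b x)) \<le> ((cmod (m a x))\<^sup>2 + (cmod (m b x))\<^sup>2) / 2" for x
          using sum_squares_bound[of "cmod (m a x)" "cmod (m b x)"] by (simp add: norm_mult)
      qed
      also have "\<dots> = (?m a + ?m b) / 2"
        using a b by (simp add: all_moments_integrable_power am)
      finally show ?thesis
        unfolding norm_mult using bound[OF a b] B by (intro mult_mono) auto
    qed
    have "(\<Sum>b\<in>I. cmod (?e a b)) = (\<Sum>b\<in>{a, \<sigma> a}. cmod (?e a b))"
      using zero[OF a] a \<sigma>a by (intro sum.mono_neutral_right fin) auto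
    also have "\<dots> \<le> (\<Sum>b\<in>{a, \<sigma> a}. B * ((?m a + ?m b) / 2))"
      using g a \<sigma>a by (intro sum_mono) auto
    also have "\<dots> \<le> B * ((?m a + ?m a) / 2) + B * ((?m a + ?m (\<sigma> a)) / 2)"
      using B by (cases "\<sigma> a = a") (auto intro!: mult_nonneg_nonneg)
    finally show "(\<Sum>b\<in>I. cmod (?e a b)) \<le> B * ?m a + B * ((?m a + ?m (\<sigma> a)) / 2)"
      by simp
  qed
  also have "\<dots> = B * (\<Sum>a\<in>I. ?m a) + B * (((\<Sum>a\<in>I. ?m a) + (\<Sum>a\<in>I. ?m (\<sigma> a))) / 2)"
    by (simp only: sum.distrib sum_distrib_left[symmetric] sum_divide_distrib[symmetric])
  also have "(\<Sum>a\<in>I. ?m (\<sigma> a)) = (\<Sum>a\<in>I. ?m a)"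
    by (rule sum.reindex_bij_betw[OF \<sigma>])
  finally show ?thesis by simp
qed

context wigner_family
begin

text \<open>The edge between \<open>i\<close> and \<open>p\<close> with every letter. Keeping the
  letters together makes disjointness depend on the far endpoints alone.\<close>

definition star :: "nat \<Rightarrow> nat \<Rightarrow> ('c \<times> nat \<times> nat) set" where
  "star i p = range (\<lambda>c. edge_key c i p)"

lemma star_disjoint: "p \<noteq> q \<Longrightarrow> star i p \<inter> star i q = {}"
  by (auto simp: star_def edge_key_eq_iff doubleton_eq_iff)

lemma star_edges: "i < N \<Longrightarrow> p < N \<Longrightarrow> star i p \<subseteq> edges"
  by (auto simp: star_def edge_key_edges)

lemma edge_key_star: "edge_key c i p \<in> star i p" "edge_key c p i \<in> star i p"
  by (auto simp: star_def edge_key_eq_iff insert_commute)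

text \<open>For \<open>p\<close> and \<open>q\<close> different from \<open>i\<close> the subtracted
  constant is the mean: with equal letters and \<open>p = q\<close> the product is a squared modulus
  of mean 1, otherwise its factors are independent and centred.\<close>

definition centred_pair :: "'c \<Rightarrow> 'c \<Rightarrow> nat \<Rightarrow> nat \<Rightarrow> nat \<Rightarrow> 'a \<Rightarrow> complex" where
  "centred_pair c c' i p q = (\<lambda>x. Z c i p x * Z c' q i x - (if c = c' \<and> p = q then 1 else 0))"

lemma centred_pair_all_moments:
  "i < N \<Longrightarrow> p < N \<Longrightarrow> q < N \<Longrightarrow> centred_pair c c' i p q \<in> all_moments M"
  unfolding centred_pair_def
  by (intro all_moments_diff all_moments_mult entry_all_moments all_moments_const finite_measure_M)

lemma centred_pair_measurable:
  "i < N \<Longrightarrow> p < N \<Longrightarrow> q < N \<Longrightarrow>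
    centred_pair c c' i p q \<in> borel_measurable (edge_algebra (star i p \<union> star i q))"
  unfolding centred_pair_def
  by (intro borel_measurable_diff borel_measurable_times entry_measurable_edge_algebra)
     (auto simp: edge_key_star)

lemma cnj_measurable:
  fixes f :: "'b \<Rightarrow> complex"
  assumes "f \<in> borel_measurable M'"
  shows "(\<lambda>x. cnj (f x)) \<in> borel_measurable M'"
proof -
  have "cnj \<in> borel_measurable borel"
    by (intro borel_measurable_continuous_onI continuous_intros)
  from measurable_compose[OF assms this] show ?thesis .
qed

lemma expectation_centred_pair_diag:
  assumes "i < N" "p < N" "p \<noteq> i"
  shows "expectation (centred_pair c c' i p p) = 0"
proof (cases "c = c'")
  case True
  have "expectation (centred_pair c c' i p p) = expectation (\<lambda>x. complex_of_real ((cmod (Z c i p x))\<^sup>2) - 1)"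
    using hermitian[of i p _ c] assms True unfolding centred_pair_def complex_norm_square
    by (intro Bochner_Integration.integral_cong) auto
  also have "\<dots> = complex_of_real (expectation (\<lambda>x. (cmod (Z c i p x))\<^sup>2)) - 1"
    using all_moments_integrable_power[OF entry_all_moments[of i p c], of 2] assms
    by (subst Bochner_Integration.integral_diff) (auto simp: prob_space simp del: of_real_power)
  finally show ?thesis using unit_variance[of i p c] assms by simp
next
  case False
  have "expectation (\<lambda>x. Z c i p x * Z c' p i x) = expectation (Z c i p) * expectation (Z c' p i)"
  proof (rule expectation_mult_indep)
    show "Z c i p \<in> borel_measurable (edge_algebra {edge_key c i p})"
      "Z c' p i \<in> borel_measurable (edge_algebra {edge_key c' p i})"
      using assms by (auto intro: entry_measurable_edge_algebra)
  qed (use assms False in \<open>auto intro: edge_key_edges entry_all_moments simp: edge_key_eq_iff\<close>)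
  then show ?thesis using centred[of i p c] assms False by (simp add: centred_pair_def)
qed

text \<open>A vertex visited only once makes the expectation vanish.\<close>

lemma centred_pair_lonely:
  assumes "i < N" "p < N" "q < N" "V \<subseteq> {..<N}" "p \<noteq> q" "p \<notin> V \<or> q \<notin> V"
    and "g \<in> borel_measurable (edge_algebra (\<Union>r\<in>V. star i r))" "g \<in> all_moments M"
  shows "expectation (\<lambda>x. centred_pair c c' i p q x * g x) = 0"
proof -
  have E: "star i p \<subseteq> edges" "star i q \<subseteq> edges" "(\<Union>r\<in>V. star i r) \<subseteq> edges"
    using assms(1-4) by (auto simp: star_def intro!: edge_key_edges)
  have D: "r \<notin> V \<Longrightarrow> star i r \<inter> (\<Union>r\<in>V. star i r) = {}" for r
    by (auto simp: star_def edge_key_eq_iff doubleton_eq_iff)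
  have m: "Z c i p \<in> borel_measurable (edge_algebra (star i p))"
      "Z c' q i \<in> borel_measurable (edge_algebra (star i q))"
    using assms by (auto intro: entry_measurable_edge_algebra edge_key_star)
  have am: "Z c i p \<in> all_moments M" "Z c' q i \<in> all_moments M"
    using assms by (auto intro: entry_all_moments)
  have eq: "centred_pair c c' i p q x = Z c i p x * Z c' q i x" for x
    using assms(5) by (simp add: centred_pair_def)
  show ?thesis
  proof (cases "p \<in> V")
    case False
    have "expectation (\<lambda>x. Z c i p x * (Z c' q i x * g x)) = expectation (Z c i p) * expectation (\<lambda>x. Z c' q i x * g x)"
    proof (rule expectation_mult_indep[OF m(1)])
      show "(\<lambda>x. Z c' q i x * g x) \<in> borel_measurable (edge_algebra (star i q \<union> (\<Union>r\<in>V. star i r)))"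
        by (intro borel_measurable_times measurable_edge_algebra_mono[OF m(2)] measurable_edge_algebra_mono[OF assms(7)]) auto
      show "star i p \<inter> (star i q \<union> (\<Union>r\<in>V. star i r)) = {}"
        using D[OF False] star_disjoint[OF assms(5)] by blast
    qed (use E am assms(8) in \<open>auto intro: all_moments_mult\<close>)
    then show ?thesis using centred[of i p c] assms by (simp add: eq mult.assoc)
  next
    case True
    then have q: "q \<notin> V" using assms(6) by simp
    have "expectation (\<lambda>x. Z c' q i x * (Z c i p x * g x)) = expectation (Z c' q i) * expectation (\<lambda>x. Z c i p x * g x)"
    proof (rule expectation_mult_indep[OF m(2)])
      show "(\<lambda>x. Z c i p x * g x) \<in> borel_measurable (edge_algebra (star i p \<union> (\<Union>r\<in>V. star i r)))"
        by (intro borel_measurable_times measurable_edge_algebra_mono[OF m(1)] measurable_edge_algebra_mono[OF assms(7)]) auto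
      show "star i q \<inter> (star i p \<union> (\<Union>r\<in>V. star i r)) = {}"
        using D[OF q] star_disjoint[OF assms(5)] by blast
    qed (use E am assms(8) in \<open>auto intro: all_moments_mult\<close>)
    then show ?thesis using centred[of q i c'] assms by (simp add: eq mult_ac)
  qed
qed

text \<open>Either an off-diagonal pair has a vertex missing from the other pair, or both pairs are
  diagonal at different vertices and independent. The swapped pair has to be excluded: for a real
  array and equal letters its correlation with \<open>(p, q)\<close> is that of a variable with
  itself.\<close>

lemma centred_pair_uncorrelated:
  assumes "i < N" "p < N" "q < N" "p' < N" "q' < N" "i \<notin> {p, q, p', q'}"
    and ne: "(p', q') \<noteq> (p, q)" "(p', q') \<noteq> (q, p)"
  shows "expectation (\<lambda>x. centred_pair c c' i p q x * cnj (centred_pair c c' i p' q' x)) = 0"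
proof -
  let ?\<xi> = "centred_pair c c' i"
  have g: "(\<lambda>x. cnj (?\<xi> r s x)) \<in> borel_measurable (edge_algebra (\<Union>r\<in>{r, s}. star i r))"
      "(\<lambda>x. cnj (?\<xi> r s x)) \<in> all_moments M" if "r < N" "s < N" for r s
    using cnj_measurable[OF centred_pair_measurable[of i r s c c']] centred_pair_all_moments[of i r s] that assms(1)
    by (auto intro: all_moments_cnj)
  have flip: "expectation (\<lambda>x. ?\<xi> p q x * cnj (?\<xi> p' q' x)) = cnj (expectation (\<lambda>x. ?\<xi> p' q' x * cnj (?\<xi> p q x)))"
    by (subst Bochner_Integration.integral_cnj[symmetric]) (simp add: mult.commute)
  consider "p \<noteq> q" "p \<notin> {p', q'} \<or> q \<notin> {p', q'}" | "p' \<noteq> q'" "p' \<notin> {p, q} \<or> q' \<notin> {p, q}"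
    | "p = q" "p' = q'" "p \<noteq> p'"
    using ne by auto
  then show ?thesis
  proof cases
    case 1
    show ?thesis by (rule centred_pair_lonely[OF _ _ _ _ 1(1,2) g]) (use assms in auto)
  next
    case 2
    have "expectation (\<lambda>x. ?\<xi> p' q' x * cnj (?\<xi> p q x)) = 0"
      by (rule centred_pair_lonely[OF _ _ _ _ 2(1,2) g]) (use assms in auto)
    then show ?thesis unfolding flip by simp
  next
    case 3
    have "expectation (\<lambda>x. ?\<xi> p q x * cnj (?\<xi> p' q' x)) = expectation (?\<xi> p q) * expectation (\<lambda>x. cnj (?\<xi> p' q' x))"
    proof (rule expectation_mult_indep)
      show "?\<xi> p q \<in> borel_measurable (edge_algebra (star i p))"
        using centred_pair_measurable[of i p p c c'] assms 3 by simp
      show "(\<lambda>x. cnj (?\<xi> p' q' x)) \<in> borel_measurable (edge_algebra (star i p'))"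
        using cnj_measurable[OF centred_pair_measurable[of i p' p' c c']] assms 3 by simp
      show "star i p \<subseteq> edges" "star i p' \<subseteq> edges" "star i p \<inter> star i p' = {}"
        by (rule star_edges star_disjoint; use assms 3 in simp)+
    qed (use assms in \<open>auto intro!: centred_pair_all_moments all_moments_cnj\<close>)
    then show ?thesis using expectation_centred_pair_diag[of i p c c'] assms 3 by simp
  qed
qed

text \<open>The constant comes from (y + 1)^2 \<le> 2 y^2 + 2 and y^2 \<le> a^4 + b^4, where y = a b
  is the product of the two moduli.\<close>

lemma centred_pair_second_moment_le:
  assumes "i < N" "p < N" "q < N"
  shows "expectation (\<lambda>x. (cmod (centred_pair c c' i p q x))\<^sup>2) \<le> 4 * K 4 + 2"
proof -
  have am: "Z c i p \<in> all_moments M" "Z c' q i \<in> all_moments M"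
    using assms by (auto intro: entry_all_moments)
  have "expectation (\<lambda>x. (cmod (centred_pair c c' i p q x))\<^sup>2) \<le>
      expectation (\<lambda>x. 2 * (cmod (Z c i p x) ^ 4 + cmod (Z c' q i x) ^ 4) + 2)"
  proof (rule integral_mono)
    show "integrable M (\<lambda>x. (cmod (centred_pair c c' i p q x))\<^sup>2)"
      using assms by (intro all_moments_integrable_power centred_pair_all_moments)
    show "integrable M (\<lambda>x. 2 * (cmod (Z c i p x) ^ 4 + cmod (Z c' q i x) ^ 4) + 2)"
      using am by (simp add: all_moments_integrable_power)
    fix x
    let ?y = "cmod (Z c i p x) * cmod (Z c' q i x)"
    have "cmod (centred_pair c c' i p q x) \<le> ?y + 1"
      unfolding centred_pair_def by (rule order_trans[OF norm_triangle_ineq4]) (auto simp: norm_mult)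
    then have "(cmod (centred_pair c c' i p q x))\<^sup>2 \<le> (?y + 1)\<^sup>2"
      by (intro power_mono) auto
    also have "\<dots> \<le> 2 * ?y\<^sup>2 + 2"
      using sum_squares_bound[of ?y 1] by (simp add: power2_sum)
    also have "?y\<^sup>2 \<le> cmod (Z c i p x) ^ (2 * 2) + cmod (Z c' q i x) ^ (2 * 2)"
      by (rule power_mult_le_sum) auto
    finally show "(cmod (centred_pair c c' i p q x))\<^sup>2 \<le> 2 * (cmod (Z c i p x) ^ 4 + cmod (Z c' q i x) ^ 4) + 2"
      by simp
  qed
  also have "\<dots> = 2 * (expectation (\<lambda>x. cmod (Z c i p x) ^ 4) + expectation (\<lambda>x. cmod (Z c' q i x) ^ 4)) + 2"
    using am by (simp add: all_moments_integrable_power prob_space)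
  also have "\<dots> \<le> 2 * (K 4 + K 4) + 2"
    using assms by (intro add_right_mono mult_left_mono add_mono entry_moment_le) auto
  finally show ?thesis by simp
qed

lemma centred_pair_correlation_le:
  assumes "i < N" "p < N" "q < N" "p' < N" "q' < N"
  shows "cmod (expectation (\<lambda>x. centred_pair c c' i p q x * cnj (centred_pair c c' i p' q' x))) \<le> 4 * K 4 + 2"
proof -
  let ?\<xi> = "centred_pair c c' i"
  have B: "0 \<le> 4 * K 4 + 2" using K_nonneg[of 4] by simp
  have "cmod (expectation (\<lambda>x. ?\<xi> p q x * cnj (?\<xi> p' q' x))) \<le> expectation (\<lambda>x. cmod (?\<xi> p q x * cnj (?\<xi> p' q' x)))"
    by simp
  also have "\<dots> = expectation (\<lambda>x. cmod (?\<xi> p q x) * cmod (?\<xi> p' q' x))"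
    by (simp add: norm_mult)
  also have "\<dots> \<le> sqrt (expectation (\<lambda>x. (cmod (?\<xi> p q x))\<^sup>2)) * sqrt (expectation (\<lambda>x. (cmod (?\<xi> p' q' x))\<^sup>2))"
    using assms by (intro Cauchy_Schwarz_all_moments centred_pair_all_moments)
  also have "\<dots> \<le> sqrt (4 * K 4 + 2) * sqrt (4 * K 4 + 2)"
    using assms B by (intro mult_mono real_sqrt_le_mono centred_pair_second_moment_le) (auto intro!: real_sqrt_ge_zero)
  finally show ?thesis using B by simp
qed

section \<open>Second moments of quadratic and linear forms\<close>

definition inner_edges :: "nat set \<Rightarrow> ('c \<times> nat \<times> nat) set" where
  "inner_edges S = {e. \<exists>c. \<exists>a\<in>S. \<exists>b\<in>S. e = edge_key c a b}"

lemma inner_edges_edges: "S \<subseteq> {..<N} \<Longrightarrow> inner_edges S \<subseteq> edges"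
  unfolding inner_edges_def by (safe, simp only:) (rule edge_key_edges, auto)

lemma star_inner_edges_disjoint: "i \<notin> S \<Longrightarrow> star i p \<inter> inner_edges S = {}"
proof (safe)
  fix c' v v' assume i: "i \<notin> S" and e: "(c', v, v') \<in> star i p" "(c', v, v') \<in> inner_edges S"
  obtain c where c: "(c', v, v') = edge_key c i p" using e(1) by (auto simp: star_def)
  obtain d a b where d: "a \<in> S" "b \<in> S" "(c', v, v') = edge_key d a b"
    using e(2) by (auto simp: inner_edges_def)
  then have "{i, p} = {a, b}" using c by (simp add: edge_key_eq_iff)
  then show "(c', v, v') \<in> {}" using d(1,2) i by (auto simp: doubleton_eq_iff)
qed

lemma wp_measurable_away:
  assumes "S \<subseteq> {..<N}" "p \<in> S"
  shows "wp S u p q \<in> borel_measurable (edge_algebra (inner_edges S))"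
  using assms by (intro wp_measurable) (auto simp: inner_edges_def)

text \<open>The coefficients live on edges inside \<open>S\<close>, the pairs on edges at
  \<open>i\<close>, so expectations factor. The sum of the squared coefficients is at most
  \<open>N\<close> row norms, hence of order \<open>N\<close> rather than N^2; the normalised form
  has variance of order 1/N.\<close>

lemma quadratic_form_le:
  assumes S: "S \<subseteq> {..<N}" "i < N" "i \<notin> S"
  shows "expectation (\<lambda>x. (cmod (\<Sum>p\<in>S. \<Sum>q\<in>S. centred_pair c c' i p q x * wp S u p q x))\<^sup>2) \<le>
    2 * (4 * K 4 + 2) * (N * walk_bound K (2 * length u))"
proof -
  have SN: "p < N" "p \<noteq> i" if "p \<in> S" for p using that S by auto
  let ?J = "inner_edges S"
  note J = inner_edges_edges[OF S(1)] and disj = star_inner_edges_disjoint[OF S(3)]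
  have wpm: "wp S u p q \<in> borel_measurable (edge_algebra ?J)" "wp S u p q \<in> all_moments M" if "p \<in> S" for p q
    using that S(1) by (auto intro: wp_measurable_away wp_all_moments)
  have "expectation (\<lambda>x. (cmod (\<Sum>a\<in>S\<times>S. centred_pair c c' i (fst a) (snd a) x * wp S u (fst a) (snd a) x))\<^sup>2) \<le>
      2 * (4 * K 4 + 2) * (\<Sum>a\<in>S\<times>S. expectation (\<lambda>x. (cmod (wp S u (fst a) (snd a) x))\<^sup>2))"
  \<comment> \<open>The second surviving partner of (p, q) is (q, p).\<close>
  proof (rule second_moment_form_le[where \<sigma> = prod.swap])
    show "finite (S \<times> S)" using finite_subset_N[OF S(1)] by simp
    show "bij_betw prod.swap (S \<times> S) (S \<times> S)"
      by (auto simp: bij_betw_def inj_on_def image_iff)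
    show "0 \<le> 4 * K 4 + 2" using K_nonneg[of 4] by simp
    fix a b assume a: "a \<in> S \<times> S" and b: "b \<in> S \<times> S"
    show "cmod (expectation (\<lambda>x. centred_pair c c' i (fst a) (snd a) x * cnj (centred_pair c c' i (fst b) (snd b) x))) \<le> 4 * K 4 + 2"
      using a b S SN by (intro centred_pair_correlation_le) auto
    show "expectation (\<lambda>x. centred_pair c c' i (fst a) (snd a) x * cnj (centred_pair c c' i (fst b) (snd b) x)) = 0"
      if "b \<noteq> a" "b \<noteq> prod.swap a"
      using a b that S SN by (intro centred_pair_uncorrelated) (auto simp: prod_eq_iff)
    let ?J' = "star i (fst a) \<union> star i (snd a) \<union> (star i (fst b) \<union> star i (snd b))"
    show "expectation (\<lambda>x. (centred_pair c c' i (fst a) (snd a) x * cnj (centred_pair c c' i (fst b) (snd b) x)) *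
          (wp S u (fst a) (snd a) x * cnj (wp S u (fst b) (snd b) x))) =
        expectation (\<lambda>x. centred_pair c c' i (fst a) (snd a) x * cnj (centred_pair c c' i (fst b) (snd b) x)) *
        expectation (\<lambda>x. wp S u (fst a) (snd a) x * cnj (wp S u (fst b) (snd b) x))"
    proof (rule expectation_mult_indep[where ?J1.0 = ?J' and ?J2.0 = ?J])
      show "(\<lambda>x. centred_pair c c' i (fst a) (snd a) x * cnj (centred_pair c c' i (fst b) (snd b) x)) \<in> borel_measurable (edge_algebra ?J')"
        using a b SN S(2)
        by (intro borel_measurable_times cnj_measurable measurable_edge_algebra_mono[OF centred_pair_measurable]) auto
      show "(\<lambda>x. wp S u (fst a) (snd a) x * cnj (wp S u (fst b) (snd b) x)) \<in> borel_measurable (edge_algebra ?J)"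
        using a b by (intro borel_measurable_times cnj_measurable wpm) auto
      show "?J' \<subseteq> edges" using a b SN S(2) by (auto dest!: star_edges[THEN subsetD, rotated 2])
      show "?J' \<inter> ?J = {}" using disj by blast
      show "(\<lambda>x. centred_pair c c' i (fst a) (snd a) x * cnj (centred_pair c c' i (fst b) (snd b) x)) \<in> all_moments M"
        using a b SN S(2) by (intro all_moments_mult all_moments_cnj centred_pair_all_moments) auto
      show "(\<lambda>x. wp S u (fst a) (snd a) x * cnj (wp S u (fst b) (snd b) x)) \<in> all_moments M"
        using a b by (intro all_moments_mult all_moments_cnj wpm) auto
    qed (rule J)
  qed (use S SN in \<open>auto intro: centred_pair_all_moments wpm\<close>)
  also have "(\<Sum>a\<in>S\<times>S. expectation (\<lambda>x. (cmod (wp S u (fst a) (snd a) x))\<^sup>2)) =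
      (\<Sum>p\<in>S. \<Sum>q\<in>S. expectation (\<lambda>x. (cmod (wp S u p q x))\<^sup>2))"
    by (simp add: sum.cartesian_product case_prod_beta)
  also have "\<dots> \<le> (\<Sum>p\<in>S. walk_bound K (2 * length u))"
    by (intro sum_mono sum_second_moments_le S)
  also have "\<dots> \<le> N * walk_bound K (2 * length u)"
    using card_mono[OF _ S(1)] walk_bound_nonneg by (simp add: mult_right_mono)
  finally show ?thesis
    using K_nonneg[of 4] by (simp add: sum.cartesian_product case_prod_beta mult_left_mono)
qed

text \<open>Only one row of the minor enters, so the bound is free of \<open>N\<close>, and the
  normalised form tends to 0.\<close>

lemma linear_form_le:
  assumes S: "S \<subseteq> {..<N}" "i < N" "i \<notin> S" "p \<in> S"
  shows "expectation (\<lambda>x. (cmod (\<Sum>q\<in>S. wp S u p q x * Z c q i x))\<^sup>2) \<le> 2 * (K 2 * walk_bound K (2 * length u))"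
proof -
  have SN: "p < N" "p \<noteq> i" if "p \<in> S" for p using that S by auto
  let ?J = "inner_edges S"
  note J = inner_edges_edges[OF S(1)] and disj = star_inner_edges_disjoint[OF S(3)]
  have wpm: "wp S u p q \<in> borel_measurable (edge_algebra ?J)" "wp S u p q \<in> all_moments M" for q
    using S by (auto intro: wp_measurable_away wp_all_moments)
  have Zm: "Z c q i \<in> borel_measurable (edge_algebra (star i q))" "Z c q i \<in> all_moments M" if "q \<in> S" for q
    using that SN S by (auto intro: entry_all_moments entry_measurable_edge_algebra edge_key_star)
  have "expectation (\<lambda>x. (cmod (\<Sum>q\<in>S. Z c q i x * wp S u p q x))\<^sup>2) \<le>
      2 * K 2 * (\<Sum>q\<in>S. expectation (\<lambda>x. (cmod (wp S u p q x))\<^sup>2))"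
  \<comment> \<open>Different entries of one column are uncorrelated, so only the diagonal survives;
    the identity counts it twice, which is the source of the factor 2.\<close>
  proof (rule second_moment_form_le[where \<sigma> = "\<lambda>q. q"])
    show "bij_betw (\<lambda>q. q) S S" by (simp add: bij_betw_def)
    fix a b assume a: "a \<in> S" and b: "b \<in> S"
    show "cmod (expectation (\<lambda>x. Z c a i x * cnj (Z c b i x))) \<le> K 2"
    proof -
      have "cmod (expectation (\<lambda>x. Z c a i x * cnj (Z c b i x))) \<le> expectation (\<lambda>x. cmod (Z c a i x * cnj (Z c b i x)))"
        by simp
      also have "\<dots> = expectation (\<lambda>x. cmod (Z c a i x) * cmod (Z c b i x))"
        by (simp add: norm_mult)
      also have "\<dots> \<le> sqrt (expectation (\<lambda>x. (cmod (Z c a i x))\<^sup>2)) * sqrt (expectation (\<lambda>x. (cmod (Z c b i x))\<^sup>2))"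
        using a b by (intro Cauchy_Schwarz_all_moments Zm)
      also have "\<dots> \<le> sqrt (K 2) * sqrt (K 2)"
        using a b S SN K_nonneg[of 2] by (intro mult_mono real_sqrt_le_mono entry_moment_le) (auto intro!: real_sqrt_ge_zero)
      finally show ?thesis using K_nonneg[of 2] by simp
    qed
    show "expectation (\<lambda>x. Z c a i x * cnj (Z c b i x)) = 0" if "b \<noteq> a"
    proof -
      have "expectation (\<lambda>x. Z c a i x * cnj (Z c b i x)) = expectation (Z c a i) * expectation (\<lambda>x. cnj (Z c b i x))"
        using a b S SN that star_disjoint[of a b i]
        by (intro expectation_mult_indep[OF Zm(1) cnj_measurable[OF Zm(1)]] star_edges all_moments_cnj Zm) auto
      then show ?thesis using centred[of a i c] a S SN by simp
    qed
    show "expectation (\<lambda>x. (Z c a i x * cnj (Z c b i x)) * (wp S u p a x * cnj (wp S u p b x))) =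
        expectation (\<lambda>x. Z c a i x * cnj (Z c b i x)) * expectation (\<lambda>x. wp S u p a x * cnj (wp S u p b x))"
    proof (rule expectation_mult_indep[where ?J1.0 = "star i a \<union> star i b" and ?J2.0 = ?J])
      show "(\<lambda>x. Z c a i x * cnj (Z c b i x)) \<in> borel_measurable (edge_algebra (star i a \<union> star i b))"
        using a b by (intro borel_measurable_times cnj_measurable measurable_edge_algebra_mono[OF Zm(1)]) auto
      show "(\<lambda>x. wp S u p a x * cnj (wp S u p b x)) \<in> borel_measurable (edge_algebra ?J)"
        by (intro borel_measurable_times cnj_measurable wpm)
      show "star i a \<union> star i b \<subseteq> edges" using a b SN S(2) star_edges by auto
      show "(star i a \<union> star i b) \<inter> ?J = {}" using disj by blast
    qed (use a b in \<open>auto intro!: J all_moments_mult all_moments_cnj wpm Zm\<close>)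
  qed (use S K_nonneg finite_subset_N[OF S(1)] in \<open>auto intro: Zm wpm\<close>)
  also have "\<dots> \<le> 2 * K 2 * walk_bound K (2 * length u)"
    using S K_nonneg[of 2] by (intro mult_left_mono sum_second_moments_le) auto
  finally show ?thesis by (simp add: mult.commute mult.assoc)
qed

end


section \<open>Entrywise limits of words\<close>

lemma norm_add3_sq_le: "(cmod (x + y + z))\<^sup>2 \<le> 3 * ((cmod x)\<^sup>2 + (cmod y)\<^sup>2 + (cmod z)\<^sup>2)"
proof -
  let ?a = "cmod x" and ?b = "cmod y" and ?c = "cmod z"
  have "cmod (x + y + z) \<le> ?a + ?b + ?c"
    by (meson norm_triangle_ineq norm_triangle_mono order_refl order_trans add_right_mono)
  then have "(cmod (x + y + z))\<^sup>2 \<le> (?a + ?b + ?c)\<^sup>2"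
    by (intro power_mono) auto
  also have "\<dots> \<le> 3 * (?a\<^sup>2 + ?b\<^sup>2 + ?c\<^sup>2)"
    using sum_squares_bound[of ?a ?b] sum_squares_bound[of ?b ?c] sum_squares_bound[of ?a ?c]
    by (simp add: power2_eq_square algebra_simps)
  finally show ?thesis .
qed

lemma (in prob_space) expectation_norm_le_sqrt:
  assumes "f \<in> all_moments M"
  shows "expectation (\<lambda>x. cmod (f x)) \<le> sqrt (expectation (\<lambda>x. (cmod (f x))\<^sup>2))"
  using Cauchy_Schwarz_all_moments[OF assms all_moments_const[OF finite_measure_axioms, of 1]]
  by (simp add: prob_space)

context wigner_family
begin

lemma entry_mult: "entry x c i p * entry x c' q i = Z c i p x * Z c' q i x / of_nat N"
proof -
  have "complex_of_real (sqrt (real N)) * complex_of_real (sqrt (real N)) = of_nat N"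
    by (simp flip: of_real_mult)
  then show ?thesis by (simp add: scaled_entry_def)
qed

text \<open>Jensen's inequality for the normalised sum. A bound on diagonal entries that is uniform
  in the vertex thus controls the normalised trace of the minor, and the induction needs no separate
  statement about traces.\<close>

lemma average_le:
  assumes S: "S \<subseteq> {..<N}" and a: "\<And>p. p \<in> S \<Longrightarrow> expectation (\<lambda>x. (cmod (wp S u p p x - f))\<^sup>2) \<le> a" "0 \<le> a"
  shows "expectation (\<lambda>x. (cmod ((\<Sum>p\<in>S. wp S u p p x - f) / of_nat N))\<^sup>2) \<le> a"
proof -
  have am: "(\<lambda>x. wp S u p p x - f) \<in> all_moments M" if "p \<in> S" for p
    using that S by (intro all_moments_diff wp_all_moments all_moments_const finite_measure_M)
  have card: "real (card S) \<le> real N"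
    using card_mono[OF _ S] by simp
  have "expectation (\<lambda>x. (cmod ((\<Sum>p\<in>S. wp S u p p x - f) / of_nat N))\<^sup>2) \<le>
      expectation (\<lambda>x. (\<Sum>p\<in>S. (cmod (wp S u p p x - f))\<^sup>2) / real N)"
  proof (rule integral_mono)
    have "(\<lambda>x. (1 / of_nat N) * (\<Sum>p\<in>S. wp S u p p x - f)) \<in> all_moments M"
      by (intro all_moments_cmult all_moments_sum am finite_measure_M)
    then have "(\<lambda>x. (\<Sum>p\<in>S. wp S u p p x - f) / of_nat N) \<in> all_moments M"
      by simp
    then show "integrable M (\<lambda>x. (cmod ((\<Sum>p\<in>S. wp S u p p x - f) / of_nat N))\<^sup>2)"
      by (rule all_moments_integrable_power)
    show "integrable M (\<lambda>x. (\<Sum>p\<in>S. (cmod (wp S u p p x - f))\<^sup>2) / real N)"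
      by (intro integrable_divide Bochner_Integration.integrable_sum all_moments_integrable_power am)
    fix x
    have "(cmod (\<Sum>p\<in>S. wp S u p p x - f))\<^sup>2 \<le> (\<Sum>p\<in>S. cmod (wp S u p p x - f))\<^sup>2"
      by (intro power_mono norm_sum) auto
    also have "\<dots> \<le> (\<Sum>p\<in>S. (cmod (wp S u p p x - f))\<^sup>2) * real (card S)"
      by (rule sum_squared_le_sum_of_squares)
    also have "\<dots> \<le> (\<Sum>p\<in>S. (cmod (wp S u p p x - f))\<^sup>2) * real N"
      using card by (intro mult_left_mono sum_nonneg) auto
    finally show "(cmod ((\<Sum>p\<in>S. wp S u p p x - f) / of_nat N))\<^sup>2 \<le> (\<Sum>p\<in>S. (cmod (wp S u p p x - f))\<^sup>2) / real N"
      using N_pos by (simp add: norm_divide power_divide divide_simps power2_eq_square mult_ac)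
  qed
  also have "\<dots> = (\<Sum>p\<in>S. expectation (\<lambda>x. (cmod (wp S u p p x - f))\<^sup>2)) / real N"
    by (simp add: all_moments_integrable_power am)
  also have "\<dots> \<le> (\<Sum>p\<in>S. a) / real N"
    using a(1) by (intro divide_right_mono sum_mono) auto
  also have "\<dots> \<le> a"
    using mult_right_mono[OF card a(2)] N_pos by (simp add: divide_simps mult.commute)
  finally show ?thesis .
qed

text \<open>The bracket in \<open>wprod_first_return\<close>: out of \<open>i\<close>, through the
  minor along \<open>u\<close>, and back.\<close>

definition excursion :: "nat set \<Rightarrow> 'c \<Rightarrow> 'c list \<Rightarrow> 'c \<Rightarrow> nat \<Rightarrow> 'a \<Rightarrow> complex" where
  "excursion S c u c' i = (\<lambda>x. \<Sum>p\<in>S. \<Sum>q\<in>S. entry x c i p * entry x c' q i * wp S u p q x)"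

lemma excursion_all_moments:
  assumes "S \<subseteq> {..<N}" "i < N"
  shows "excursion S c u c' i \<in> all_moments M"
  unfolding excursion_def using assms
  by (intro all_moments_sum all_moments_mult entry_all_moments' wp_all_moments finite_measure_M) auto

text \<open>Dividing the bound of \<open>quadratic_form_le\<close> by the square of \<open>N\<close>
  leaves this constant over \<open>N\<close>.\<close>

definition excursion_bound :: "nat \<Rightarrow> real" where
  "excursion_bound n = 2 * (4 * K 4 + 2) * walk_bound K (2 * n)"

text \<open>Three errors: the fluctuation of the form around its conditional mean, the deviation of
  the trace of the minor from its limit, and the at most \<open>d\<close> missing vertices, since
  the sum over \<open>S\<close> is divided by \<open>N\<close>. The factor 3 is that of
  \<open>norm_add3_sq_le\<close>.\<close>

lemma excursion_le:
  assumes S: "S \<subseteq> {..<N}" "i < N" "i \<notin> S" and d: "N \<le> card S + d"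
    and a: "\<And>p. p \<in> S \<Longrightarrow> expectation (\<lambda>x. (cmod (wp S u p p x - complex_of_real f))\<^sup>2) \<le> a" "0 \<le> a"
  shows "expectation (\<lambda>x. (cmod (excursion S c u c' i x - complex_of_real (if c' = c then f else 0)))\<^sup>2) \<le>
    3 * (excursion_bound (length u) / real N + a + (real d / real N * f)\<^sup>2)"
proof -
  let ?T = "\<lambda>x. \<Sum>p\<in>S. \<Sum>q\<in>S. centred_pair c c' i p q x * wp S u p q x"
  let ?A = "\<lambda>x. \<Sum>p\<in>S. wp S u p p x - complex_of_real f"
  define \<delta> where "\<delta> = (if c' = c then 1 else 0 :: complex)"
  let ?X1 = "\<lambda>x. ?T x / of_nat N"
  let ?X2 = "\<lambda>x. \<delta> * (?A x / of_nat N)"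
  let ?X3 = "\<delta> * complex_of_real ((real (card S) / real N - 1) * f)"
  have SN: "p < N" if "p \<in> S" for p using that S by auto
  have fin: "finite S" by (rule finite_subset_N[OF S(1)])
  have split: "excursion S c u c' i x - complex_of_real (if c' = c then f else 0) = ?X1 x + ?X2 x + ?X3" for x
  proof -
    have "(\<Sum>p\<in>S. \<Sum>q\<in>S. Z c i p x * Z c' q i x * wp S u p q x) =
        (\<Sum>p\<in>S. \<Sum>q\<in>S. centred_pair c c' i p q x * wp S u p q x + (if q = p then \<delta> * wp S u p p x else 0))"
      by (intro sum.cong refl) (auto simp: centred_pair_def \<delta>_def left_diff_distrib)
    also have "\<dots> = ?T x + (\<Sum>p\<in>S. \<Sum>q\<in>S. if q = p then \<delta> * wp S u p p x else 0)"
      by (simp only: sum.distrib)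
    also have "(\<Sum>p\<in>S. \<Sum>q\<in>S. if q = p then \<delta> * wp S u p p x else 0) = (\<Sum>p\<in>S. \<delta> * wp S u p p x)"
      using fin by (intro sum.cong refl) simp
    also have "\<dots> = \<delta> * (\<Sum>p\<in>S. wp S u p p x)"
      by (simp only: sum_distrib_left)
    also have "(\<Sum>p\<in>S. wp S u p p x) = ?A x + of_nat (card S) * complex_of_real f"
      by (simp add: sum_subtractf)
    finally have "(\<Sum>p\<in>S. \<Sum>q\<in>S. Z c i p x * Z c' q i x * wp S u p q x) =
        ?T x + \<delta> * (?A x + of_nat (card S) * complex_of_real f)" .
    moreover have "excursion S c u c' i x = (\<Sum>p\<in>S. \<Sum>q\<in>S. Z c i p x * Z c' q i x * wp S u p q x) / of_nat N"
      unfolding excursion_def entry_mult by (simp add: sum_divide_distrib)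
    ultimately have "excursion S c u c' i x = (?T x + \<delta> * (?A x + of_nat (card S) * complex_of_real f)) / of_nat N"
      by simp
    moreover have "complex_of_real (if c' = c then f else 0) = \<delta> * complex_of_real f"
      by (simp add: \<delta>_def)
    ultimately show ?thesis
      using N_pos by (simp add: add_divide_distrib distrib_left left_diff_distrib right_diff_distrib)
  qed
  have am: "?X1 \<in> all_moments M" "?X2 \<in> all_moments M" "(\<lambda>x. ?X3) \<in> all_moments M"
  proof -
    have "?T \<in> all_moments M"
      using S SN by (intro all_moments_sum all_moments_mult centred_pair_all_moments wp_all_moments finite_measure_M) auto
    from all_moments_cmult[OF finite_measure_M this, of "1 / of_nat N"] show "?X1 \<in> all_moments M" by simp
    have "?A \<in> all_moments M"
      using S by (intro all_moments_sum all_moments_diff wp_all_moments all_moments_const finite_measure_M) auto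
    from all_moments_cmult[OF finite_measure_M this, of "\<delta> / of_nat N"] show "?X2 \<in> all_moments M" by simp
    show "(\<lambda>x. ?X3) \<in> all_moments M" by (intro all_moments_const finite_measure_M)
  qed
  have int: "integrable M (\<lambda>x. (cmod (?X1 x))\<^sup>2)" "integrable M (\<lambda>x. (cmod (?X2 x))\<^sup>2)" "integrable M (\<lambda>x. (cmod ?X3)\<^sup>2)"
    by (intro all_moments_integrable_power am)+
  have "expectation (\<lambda>x. (cmod (excursion S c u c' i x - complex_of_real (if c' = c then f else 0)))\<^sup>2) \<le>
      expectation (\<lambda>x. 3 * ((cmod (?X1 x))\<^sup>2 + (cmod (?X2 x))\<^sup>2 + (cmod ?X3)\<^sup>2))"
    unfolding split
  proof (rule integral_mono)
    show "integrable M (\<lambda>x. (cmod (?X1 x + ?X2 x + ?X3))\<^sup>2)"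
      by (intro all_moments_integrable_power all_moments_add am)
    show "integrable M (\<lambda>x. 3 * ((cmod (?X1 x))\<^sup>2 + (cmod (?X2 x))\<^sup>2 + (cmod ?X3)\<^sup>2))"
      by (intro integrable_mult_right Bochner_Integration.integrable_add int)
  qed (rule norm_add3_sq_le)
  also have "\<dots> = 3 * (expectation (\<lambda>x. (cmod (?X1 x))\<^sup>2) + expectation (\<lambda>x. (cmod (?X2 x))\<^sup>2) + (cmod ?X3)\<^sup>2)"
    by (simp only: Bochner_Integration.integral_add int Bochner_Integration.integrable_add integral_mult_right_zero lebesgue_integral_const prob_space) simp
  also have "\<dots> \<le> 3 * (excursion_bound (length u) / real N + a + (real d / real N * f)\<^sup>2)"
  proof (intro mult_left_mono add_mono)
    have "expectation (\<lambda>x. (cmod (?X1 x))\<^sup>2) = expectation (\<lambda>x. (cmod (?T x))\<^sup>2) / (real N)\<^sup>2"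
      by (simp add: norm_divide power_divide)
    also have "\<dots> \<le> 2 * (4 * K 4 + 2) * (N * walk_bound K (2 * length u)) / (real N)\<^sup>2"
      by (intro divide_right_mono quadratic_form_le S) simp
    also have "\<dots> = excursion_bound (length u) / real N"
      using N_pos by (simp add: excursion_bound_def power2_eq_square)
    finally show "expectation (\<lambda>x. (cmod (?X1 x))\<^sup>2) \<le> excursion_bound (length u) / real N" .
    have "expectation (\<lambda>x. (cmod (?X2 x))\<^sup>2) \<le> expectation (\<lambda>x. (cmod (?A x / of_nat N))\<^sup>2)"
      by (cases "c' = c") (simp_all add: \<delta>_def)
    also have "\<dots> \<le> a" by (rule average_le[OF S(1) a])
    finally show "expectation (\<lambda>x. (cmod (?X2 x))\<^sup>2) \<le> a" .
    have card: "card S \<le> N" using card_mono[OF _ S(1)] by simp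
    have "cmod ?X3 \<le> \<bar>(real (card S) / real N - 1) * f\<bar>"
      by (simp only: norm_mult norm_of_real) (simp add: \<delta>_def)
    also have "\<dots> \<le> real d / real N * \<bar>f\<bar>"
      unfolding abs_mult using d card N_pos
      by (intro mult_right_mono) (auto simp: abs_le_iff divide_simps)
    finally have "(cmod ?X3)\<^sup>2 \<le> (real d / real N * \<bar>f\<bar>)\<^sup>2"
      by (intro power_mono) auto
    also have "\<dots> = (real d / real N * f)\<^sup>2"
      by (simp add: power_mult_distrib power_divide)
    finally show "(cmod ?X3)\<^sup>2 \<le> (real d / real N * f)\<^sup>2" .
  qed simp
  finally show ?thesis .
qed

text \<open>The recursion of \<open>free_moment\<close> is subtracted term by term, with R V - r v =
  (R - r) V + r (V - v). The first product needs Cauchy-Schwarz, as both factors involve column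
  \<open>i\<close>; in the second \<open>r\<close> is constant. The loop at \<open>i\<close> carries
  an unpaired normalisation and is of order 1/sqrt N.\<close>

lemma diagonal_step:
  assumes S: "S \<subseteq> {..<N}" "i \<in> S"
    and \<rho>: "\<And>k. k < length w \<Longrightarrow> expectation (\<lambda>x. (cmod (excursion (S - {i}) c (take k w) (w ! k) i x -
        complex_of_real (if w ! k = c then free_moment (take k w) else 0)))\<^sup>2) \<le> \<rho> k"
    and b: "\<And>k. k < length w \<Longrightarrow>
        expectation (\<lambda>x. (cmod (wp S (drop (Suc k) w) i i x - complex_of_real (free_moment (drop (Suc k) w))))\<^sup>2) \<le> b k"
  shows "expectation (\<lambda>x. cmod (wp S (c # w) i i x - complex_of_real (free_moment (c # w)))) \<le>
    sqrt (K 2 / real N) * sqrt (walk_moment_bound K (length w) 2) +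
    (\<Sum>k<length w. sqrt (\<rho> k) * sqrt (walk_moment_bound K (length w - Suc k) 2) + \<bar>free_moment (take k w)\<bar> * sqrt (b k))"
proof -
  let ?r = "\<lambda>k. complex_of_real (if w ! k = c then free_moment (take k w) else 0)"
  let ?R = "\<lambda>k x. excursion (S - {i}) c (take k w) (w ! k) i x - ?r k"
  let ?V = "\<lambda>k. wp S (drop (Suc k) w) i i"
  let ?D = "\<lambda>k x. ?V k x - complex_of_real (free_moment (drop (Suc k) w))"
  have i: "i < N" using S by auto
  have am: "(\<lambda>x. entry x c i i) \<in> all_moments M" "wp S w i i \<in> all_moments M"
      "?V k \<in> all_moments M" "?R k \<in> all_moments M" "?D k \<in> all_moments M" for k
    using S i by (auto intro!: entry_all_moments' wp_all_moments excursion_all_moments all_moments_diff all_moments_const finite_measure_M)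
  have eq: "wp S (c # w) i i x - complex_of_real (free_moment (c # w)) =
      entry x c i i * wp S w i i x + (\<Sum>k<length w. ?R k x * ?V k x + ?r k * ?D k x)" for x
  proof -
    have "complex_of_real (free_moment (c # w)) = (\<Sum>k<length w. ?r k * complex_of_real (free_moment (drop (Suc k) w)))"
      by (simp add: of_real_sum if_distrib cong: if_cong) (auto intro!: sum.cong)
    moreover have "(\<Sum>k<length w. ?R k x * ?V k x + ?r k * ?D k x) =
        (\<Sum>k<length w. excursion (S - {i}) c (take k w) (w ! k) i x * ?V k x) -
        (\<Sum>k<length w. ?r k * complex_of_real (free_moment (drop (Suc k) w)))"
      unfolding sum_subtractf[symmetric]
      by (intro sum.cong refl) (simp only: left_diff_distrib right_diff_distrib, simp)
    ultimately show ?thesis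
      unfolding wprod_first_return[OF finite_subset_N[OF S(1)] S(2)] excursion_def by simp
  qed
  have prod: "expectation (\<lambda>x. cmod (f x * g x)) \<le> sqrt A * sqrt B"
    if "f \<in> all_moments M" "g \<in> all_moments M" "expectation (\<lambda>x. (cmod (f x))\<^sup>2) \<le> A" "expectation (\<lambda>x. (cmod (g x))\<^sup>2) \<le> B" for f g A B
  proof -
    have "expectation (\<lambda>x. cmod (f x * g x)) \<le> sqrt (expectation (\<lambda>x. (cmod (f x))\<^sup>2)) * sqrt (expectation (\<lambda>x. (cmod (g x))\<^sup>2))"
      using Cauchy_Schwarz_all_moments[OF that(1,2)] by (simp add: norm_mult)
    also have "\<dots> \<le> sqrt A * sqrt B"
      using that(3,4) order_trans[OF integral_nonneg_AE that(3)]
      by (intro mult_mono real_sqrt_le_mono) (auto intro!: real_sqrt_ge_zero)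
    finally show ?thesis .
  qed
  have int: "integrable M (\<lambda>x. cmod (entry x c i i * wp S w i i x))"
      "integrable M (\<lambda>x. cmod (?R k x * ?V k x))" "integrable M (\<lambda>x. cmod (?r k) * cmod (?D k x))" for k
    by (rule all_moments_integrable_norm[OF all_moments_mult[OF am(1,2)]]
        all_moments_integrable_norm[OF all_moments_mult[OF am(4,3)]]
        integrable_mult_right[OF all_moments_integrable_norm[OF am(5)]])+
  have "expectation (\<lambda>x. cmod (wp S (c # w) i i x - complex_of_real (free_moment (c # w)))) \<le>
      expectation (\<lambda>x. cmod (entry x c i i * wp S w i i x) + (\<Sum>k<length w. cmod (?R k x * ?V k x) + cmod (?r k) * cmod (?D k x)))"
  proof (rule integral_mono)
    show "integrable M (\<lambda>x. cmod (wp S (c # w) i i x - complex_of_real (free_moment (c # w))))"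
      using S by (intro all_moments_integrable_norm all_moments_diff wp_all_moments all_moments_const finite_measure_M)
    show "integrable M (\<lambda>x. cmod (entry x c i i * wp S w i i x) + (\<Sum>k<length w. cmod (?R k x * ?V k x) + cmod (?r k) * cmod (?D k x)))"
      by (intro Bochner_Integration.integrable_add Bochner_Integration.integrable_sum int)
    show "cmod (wp S (c # w) i i x - complex_of_real (free_moment (c # w))) \<le>
        cmod (entry x c i i * wp S w i i x) + (\<Sum>k<length w. cmod (?R k x * ?V k x) + cmod (?r k) * cmod (?D k x))" for x
      unfolding eq
    proof (rule order_trans[OF norm_triangle_ineq], rule add_left_mono, rule sum_norm_le)
      fix k
      show "cmod (?R k x * ?V k x + ?r k * ?D k x) \<le> cmod (?R k x * ?V k x) + cmod (?r k) * cmod (?D k x)"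
        by (rule order_trans[OF norm_triangle_ineq]) (simp only: norm_mult)
    qed
  qed
  also have "\<dots> = expectation (\<lambda>x. cmod (entry x c i i * wp S w i i x)) +
      (\<Sum>k<length w. expectation (\<lambda>x. cmod (?R k x * ?V k x)) + cmod (?r k) * expectation (\<lambda>x. cmod (?D k x)))"
    using int by (simp only: Bochner_Integration.integral_add Bochner_Integration.integrable_sum
      Bochner_Integration.integrable_add Bochner_Integration.integral_sum integral_mult_right_zero)
  also have "\<dots> \<le> sqrt (K 2 / real N) * sqrt (walk_moment_bound K (length w) 2) +
    (\<Sum>k<length w. sqrt (\<rho> k) * sqrt (walk_moment_bound K (length w - Suc k) 2) + \<bar>free_moment (take k w)\<bar> * sqrt (b k))"
  proof (intro add_mono sum_mono)
    have "expectation (\<lambda>x. (cmod (entry x c i i))\<^sup>2) = expectation (\<lambda>x. (cmod (Z c i i x))\<^sup>2) / real N"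
      by (simp add: scaled_entry_def norm_divide power_divide)
    also have "\<dots> \<le> K 2 / real N"
      by (intro divide_right_mono entry_moment_le i) simp
    finally show "expectation (\<lambda>x. cmod (entry x c i i * wp S w i i x)) \<le>
        sqrt (K 2 / real N) * sqrt (walk_moment_bound K (length w) 2)"
      by (intro prod am wp_moment_le S)
    fix k assume "k \<in> {..<length w}"
    then have k: "k < length w" by simp
    show "expectation (\<lambda>x. cmod (?R k x * ?V k x)) \<le> sqrt (\<rho> k) * sqrt (walk_moment_bound K (length w - Suc k) 2)"
      using wp_moment_le[OF S(1) S(2) S(2), of "drop (Suc k) w" 2] by (intro prod am \<rho> k) simp
    show "cmod (?r k) * expectation (\<lambda>x. cmod (?D k x)) \<le> \<bar>free_moment (take k w)\<bar> * sqrt (b k)"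
    proof (rule mult_mono)
      show "expectation (\<lambda>x. cmod (?D k x)) \<le> sqrt (b k)"
        by (rule order_trans[OF expectation_norm_le_sqrt[OF am(5)] real_sqrt_le_mono[OF b[OF k]]])
    qed (auto simp: norm_of_real)
  qed
  finally show ?thesis .
qed

text \<open>At the first hit, \<open>i\<close> is entered through a single entry of its column, so
  each term is a linear form of order 1/sqrt N times a tail with bounded second moment.\<close>

lemma off_diagonal_le:
  assumes S: "S \<subseteq> {..<N}" "i \<in> S" "p \<in> S" "p \<noteq> i"
  shows "expectation (\<lambda>x. cmod (wp S w p i x)) \<le>
    (\<Sum>k<length w. sqrt (2 * (K 2 * walk_bound K (2 * k)) / real N) * sqrt (walk_moment_bound K (length w - Suc k) 2))"
proof -
  let ?Y = "\<lambda>k x. \<Sum>q\<in>S - {i}. wp (S - {i}) (take k w) p q x * entry x (w ! k) q i"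
  let ?V = "\<lambda>k. wp S (drop (Suc k) w) i i"
  have i: "i < N" using S by auto
  have S': "S - {i} \<subseteq> {..<N}" "p \<in> S - {i}" using S by auto
  have am: "?Y k \<in> all_moments M" "?V k \<in> all_moments M" for k
    using S S' by (auto intro!: all_moments_sum all_moments_mult entry_all_moments' wp_all_moments finite_measure_M)
  have Y: "expectation (\<lambda>x. (cmod (?Y k x))\<^sup>2) \<le> 2 * (K 2 * walk_bound K (2 * k)) / real N" if "k < length w" for k
  proof -
    have "?Y k x = (\<Sum>q\<in>S - {i}. wp (S - {i}) (take k w) p q x * Z (w ! k) q i x) / complex_of_real (sqrt (real N))" for x
      by (simp add: scaled_entry_def sum_divide_distrib)
    then have "expectation (\<lambda>x. (cmod (?Y k x))\<^sup>2) =
        expectation (\<lambda>x. (cmod (\<Sum>q\<in>S - {i}. wp (S - {i}) (take k w) p q x * Z (w ! k) q i x))\<^sup>2) / real N"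
      by (simp add: norm_divide power_divide)
    also have "\<dots> \<le> 2 * (K 2 * walk_bound K (2 * length (take k w))) / real N"
      by (intro divide_right_mono linear_form_le S' i) auto
    finally show ?thesis using that by (simp add: min_def)
  qed
  have "expectation (\<lambda>x. cmod (wp S w p i x)) \<le> expectation (\<lambda>x. \<Sum>k<length w. cmod (?Y k x) * cmod (?V k x))"
  proof (rule integral_mono)
    show "integrable M (\<lambda>x. cmod (wp S w p i x))"
      by (intro all_moments_integrable_norm wp_all_moments S)
    show "integrable M (\<lambda>x. \<Sum>k<length w. cmod (?Y k x) * cmod (?V k x))"
      using all_moments_integrable_mult_norm[OF am, of _ 1 _ 1] by (intro Bochner_Integration.integrable_sum) simp
    show "cmod (wp S w p i x) \<le> (\<Sum>k<length w. cmod (?Y k x) * cmod (?V k x))" for x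
      unfolding wprod_first_hit[OF finite_subset_N[OF S(1)] S(2) S'(2)] norm_mult[symmetric] by (rule norm_sum)
  qed
  also have "\<dots> = (\<Sum>k<length w. expectation (\<lambda>x. cmod (?Y k x) * cmod (?V k x)))"
    using all_moments_integrable_mult_norm[OF am, of _ 1 _ 1] by (intro Bochner_Integration.integral_sum) simp
  also have "\<dots> \<le> (\<Sum>k<length w. sqrt (2 * (K 2 * walk_bound K (2 * k)) / real N) * sqrt (walk_moment_bound K (length w - Suc k) 2))"
  proof (rule sum_mono)
    fix k assume "k \<in> {..<length w}"
    then have k: "k < length w" by simp
    have "expectation (\<lambda>x. cmod (?Y k x) * cmod (?V k x)) \<le>
        sqrt (expectation (\<lambda>x. (cmod (?Y k x))\<^sup>2)) * sqrt (expectation (\<lambda>x. (cmod (?V k x))\<^sup>2))"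
      by (rule Cauchy_Schwarz_all_moments[OF am])
    also have "\<dots> \<le> sqrt (2 * (K 2 * walk_bound K (2 * k)) / real N) * sqrt (walk_moment_bound K (length w - Suc k) 2)"
      using Y[OF k] wp_moment_le[OF S(1) S(2) S(2), of "drop (Suc k) w" 2] order_trans[OF integral_nonneg_AE Y[OF k]]
      by (intro mult_mono real_sqrt_le_mono) (auto intro!: real_sqrt_ge_zero)
    finally show "expectation (\<lambda>x. cmod (?Y k x) * cmod (?V k x)) \<le>
        sqrt (2 * (K 2 * walk_bound K (2 * k)) / real N) * sqrt (walk_moment_bound K (length w - Suc k) 2)" .
  qed
  finally show ?thesis .
qed

text \<open>\<open>diagonal_step\<close> consumes L2 bounds and produces an L1 bound; the third
  moment, bounded through \<open>wp_moment_le\<close>, closes the loop.\<close>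

lemma second_moment_from_first:
  assumes S: "S \<subseteq> {..<N}" "i \<in> S" and e: "expectation (\<lambda>x. cmod (wp S w i i x - complex_of_real f)) \<le> e"
  shows "expectation (\<lambda>x. (cmod (wp S w i i x - complex_of_real f))\<^sup>2) \<le>
    sqrt e * sqrt (2 ^ 3 * (walk_moment_bound K (length w) 3 + \<bar>f\<bar> ^ 3))"
proof -
  have am: "wp S w i i \<in> all_moments M" "(\<lambda>x. wp S w i i x - complex_of_real f) \<in> all_moments M"
    by (intro wp_all_moments S, intro all_moments_diff wp_all_moments all_moments_const finite_measure_M S)
  have int: "integrable M (\<lambda>x. cmod (wp S w i i x) ^ 3)"
    by (intro all_moments_integrable_power am)
  have "expectation (\<lambda>x. cmod (wp S w i i x - complex_of_real f) ^ 3) \<le>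
      expectation (\<lambda>x. 2 ^ 3 * (cmod (wp S w i i x) ^ 3 + \<bar>f\<bar> ^ 3))"
  proof (rule integral_mono)
    fix x
    have "cmod (wp S w i i x - complex_of_real f) ^ 3 \<le> (cmod (wp S w i i x) + cmod (complex_of_real f)) ^ 3"
      by (intro power_mono norm_triangle_ineq4 norm_ge_zero)
    also have "\<dots> \<le> 2 ^ 3 * (cmod (wp S w i i x) ^ 3 + cmod (complex_of_real f) ^ 3)"
      by (intro power_add_le_sum norm_ge_zero)
    finally show "cmod (wp S w i i x - complex_of_real f) ^ 3 \<le> 2 ^ 3 * (cmod (wp S w i i x) ^ 3 + \<bar>f\<bar> ^ 3)"
      by (simp only: norm_of_real)
  next
    show "integrable M (\<lambda>x. cmod (wp S w i i x - complex_of_real f) ^ 3)"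
      by (intro all_moments_integrable_power am)
    show "integrable M (\<lambda>x. 2 ^ 3 * (cmod (wp S w i i x) ^ 3 + \<bar>f\<bar> ^ 3))"
      using int by simp
  qed
  also have "\<dots> = 2 ^ 3 * (expectation (\<lambda>x. cmod (wp S w i i x) ^ 3) + \<bar>f\<bar> ^ 3)"
    using int by (simp add: prob_space)
  also have "\<dots> \<le> 2 ^ 3 * (walk_moment_bound K (length w) 3 + \<bar>f\<bar> ^ 3)"
    using S by (intro mult_left_mono add_right_mono wp_moment_le) auto
  finally have "sqrt (expectation (\<lambda>x. cmod (wp S w i i x - complex_of_real f) ^ 3)) \<le>
      sqrt (2 ^ 3 * (walk_moment_bound K (length w) 3 + \<bar>f\<bar> ^ 3))"
    by (rule real_sqrt_le_mono)
  moreover have "0 \<le> e" by (rule order_trans[OF _ e]) (simp add: integral_nonneg_AE)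
  ultimately show ?thesis
    using real_sqrt_le_mono[OF e]
    by (intro order_trans[OF second_moment_le[OF am(2)] mult_mono]) (auto intro!: real_sqrt_ge_zero)
qed

end


locale wigner_families = prob_sequence M N0 for M :: "nat \<Rightarrow> 'a measure" and N0 :: nat +
  fixes Z :: "nat \<Rightarrow> 'c \<Rightarrow> nat \<Rightarrow> nat \<Rightarrow> 'a \<Rightarrow> complex" and K :: "nat \<Rightarrow> real"
  assumes family: "N \<ge> N0 \<Longrightarrow> wigner_family (M N) N (Z N) K"
begin

abbreviation wps :: "nat \<Rightarrow> nat set \<Rightarrow> 'c list \<Rightarrow> nat \<Rightarrow> nat \<Rightarrow> 'a \<Rightarrow> complex" where
  "wps N S w i j x \<equiv> wprod (scaled_entry N (Z N) x) S w i j"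

text \<open>
  The estimate has to be uniform over the minors of bounded corank, since the induction step deletes
  a row and a column.
\<close>

lemma diagonal_tendsto:
  "\<exists>\<delta>. \<delta> \<longlonglongrightarrow> 0 \<and> (\<forall>N\<ge>N0. \<forall>S i. S \<subseteq> {..<N} \<longrightarrow> N \<le> card S + d \<longrightarrow> i \<in> S \<longrightarrow>
    (\<integral>x. (cmod (wps N S w i i x - complex_of_real (free_moment w)))\<^sup>2 \<partial>M N) \<le> \<delta> N)"
proof (induction "length w" arbitrary: w d rule: less_induct)
  case less
  show ?case
  proof (cases w)
    case Nil
    then show ?thesis by (intro exI[of _ "\<lambda>_. 0"]) auto
  next
    case (Cons c v)
    let ?P = "\<lambda>d w \<delta>. \<delta> \<longlonglongrightarrow> 0 \<and> (\<forall>N\<ge>N0. \<forall>S i. S \<subseteq> {..<N} \<longrightarrow> N \<le> card S + d \<longrightarrow> i \<in> S \<longrightarrow>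
      (\<integral>x. (cmod (wps N S w i i x - complex_of_real (free_moment w)))\<^sup>2 \<partial>M N) \<le> \<delta> N)"
    \<comment> \<open>The head of the split walk lives in \<open>S - {i}\<close>, whose corank is
      one larger; the tail, treated next, stays in \<open>S\<close> with corank
      \<open>d\<close>.\<close>
    have "\<exists>\<delta>. ?P (Suc d) (take k v) \<delta>" for k
    proof -
      have "length (take k v) < length w" using Cons by simp
      from less.hyps[OF this] show ?thesis .
    qed
    then obtain a where a: "\<And>k. ?P (Suc d) (take k v) (a k)" by (rule that[OF someI_ex])
    have "\<exists>\<delta>. ?P d (drop (Suc k) v) \<delta>" for k
    proof -
      have "length (drop (Suc k) v) < length w" using Cons by simp
      from less.hyps[OF this] show ?thesis .
    qed
    then obtain b where b: "\<And>k. ?P d (drop (Suc k) v) (b k)" by (rule that[OF someI_ex])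
    define C where "C n = 2 * (4 * K 4 + 2) * walk_bound K (2 * n)" for n
    \<comment> \<open>\<open>excursion_le\<close> asks for a nonnegative bound; the absolute value
      supplies it and still tends to 0.\<close>
    define \<rho> where "\<rho> k N = 3 * (C (length (take k v)) / real N + \<bar>a k N\<bar> + (real (Suc d) / real N * free_moment (take k v))\<^sup>2)" for k N
    define \<epsilon> where "\<epsilon> N = sqrt (K 2 / real N) * sqrt (walk_moment_bound K (length v) 2) +
      (\<Sum>k<length v. sqrt (\<rho> k N) * sqrt (walk_moment_bound K (length v - Suc k) 2) + \<bar>free_moment (take k v)\<bar> * sqrt (b k N))" for N
    define \<delta> where "\<delta> N = sqrt (\<epsilon> N) * sqrt (2 ^ 3 * (walk_moment_bound K (length w) 3 + \<bar>free_moment w\<bar> ^ 3))" for N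
    have lim: "(\<lambda>N. y / real N) \<longlonglongrightarrow> 0" for y
      by (rule lim_const_over_n)
    have "\<rho> k \<longlonglongrightarrow> 3 * (0 + \<bar>0\<bar> + (0 * free_moment (take k v))\<^sup>2)" for k
      unfolding \<rho>_def using a by (intro tendsto_intros lim) auto
    then have \<rho>0: "\<rho> k \<longlonglongrightarrow> 0" for k by simp
    have "\<epsilon> \<longlonglongrightarrow> sqrt 0 * sqrt (walk_moment_bound K (length v) 2) +
      (\<Sum>k<length v. sqrt 0 * sqrt (walk_moment_bound K (length v - Suc k) 2) + \<bar>free_moment (take k v)\<bar> * sqrt 0)"
      unfolding \<epsilon>_def using b by (intro tendsto_intros lim \<rho>0) auto
    then have "\<epsilon> \<longlonglongrightarrow> 0" by simp
    then have "\<delta> \<longlonglongrightarrow> sqrt 0 * sqrt (2 ^ 3 * (walk_moment_bound K (length w) 3 + \<bar>free_moment w\<bar> ^ 3))"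
      unfolding \<delta>_def by (intro tendsto_intros)
    then have \<delta>0: "\<delta> \<longlonglongrightarrow> 0" by simp
    have "(\<integral>x. (cmod (wps N S w i i x - complex_of_real (free_moment w)))\<^sup>2 \<partial>M N) \<le> \<delta> N"
      if N: "N \<ge> N0" and S: "S \<subseteq> {..<N}" "N \<le> card S + d" "i \<in> S" for N S i
    proof -
      interpret wigner_family "M N" N "Z N" K by (rule family[OF N])
      have S': "S - {i} \<subseteq> {..<N}" "i \<notin> S - {i}" "i < N" "N \<le> card (S - {i}) + Suc d"
        using S finite_subset_N[OF S(1)] by auto
      show ?thesis
        unfolding \<delta>_def
      proof (rule second_moment_from_first[OF S(1,3)])
        show "expectation (\<lambda>x. cmod (wp S w i i x - complex_of_real (free_moment w))) \<le> \<epsilon> N"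
          unfolding \<epsilon>_def Cons
        proof (rule diagonal_step[OF S(1,3)])
          fix k assume "k < length v"
          show "expectation (\<lambda>x. (cmod (wp S (drop (Suc k) v) i i x - complex_of_real (free_moment (drop (Suc k) v))))\<^sup>2) \<le> b k N"
            using b[of k] N S by blast
          have "expectation (\<lambda>x. (cmod (wp (S - {i}) (take k v) p p x - complex_of_real (free_moment (take k v))))\<^sup>2) \<le> \<bar>a k N\<bar>"
            if "p \<in> S - {i}" for p
          proof -
            have "expectation (\<lambda>x. (cmod (wp (S - {i}) (take k v) p p x - complex_of_real (free_moment (take k v))))\<^sup>2) \<le> a k N"
              using a[of k] N S'(1,4) that by blast
            then show ?thesis by simp
          qed
          from excursion_le[OF S'(1,3,2,4) this]
          show "expectation (\<lambda>x. (cmod (excursion (S - {i}) c (take k v) (v ! k) i x -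
              complex_of_real (if v ! k = c then free_moment (take k v) else 0)))\<^sup>2) \<le> \<rho> k N"
            unfolding \<rho>_def C_def excursion_bound_def by simp
        qed
      qed
    qed
    with \<delta>0 show ?thesis by blast
  qed
qed

lemma wps_moment_bounded:
  assumes "i < N0" "j < N0"
  shows "moment_bounded (\<lambda>N. wps N {..<N} w i j)"
  unfolding moment_bounded_def
proof (intro conjI allI impI)
  fix N assume N: "N \<ge> N0"
  interpret wigner_family "M N" N "Z N" K by (rule family[OF N])
  show "wps N {..<N} w i j \<in> all_moments (M N)"
    using assms N by (intro wp_all_moments) auto
next
  fix p
  show "\<exists>B. \<forall>N\<ge>N0. (\<integral>x. cmod (wps N {..<N} w i j x) ^ p \<partial>M N) \<le> B"
  proof (intro exI allI impI)
    fix N assume N: "N \<ge> N0"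
    interpret wigner_family "M N" N "Z N" K by (rule family[OF N])
    show "(\<integral>x. cmod (wps N {..<N} w i j x) ^ p \<partial>M N) \<le> walk_moment_bound K (length w) p"
      using assms N by (intro wp_moment_le) auto
  qed
qed

theorem wps_tends:
  assumes "i < N0" "j < N0"
  shows "tends (\<lambda>N. wps N {..<N} w i j) (if i = j then complex_of_real (free_moment w) else 0)"
  unfolding tends_def
proof (rule conjI[OF wps_moment_bounded[OF assms]])
  let ?z = "if i = j then complex_of_real (free_moment w) else 0"
  obtain \<delta> where \<delta>: "\<delta> \<longlonglongrightarrow> 0"
      "\<forall>N\<ge>N0. \<forall>S i. S \<subseteq> {..<N} \<longrightarrow> N \<le> card S + 0 \<longrightarrow> i \<in> S \<longrightarrow>
        (\<integral>x. (cmod (wps N S w i i x - complex_of_real (free_moment w)))\<^sup>2 \<partial>M N) \<le> \<delta> N"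
    using diagonal_tendsto[of 0 w] by (elim exE conjE) (rule that)
  define \<eta> where "\<eta> N = (\<Sum>k<length w. sqrt (2 * (K 2 * walk_bound K (2 * k)) / real N) * sqrt (walk_moment_bound K (length w - Suc k) 2))" for N
  have "\<eta> \<longlonglongrightarrow> (\<Sum>k<length w. sqrt 0 * sqrt (walk_moment_bound K (length w - Suc k) 2))"
    unfolding \<eta>_def by (intro tendsto_intros lim_const_over_n)
  moreover have "(\<lambda>N. sqrt (\<delta> N)) \<longlonglongrightarrow> sqrt 0"
    by (intro tendsto_intros \<delta>)
  ultimately have lim: "(\<lambda>N. if i = j then sqrt (\<delta> N) else \<eta> N) \<longlonglongrightarrow> 0"
    by (cases "i = j") simp_all
  show "(\<lambda>N. \<integral>x. cmod (wps N {..<N} w i j x - ?z) \<partial>M N) \<longlonglongrightarrow> 0"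
  proof (rule tendsto_sandwich[where f = "\<lambda>_. 0", OF _ _ tendsto_const lim])
    show "\<forall>\<^sub>F N in sequentially. (\<integral>x. cmod (wps N {..<N} w i j x - ?z) \<partial>M N) \<le> (if i = j then sqrt (\<delta> N) else \<eta> N)"
      unfolding eventually_sequentially
    proof (intro exI allI impI)
      fix N assume N: "N \<ge> N0"
      interpret wigner_family "M N" N "Z N" K by (rule family[OF N])
      have am: "(\<lambda>x. wp {..<N} w i i x - complex_of_real (free_moment w)) \<in> all_moments (M N)"
        using assms N by (intro all_moments_diff wp_all_moments all_moments_const finite_measure_M) auto
      show "(\<integral>x. cmod (wps N {..<N} w i j x - ?z) \<partial>M N) \<le> (if i = j then sqrt (\<delta> N) else \<eta> N)"
      proof (cases "i = j")
        case True
        then show ?thesis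
          using order_trans[OF expectation_norm_le_sqrt[OF am] real_sqrt_le_mono[OF \<delta>(2)[rule_format, OF N, of "{..<N}" i]]] assms N
          by simp
      next
        case False
        then show ?thesis
          using off_diagonal_le[of "{..<N}" j i w] assms N by (simp add: \<eta>_def)
      qed
    qed
  qed (auto simp: always_eventually)
qed

end


section \<open>An invariant space of rows\<close>

text \<open>
  The letters \<open>True\<close> and \<open>False\<close> stand for \<open>A\<close> and \<open>B\<close>, and \<open>G\<close> for \<open>A\<^sup>m\<close>. Row \<open>j\<close> of \<open>T\<close>, for \<open>j < N0\<close>,
  is row \<open>j\<close> of \<open>G\<close> with the first \<open>N0\<close> entries erased. With \<open>u = []\<close>, \<open>crow b u j\<close> is this row
  or the unit vector at \<open>j\<close>, according to \<open>b\<close>; in general the word \<open>u\<close> is applied to it.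
\<close>

locale corner =
  fixes z :: "bool \<Rightarrow> nat \<Rightarrow> nat \<Rightarrow> complex" and N N0 m :: nat
  assumes N0_le: "N0 \<le> N"
begin

abbreviation W :: "bool list \<Rightarrow> nat \<Rightarrow> nat \<Rightarrow> complex" where
  "W u i j \<equiv> wprod z {..<N} u i j"

abbreviation G :: "nat \<Rightarrow> nat \<Rightarrow> complex" where
  "G i j \<equiv> W (replicate m True) i j"

text \<open>Erasing entries leaves a sum over t \<ge> N0, whose length grows with \<open>N\<close>.
  As a full product minus \<open>N0\<close> terms, an entry with s < N0 involves only finitely many
  upper left entries of words.\<close>

definition crow :: "bool \<Rightarrow> bool list \<Rightarrow> nat \<Rightarrow> nat \<Rightarrow> complex" where
  "crow b u j s = (if b then W (replicate m True @ u) j s - (\<Sum>t<N0. G j t * W u t s) else W u j s)"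

text \<open>The pairing of a row with column \<open>l\<close> of the lower left block of
  \<open>G\<close> (see \<open>cpair_eq\<close>), again in terms of corner entries. For Hermitian
  \<open>z\<close>, \<open>b = True\<close>, \<open>u = []\<close> and \<open>l = j\<close> it is
  the squared norm of row \<open>j\<close> of \<open>T\<close>.\<close>

definition cpair :: "bool \<Rightarrow> bool list \<Rightarrow> nat \<Rightarrow> nat \<Rightarrow> complex" where
  "cpair b u j l = crow b (u @ replicate m True) j l - (\<Sum>t<N0. crow b u j t * G t l)"

definition T :: "nat \<Rightarrow> nat \<Rightarrow> complex" where
  "T r s = (if (r < N0) \<noteq> (s < N0) then G r s else 0)"

definition P :: "complex \<Rightarrow> nat \<Rightarrow> nat \<Rightarrow> complex" where
  "P \<alpha> r s = \<alpha> * (\<Sum>l<N. T r l * z False l s) + cnj \<alpha> * (\<Sum>l<N. z False r l * T l s)"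

lemma W_single: "s < N \<Longrightarrow> W [c] l s = z c l s"
proof -
  assume s: "s < N"
  have "W [c] l s = (\<Sum>k<N. if k = s then z c l k else 0)"
    unfolding wprod.simps by (intro sum.cong) auto
  also have "\<dots> = z c l s" using s by simp
  finally show ?thesis .
qed

lemma crow_append:
  assumes "j < N0"
  shows "(\<Sum>t<N. crow b u j t * W v t s) = crow b (u @ v) j s"
proof (cases b)
  case True
  have "(\<Sum>t<N. crow b u j t * W v t s) =
      (\<Sum>t<N. W (replicate m True @ u) j t * W v t s) - (\<Sum>t<N. \<Sum>r<N0. G j r * (W u r t * W v t s))"
    using True by (simp add: crow_def left_diff_distrib sum_subtractf sum_distrib_right mult.assoc)
  also have "(\<Sum>t<N. \<Sum>r<N0. G j r * (W u r t * W v t s)) = (\<Sum>r<N0. G j r * (\<Sum>t<N. W u r t * W v t s))"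
    by (subst sum.swap) (simp add: sum_distrib_left)
  also have "\<dots> = (\<Sum>r<N0. G j r * W (u @ v) r s)"
    using N0_le by (intro sum.cong refl arg_cong2[where f = "(*)"] wprod_append[symmetric]) auto
  also have "(\<Sum>t<N. W (replicate m True @ u) j t * W v t s) = W ((replicate m True @ u) @ v) j s"
    using assms N0_le by (intro wprod_append[symmetric]) auto
  finally show ?thesis using True by (simp add: crow_def)
next
  case False
  then show ?thesis using assms N0_le by (simp add: crow_def wprod_append)
qed

lemma sum_lower_block:
  "(\<Sum>t<N. r t * (if t < N0 then 0 else g t)) = (\<Sum>t<N. r t * g t) - (\<Sum>t<N0. r t * (g t :: complex))"
proof -
  have "(\<Sum>t<N0. r t * g t) = (\<Sum>t<N. if t < N0 then r t * g t else 0)"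
    using N0_le by (intro sum.mono_neutral_cong_left) auto
  then show ?thesis
    by (simp add: sum_subtractf[symmetric]) (auto intro!: sum.cong)
qed

lemma cpair_eq:
  assumes "j < N0"
  shows "(\<Sum>t<N. crow b u j t * (if t < N0 then 0 else G t l)) = cpair b u j l"
  by (simp add: sum_lower_block crow_append[OF assms] cpair_def)

lemma crow_True_Nil: "crow True [] j s = (if s < N0 then 0 else G j s)"
proof -
  have "(\<Sum>t<N0. G j t * W [] t s) = (\<Sum>t<N0. if t = s then G j t else 0)"
    by (intro sum.cong) auto
  then show ?thesis by (simp add: crow_def)
qed

lemma crow_False_Nil: "crow False [] j s = (if j = s then 1 else 0)"
  by (simp add: crow_def)

text \<open>This is the rank bound for \<open>T\<close>: whatever the row \<open>r\<close>, its
  image combines the rows v_l, weighted by the entries of \<open>r\<close>, and the e_l, weighted by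
  pairings of \<open>r\<close> with columns.\<close>

lemma row_times_T:
  "(\<Sum>t<N. r t * T t s) =
    (\<Sum>l<N0. r l * crow True [] l s + (\<Sum>t<N. r t * (if t < N0 then 0 else G t l)) * crow False [] l s)"
proof (cases "s < N0")
  case True
  let ?p = "\<lambda>l. \<Sum>t<N. r t * (if t < N0 then 0 else G t l)"
  have "(\<Sum>t<N. r t * T t s) = ?p s"
    using True by (intro sum.cong) (auto simp: T_def)
  also have "\<dots> = (\<Sum>l<N0. if l = s then ?p l else 0)"
    using True by simp
  also have "\<dots> = (\<Sum>l<N0. r l * crow True [] l s + ?p l * crow False [] l s)"
    using True by (intro sum.cong) (auto simp: crow_True_Nil crow_False_Nil)
  finally show ?thesis .
next
  case False
  have "(\<Sum>t<N. r t * T t s) = (\<Sum>t<N0. r t * G t s)"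
    using False N0_le by (intro sum.mono_neutral_cong_right) (auto simp: T_def)
  also have "\<dots> = (\<Sum>l<N0. r l * crow True [] l s + (\<Sum>t<N. r t * (if t < N0 then 0 else G t l)) * crow False [] l s)"
    using False by (intro sum.cong) (auto simp: crow_True_Nil crow_False_Nil)
  finally show ?thesis .
qed

text \<open>\<open>x\<close> holds the coefficients of e_j and v_j, \<open>y\<close> those of the
  same rows with B applied. Varying \<open>f\<close> and \<open>v\<close>, the same coefficients
  give the row itself (\<open>crow\<close>, \<open>[]\<close>), its product with B
  (\<open>crow\<close>, \<open>[False]\<close>) and its pairings with columns
  (\<open>cpair\<close>).\<close>

definition comb :: "(bool \<Rightarrow> nat \<Rightarrow> complex) \<Rightarrow> (bool \<Rightarrow> nat \<Rightarrow> complex) \<Rightarrow> (bool \<Rightarrow> bool list \<Rightarrow> nat \<Rightarrow> nat \<Rightarrow> complex) \<Rightarrow>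
    bool list \<Rightarrow> nat \<Rightarrow> complex" where
  "comb x y f v s = (\<Sum>b\<in>UNIV. \<Sum>j<N0. x b j * f b v j s + y b j * f b (False # v) j s)"

lemma comb_apply:
  assumes "\<And>b u j. j < N0 \<Longrightarrow> (\<Sum>t<N. f b u j t * h t) = g b (u @ w) j s"
  shows "(\<Sum>t<N. comb x y f v t * h t) = comb x y g (v @ w) s"
proof -
  have "(\<Sum>t<N. comb x y f v t * h t) =
      (\<Sum>t<N. \<Sum>b\<in>UNIV. \<Sum>j<N0. x b j * (f b v j t * h t) + y b j * (f b (False # v) j t * h t))"
    by (simp add: comb_def sum_distrib_right distrib_right mult.assoc)
  also have "\<dots> = (\<Sum>b\<in>UNIV. \<Sum>j<N0. \<Sum>t<N. x b j * (f b v j t * h t) + y b j * (f b (False # v) j t * h t))"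
    by (subst sum.swap, subst (2) sum.swap) simp
  also have "\<dots> = (\<Sum>b\<in>UNIV. \<Sum>j<N0. x b j * (\<Sum>t<N. f b v j t * h t) + y b j * (\<Sum>t<N. f b (False # v) j t * h t))"
    by (simp add: sum.distrib sum_distrib_left)
  also have "\<dots> = comb x y g (v @ w) s"
    unfolding comb_def by (intro sum.cong refl) (simp add: assms)
  finally show ?thesis .
qed

text \<open>For a row r, r P = \<alpha> (r T) B + cnj \<alpha> (r B) T. By
  \<open>row_times_T\<close> the first term only has rows with B applied, giving the new
  \<open>y\<close>, and the second only rows without, giving the new \<open>x\<close>.\<close>

lemma comb_times_P:
  assumes s: "s < N"
  shows "(\<Sum>t<N. comb x y crow [] t * P \<alpha> t s) =
    comb (\<lambda>b l. cnj \<alpha> * (if b then comb x y crow [False] l else comb x y cpair [False] l))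
      (\<lambda>b l. \<alpha> * (if b then comb x y crow [] l else comb x y cpair [] l)) crow [] s"
proof -
  let ?r = "comb x y crow []" and ?rB = "comb x y crow [False]"
  have pr: "(\<Sum>t<N. comb x y crow v t * (if t < N0 then 0 else G t l)) = comb x y cpair v l" for v l
    using comb_apply[where w = "[]" and f = crow and g = cpair and h = "\<lambda>t. if t < N0 then 0 else G t l" and s = l] cpair_eq
    by simp
  have rB: "(\<Sum>t<N. ?r t * z False t l) = ?rB l" if "l < N" for l
    using comb_apply[where f = crow and g = crow and w = "[False]" and v = "[]" and h = "\<lambda>t. W [False] t l", OF crow_append] that
    by (simp add: W_single del: wprod.simps)
  have "(\<Sum>t<N. ?r t * (\<Sum>l<N. T t l * z False l s)) = (\<Sum>l<N. (\<Sum>t<N. ?r t * T t l) * z False l s)"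
    by (simp add: sum_distrib_left sum_distrib_right mult.assoc) (rule sum.swap)
  also have "\<dots> = (\<Sum>l<N. \<Sum>k<N0. ?r k * (crow True [] k l * W [False] l s) + comb x y cpair [] k * (crow False [] k l * W [False] l s))"
    using s by (simp add: row_times_T pr W_single sum_distrib_right distrib_right mult.assoc del: wprod.simps)
  also have "\<dots> = (\<Sum>k<N0. ?r k * (\<Sum>l<N. crow True [] k l * W [False] l s) + comb x y cpair [] k * (\<Sum>l<N. crow False [] k l * W [False] l s))"
    by (subst sum.swap) (simp add: sum.distrib sum_distrib_left)
  also have "\<dots> = (\<Sum>k<N0. ?r k * crow True [False] k s + comb x y cpair [] k * crow False [False] k s)"
    by (intro sum.cong refl) (simp only: lessThan_iff crow_append append_Nil)
  finally have TB: "(\<Sum>t<N. ?r t * (\<Sum>l<N. T t l * z False l s)) = \<dots>" .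
  have "(\<Sum>t<N. ?r t * (\<Sum>l<N. z False t l * T l s)) = (\<Sum>l<N. (\<Sum>t<N. ?r t * z False t l) * T l s)"
    by (simp add: sum_distrib_left sum_distrib_right mult.assoc) (rule sum.swap)
  also have "\<dots> = (\<Sum>l<N. ?rB l * T l s)"
    by (intro sum.cong refl) (simp add: rB)
  also have "\<dots> = (\<Sum>k<N0. ?rB k * crow True [] k s + comb x y cpair [False] k * crow False [] k s)"
    by (simp add: row_times_T pr)
  finally have BT: "(\<Sum>t<N. ?r t * (\<Sum>l<N. z False t l * T l s)) = \<dots>" .
  have "(\<Sum>t<N. ?r t * P \<alpha> t s) =
      \<alpha> * (\<Sum>t<N. ?r t * (\<Sum>l<N. T t l * z False l s)) + cnj \<alpha> * (\<Sum>t<N. ?r t * (\<Sum>l<N. z False t l * T l s))"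
  proof -
    have "?r t * P \<alpha> t s =
        \<alpha> * (?r t * (\<Sum>l<N. T t l * z False l s)) + cnj \<alpha> * (?r t * (\<Sum>l<N. z False t l * T l s))" for t
      unfolding P_def distrib_left by (simp only: mult.left_commute)
    then show ?thesis
      by (simp only: sum.distrib sum_distrib_left[symmetric])
  qed
  also have "\<dots> = comb (\<lambda>b l. cnj \<alpha> * (if b then ?rB l else comb x y cpair [False] l))
      (\<lambda>b l. \<alpha> * (if b then ?r l else comb x y cpair [] l)) crow [] s"
    unfolding TB BT comb_def[of _ _ crow "[]" s]
    by (simp add: UNIV_bool sum.distrib sum_distrib_left algebra_simps)
  finally show ?thesis .
qed

end


section \<open>Moments of the polynomial\<close>

text \<open>Both cases of \<open>D_const\<close> are the variance of the m-th power of a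
  semicircular element.\<close>

lemma D_const_eq: "D_const m = semicircle_moment (m + m) - (semicircle_moment m)\<^sup>2"
  by (simp add: D_const_def semicircle_moment_def flip: mult_2)

fun prow :: "(nat \<Rightarrow> nat \<Rightarrow> complex) \<Rightarrow> nat \<Rightarrow> nat \<Rightarrow> nat \<Rightarrow> nat \<Rightarrow> complex" where
  "prow p N i 0 s = (if i = s then 1 else 0)"
| "prow p N i (Suc k) s = (\<Sum>t<N. prow p N i k t * p t s)"

locale wigner_pair = wigner_families M N0 Z K
  for M :: "nat \<Rightarrow> 'a measure" and N0 :: nat and Z :: "nat \<Rightarrow> bool \<Rightarrow> nat \<Rightarrow> nat \<Rightarrow> 'a \<Rightarrow> complex" and K :: "nat \<Rightarrow> real" +
  fixes m :: nat
  assumes N0_pos: "N0 \<ge> 1"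
begin

abbreviation A_word :: "bool list" where
  "A_word \<equiv> replicate m True"

abbreviation crow :: "nat \<Rightarrow> 'a \<Rightarrow> bool \<Rightarrow> bool list \<Rightarrow> nat \<Rightarrow> nat \<Rightarrow> complex" where
  "crow N \<omega> \<equiv> corner.crow (scaled_entry N (Z N) \<omega>) N N0 m"

abbreviation cpair :: "nat \<Rightarrow> 'a \<Rightarrow> bool \<Rightarrow> bool list \<Rightarrow> nat \<Rightarrow> nat \<Rightarrow> complex" where
  "cpair N \<omega> \<equiv> corner.cpair (scaled_entry N (Z N) \<omega>) N N0 m"

abbreviation comb :: "(bool \<Rightarrow> nat \<Rightarrow> complex) \<Rightarrow> (bool \<Rightarrow> nat \<Rightarrow> complex) \<Rightarrow>
    (bool \<Rightarrow> bool list \<Rightarrow> nat \<Rightarrow> nat \<Rightarrow> complex) \<Rightarrow> bool list \<Rightarrow> nat \<Rightarrow> complex" where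
  "comb \<equiv> corner.comb N0"

text \<open>The limit at j = l; off the diagonal the limit is 0, so only t = j remains of the
  subtracted sum.\<close>

definition crow_limit :: "bool \<Rightarrow> bool list \<Rightarrow> real" where
  "crow_limit b u = (if b then free_moment (A_word @ u) - semicircle_moment m * free_moment u else free_moment u)"

definition cpair_limit :: "bool \<Rightarrow> bool list \<Rightarrow> real" where
  "cpair_limit b u = crow_limit b (u @ A_word) - crow_limit b u * semicircle_moment m"

text \<open>A single \<open>False\<close> makes a moment vanish and an adjacent pair of them can be
  deleted; what is left are moments of powers of one letter. The four nonzero values are the only
  transitions of the limiting P.\<close>

lemma limit_simps:
  "crow_limit False [] = 1" "crow_limit False [False] = 0" "crow_limit False [False, False] = 1"
  "crow_limit True [] = 0" "crow_limit True [False] = 0" "crow_limit True [False, False] = 0"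
  "cpair_limit False [] = 0" "cpair_limit False [False] = 0" "cpair_limit False [False, False] = 0"
  "cpair_limit True [] = D_const m" "cpair_limit True [False] = 0" "cpair_limit True [False, False] = D_const m"
proof -
  have odd: "free_moment (replicate k True @ False # replicate l True) = 0" for k l
    by (rule free_moment_odd[of _ False]) (simp add: count_list_0_iff)
  have pair: "free_moment (replicate k True @ False # False # replicate l True) = semicircle_moment (k + l)" for k l
    by (rule free_moment_insert_pair) simp
  have AA: "free_moment (A_word @ A_word) = semicircle_moment (m + m)"
    by (simp only: replicate_add[symmetric] free_moment_replicate)
  have s: "free_moment [False] = 0" "free_moment (A_word @ [False]) = 0" "free_moment (False # A_word) = 0"
      "free_moment [False, False] = semicircle_moment 0" "free_moment (A_word @ [False, False]) = semicircle_moment m"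
      "free_moment (False # False # A_word) = semicircle_moment m"
    using odd[of 0 0] odd[of m 0] odd[of 0 m] pair[of 0 0] pair[of m 0] pair[of 0 m]
    by (simp_all del: free_moment.simps)
  have c0: "semicircle_moment 0 = 1" by (simp add: semicircle_moment_def catalan_0)
  show "crow_limit False [] = 1" "crow_limit False [False] = 0" "crow_limit False [False, False] = 1"
    "crow_limit True [] = 0" "crow_limit True [False] = 0" "crow_limit True [False, False] = 0"
    "cpair_limit False [] = 0" "cpair_limit False [False] = 0" "cpair_limit False [False, False] = 0"
    "cpair_limit True [] = D_const m" "cpair_limit True [False] = 0" "cpair_limit True [False, False] = D_const m"
    using c0 unfolding cpair_limit_def crow_limit_def D_const_eq
    by (simp_all add: s AA odd pair free_moment_replicate power2_eq_square del: free_moment.simps(2))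
qed

lemma tends_crow:
  assumes "j < N0" "l < N0"
  shows "tends (\<lambda>N \<omega>. crow N \<omega> b u j l) (if j = l then complex_of_real (crow_limit b u) else 0)"
proof (rule tends_cong)
  let ?z = "\<lambda>w i j. if i = j then complex_of_real (free_moment w) else 0"
  let ?Z = "\<lambda>N \<omega>. if b then wps N {..<N} (A_word @ u) j l \<omega> - (\<Sum>t<N0. wps N {..<N} A_word j t \<omega> * wps N {..<N} u t l \<omega>)
    else wps N {..<N} u j l \<omega>"
  let ?L = "if b then ?z (A_word @ u) j l - (\<Sum>t<N0. ?z A_word j t * ?z u t l) else ?z u j l"
  show "crow N \<omega> b u j l = ?Z N \<omega>" if "N \<ge> N0" for N \<omega>
  proof -
    interpret C: corner "scaled_entry N (Z N) \<omega>" N N0 m by unfold_locales (rule that)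
    show ?thesis by (simp add: C.crow_def)
  qed
  have "tends ?Z ?L"
  proof (cases b)
    case True
    have "tends (\<lambda>N \<omega>. wps N {..<N} (A_word @ u) j l \<omega> - (\<Sum>t<N0. wps N {..<N} A_word j t \<omega> * wps N {..<N} u t l \<omega>))
        (?z (A_word @ u) j l - (\<Sum>t<N0. ?z A_word j t * ?z u t l))"
      using assms by (intro tends_diff tends_sum tends_mult wps_tends) auto
    then show ?thesis using True by simp
  next
    case False
    then show ?thesis using wps_tends[OF assms, of u] by simp
  qed
  moreover have "(\<Sum>t<N0. ?z A_word j t * ?z u t l) = ?z A_word j j * ?z u j l"
  proof -
    have "(\<Sum>t<N0. ?z A_word j t * ?z u t l) = (\<Sum>t<N0. if t = j then ?z A_word j j * ?z u j l else 0)"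
      by (intro sum.cong) auto
    then show ?thesis using assms by simp
  qed
  ultimately show "tends ?Z (if j = l then complex_of_real (crow_limit b u) else 0)"
    by (auto simp: crow_limit_def free_moment_replicate split: if_splits)
qed

lemma tends_cpair:
  assumes "j < N0" "l < N0"
  shows "tends (\<lambda>N \<omega>. cpair N \<omega> b u j l) (if j = l then complex_of_real (cpair_limit b u) else 0)"
proof (rule tends_cong)
  let ?z = "\<lambda>j l. if j = l then complex_of_real (crow_limit b (u @ A_word)) else 0"
  let ?y = "\<lambda>j l. if j = l then complex_of_real (crow_limit b u) else 0"
  let ?a = "\<lambda>j l. if j = l then complex_of_real (free_moment A_word) else 0"
  let ?Z = "\<lambda>N \<omega>. crow N \<omega> b (u @ A_word) j l - (\<Sum>t<N0. crow N \<omega> b u j t * wps N {..<N} A_word t l \<omega>)"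
  show "cpair N \<omega> b u j l = ?Z N \<omega>" if "N \<ge> N0" for N \<omega>
  proof -
    interpret C: corner "scaled_entry N (Z N) \<omega>" N N0 m by unfold_locales (rule that)
    show ?thesis by (simp add: C.cpair_def)
  qed
  have "tends ?Z (?z j l - (\<Sum>t<N0. ?y j t * ?a t l))"
    using assms by (intro tends_diff tends_sum tends_mult tends_crow wps_tends) auto
  moreover have "(\<Sum>t<N0. ?y j t * ?a t l) = (\<Sum>t<N0. if t = j then ?y j j * ?a j l else 0)"
    by (intro sum.cong) auto
  ultimately show "tends ?Z (if j = l then complex_of_real (cpair_limit b u) else 0)"
    using assms by (auto simp: cpair_limit_def free_moment_replicate split: if_splits)
qed

lemma tends_comb:
  assumes "l < N0" "i < N0"
    and x: "\<And>b j. j < N0 \<Longrightarrow> tends (x b j) (if j = i then \<xi> b else 0)"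
    and y: "\<And>b j. j < N0 \<Longrightarrow> tends (y b j) (if j = i then \<eta> b else 0)"
    and f: "\<And>b u j. j < N0 \<Longrightarrow> tends (\<lambda>N \<omega>. f N \<omega> b u j l) (if j = l then complex_of_real (L b u) else 0)"
  shows "tends (\<lambda>N \<omega>. comb (\<lambda>b j. x b j N \<omega>) (\<lambda>b j. y b j N \<omega>) (f N \<omega>) v l)
    (if l = i then \<Sum>b\<in>UNIV. \<xi> b * complex_of_real (L b v) + \<eta> b * complex_of_real (L b (False # v)) else 0)"
proof (rule tends_cong)
  let ?d = "\<lambda>j k c. if j = k then c else (0::complex)"
  show "comb (\<lambda>b j. x b j N \<omega>) (\<lambda>b j. y b j N \<omega>) (f N \<omega>) v l =
      (\<Sum>b\<in>UNIV. \<Sum>j<N0. x b j N \<omega> * f N \<omega> b v j l + y b j N \<omega> * f N \<omega> b (False # v) j l)" if "N \<ge> N0" for N \<omega>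
  proof -
    interpret C: corner "scaled_entry N (Z N) \<omega>" N N0 m by unfold_locales (rule that)
    show ?thesis by (simp add: C.comb_def)
  qed
  have "tends (\<lambda>N \<omega>. \<Sum>b\<in>UNIV. \<Sum>j<N0. x b j N \<omega> * f N \<omega> b v j l + y b j N \<omega> * f N \<omega> b (False # v) j l)
      (\<Sum>b\<in>UNIV. \<Sum>j<N0. ?d j i (\<xi> b) * ?d j l (complex_of_real (L b v)) + ?d j i (\<eta> b) * ?d j l (complex_of_real (L b (False # v))))"
    by (intro tends_sum tends_add tends_mult x y f) auto
  moreover have "(\<Sum>j<N0. ?d j i a * ?d j l a' + ?d j i c * ?d j l c') = (if l = i then a * a' + c * c' else 0)" for a a' c c'
  proof -
    have "(\<Sum>j<N0. ?d j i a * ?d j l a' + ?d j i c * ?d j l c') =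
        (\<Sum>j<N0. if j = i then ?d i l a' * a + c * ?d i l c' else 0)"
      by (intro sum.cong) auto
    then show ?thesis using assms(1,2) by (auto simp: mult.commute)
  qed
  ultimately show "tends (\<lambda>N \<omega>. \<Sum>b\<in>UNIV. \<Sum>j<N0. x b j N \<omega> * f N \<omega> b v j l + y b j N \<omega> * f N \<omega> b (False # v) j l)
      (if l = i then \<Sum>b\<in>UNIV. \<xi> b * complex_of_real (L b v) + \<eta> b * complex_of_real (L b (False # v)) else 0)"
    by (cases "l = i") simp_all
qed

text \<open>
  Limits of the coefficients of \<open>crow b [] i\<close> and of \<open>crow b [False] i\<close> in row \<open>i\<close> of \<open>P\<^sup>k\<close>; all other
  coefficients tend to 0.
\<close>

definition prow_limit_even :: "complex \<Rightarrow> nat \<Rightarrow> bool \<Rightarrow> complex" where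
  "prow_limit_even \<alpha> k b = (if even k \<and> \<not> b then (\<alpha> * cnj \<alpha> * complex_of_real (D_const m)) ^ (k div 2) else 0)"

definition prow_limit_odd :: "complex \<Rightarrow> nat \<Rightarrow> bool \<Rightarrow> complex" where
  "prow_limit_odd \<alpha> k b = (if odd k \<and> b then \<alpha> * (\<alpha> * cnj \<alpha> * complex_of_real (D_const m)) ^ (k div 2) else 0)"

text \<open>The coefficients are random. By \<open>comb_times_P\<close>, those for
  \<open>Suc k\<close> are sums of products of the old ones with corner entries, and the number of
  terms is independent of \<open>N\<close>; \<open>tends_comb\<close> therefore passes their limits
  on.\<close>

lemma prow_expansion:
  assumes i: "i < N0"
  shows "\<exists>x y. (\<forall>N\<ge>N0. \<forall>\<omega>. \<forall>s<N. prow (corner.P (scaled_entry N (Z N) \<omega>) N N0 m \<alpha>) N i k s =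
      comb (\<lambda>b j. x b j N \<omega>) (\<lambda>b j. y b j N \<omega>) (crow N \<omega>) [] s) \<and>
    (\<forall>b. \<forall>j<N0. tends (x b j) (if j = i then prow_limit_even \<alpha> k b else 0)) \<and>
    (\<forall>b. \<forall>j<N0. tends (y b j) (if j = i then prow_limit_odd \<alpha> k b else 0))"
proof (induction k)
  case 0
  let ?x = "\<lambda>b j N \<omega>. if j = i \<and> \<not> b then 1 else 0 :: complex"
  show ?case
  proof (intro exI conjI allI impI)
    fix N \<omega> s assume N: "N \<ge> N0" "s < N"
    interpret C: corner "scaled_entry N (Z N) \<omega>" N N0 m by unfold_locales (rule N)
    have "comb (\<lambda>b j. ?x b j N \<omega>) (\<lambda>b j. 0) (crow N \<omega>) [] s = (\<Sum>j<N0. if j = i then crow N \<omega> False [] j s else 0)"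
      unfolding C.comb_def by (simp add: UNIV_bool mult_delta_left)
    then show "prow (corner.P (scaled_entry N (Z N) \<omega>) N N0 m \<alpha>) N i 0 s =
        comb (\<lambda>b j. ?x b j N \<omega>) (\<lambda>b j. (\<lambda>b j N \<omega>. 0) b j N \<omega>) (crow N \<omega>) [] s"
      using i by (simp add: C.crow_False_Nil)
  next
    fix b j
    show "tends (?x b j) (if j = i then prow_limit_even \<alpha> 0 b else 0)"
      using tends_const[of "if j = i \<and> \<not> b then 1 else 0"] by (simp add: prow_limit_even_def cong: if_cong) (auto split: if_splits)
    show "tends ((\<lambda>b j N \<omega>. 0) b j) (if j = i then prow_limit_odd \<alpha> 0 b else 0)"
      using tends_const[of 0] by (simp add: prow_limit_odd_def)
  qed
next
  case (Suc k)
  then obtain x y where xy': "\<forall>N\<ge>N0. \<forall>\<omega>. \<forall>s<N. prow (corner.P (scaled_entry N (Z N) \<omega>) N N0 m \<alpha>) N i k s =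
      comb (\<lambda>b j. x b j N \<omega>) (\<lambda>b j. y b j N \<omega>) (crow N \<omega>) [] s"
    and x': "\<forall>b. \<forall>j<N0. tends (x b j) (if j = i then prow_limit_even \<alpha> k b else 0)"
    and y': "\<forall>b. \<forall>j<N0. tends (y b j) (if j = i then prow_limit_odd \<alpha> k b else 0)"
    by (elim exE conjE) (rule that)
  note xy = xy'[rule_format] and x = x'[rule_format] and y = y'[rule_format]
  let ?c = "\<lambda>f v l N \<omega>. comb (\<lambda>b j. x b j N \<omega>) (\<lambda>b j. y b j N \<omega>) (f N \<omega>) v l"
  let ?x = "\<lambda>b l N \<omega>. cnj \<alpha> * (if b then ?c crow [False] l N \<omega> else ?c cpair [False] l N \<omega>)"
  let ?y = "\<lambda>b l N \<omega>. \<alpha> * (if b then ?c crow [] l N \<omega> else ?c cpair [] l N \<omega>)"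
  show ?case
  proof (rule exI[of _ ?x], rule exI[of _ ?y], intro conjI allI impI)
    fix N \<omega> s assume N: "N \<ge> N0" "s < N"
    interpret C: corner "scaled_entry N (Z N) \<omega>" N N0 m by unfold_locales (rule N)
    have "prow (corner.P (scaled_entry N (Z N) \<omega>) N N0 m \<alpha>) N i (Suc k) s = (\<Sum>t<N. ?c crow [] t N \<omega> * C.P \<alpha> t s)"
      using xy[OF N(1)] by simp
    then show "prow (corner.P (scaled_entry N (Z N) \<omega>) N N0 m \<alpha>) N i (Suc k) s =
        comb (\<lambda>b j. ?x b j N \<omega>) (\<lambda>b j. ?y b j N \<omega>) (crow N \<omega>) [] s"
      unfolding C.comb_times_P[OF N(2)] .
  next
    fix b j assume j: "j < N0"
    note R = tends_comb[where f = crow and L = crow_limit and x = x and y = y and \<xi> = "prow_limit_even \<alpha> k" and \<eta> = "prow_limit_odd \<alpha> k", OF j i x y tends_crow[OF _ j]]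
      and Q = tends_comb[where f = cpair and L = cpair_limit and x = x and y = y and \<xi> = "prow_limit_even \<alpha> k" and \<eta> = "prow_limit_odd \<alpha> k", OF j i x y tends_cpair[OF _ j]]
    show "tends (?x b j) (if j = i then prow_limit_even \<alpha> (Suc k) b else 0)"
    proof (cases b)
      case True
      have z: "(\<Sum>b\<in>UNIV. prow_limit_even \<alpha> k b * complex_of_real (crow_limit b [False]) +
          prow_limit_odd \<alpha> k b * complex_of_real (crow_limit b [False, False])) = 0"
        by (simp add: UNIV_bool limit_simps prow_limit_odd_def)
      then show ?thesis
        using tends_cmult[OF R[where v = "[False]"], of "cnj \<alpha>"] True
        unfolding z by (cases "j = i") (simp_all add: prow_limit_even_def)
    next
      case False
      \<comment> \<open>From odd k back to e_i: the weight \<open>cnj \<alpha> * D_const m\<close>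
        completes the next power.\<close>
      have "cnj \<alpha> * (\<Sum>b\<in>UNIV. prow_limit_even \<alpha> k b * complex_of_real (cpair_limit b [False]) +
          prow_limit_odd \<alpha> k b * complex_of_real (cpair_limit b [False, False])) = prow_limit_even \<alpha> (Suc k) False"
        by (auto simp: UNIV_bool limit_simps prow_limit_odd_def prow_limit_even_def elim!: oddE)
      then show ?thesis
        using tends_cmult[OF Q[where v = "[False]"], of "cnj \<alpha>"] False by (simp split: if_splits)
    qed
    show "tends (?y b j) (if j = i then prow_limit_odd \<alpha> (Suc k) b else 0)"
    proof (cases b)
      case True
      \<comment> \<open>From even k, e_i moves to v_i B with weight \<alpha>.\<close>
      have "\<alpha> * (\<Sum>b\<in>UNIV. prow_limit_even \<alpha> k b * complex_of_real (crow_limit b []) +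
          prow_limit_odd \<alpha> k b * complex_of_real (crow_limit b [False])) = prow_limit_odd \<alpha> (Suc k) True"
        by (auto simp: UNIV_bool limit_simps prow_limit_odd_def prow_limit_even_def)
      then show ?thesis
        using tends_cmult[OF R[where v = "[]"], of "\<alpha>"] True by (simp split: if_splits)
    next
      case False
      have z: "(\<Sum>b\<in>UNIV. prow_limit_even \<alpha> k b * complex_of_real (cpair_limit b []) +
          prow_limit_odd \<alpha> k b * complex_of_real (cpair_limit b [False])) = 0"
        by (simp add: UNIV_bool limit_simps prow_limit_even_def)
      then show ?thesis
        using tends_cmult[OF Q[where v = "[]"], of "\<alpha>"] False
        unfolding z by (cases "j = i") (simp_all add: prow_limit_odd_def)
    qed
  qed
qed

lemma tends_prow_diag:
  assumes i: "i < N0"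
  shows "tends (\<lambda>N \<omega>. prow (corner.P (scaled_entry N (Z N) \<omega>) N N0 m \<alpha>) N i k i) (prow_limit_even \<alpha> k False)"
proof -
  from prow_expansion[OF i, of \<alpha> k] obtain x y where xy': "\<forall>N\<ge>N0. \<forall>\<omega>. \<forall>s<N. prow (corner.P (scaled_entry N (Z N) \<omega>) N N0 m \<alpha>) N i k s =
      comb (\<lambda>b j. x b j N \<omega>) (\<lambda>b j. y b j N \<omega>) (crow N \<omega>) [] s"
    and x': "\<forall>b. \<forall>j<N0. tends (x b j) (if j = i then prow_limit_even \<alpha> k b else 0)"
    and y': "\<forall>b. \<forall>j<N0. tends (y b j) (if j = i then prow_limit_odd \<alpha> k b else 0)"
    by (elim exE conjE) (rule that)
  note xy = xy'[rule_format] and x = x'[rule_format] and y = y'[rule_format]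
  \<comment> \<open>At position \<open>i\<close> only the unit vector has a nonzero limit, so the
    diagonal entry reads off its coefficient.\<close>
  have "(\<Sum>b\<in>UNIV. prow_limit_even \<alpha> k b * complex_of_real (crow_limit b []) +
      prow_limit_odd \<alpha> k b * complex_of_real (crow_limit b [False])) = prow_limit_even \<alpha> k False"
    by (simp add: UNIV_bool limit_simps)
  with tends_comb[where f = crow and L = crow_limit and x = x and y = y and \<xi> = "prow_limit_even \<alpha> k" and \<eta> = "prow_limit_odd \<alpha> k" and v = "[]", OF i i x y tends_crow[OF _ i]]
  have "tends (\<lambda>N \<omega>. comb (\<lambda>b j. x b j N \<omega>) (\<lambda>b j. y b j N \<omega>) (crow N \<omega>) [] i) (prow_limit_even \<alpha> k False)"
    by simp
  then show ?thesis
    by (rule tends_cong[rotated]) (use xy i in auto)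
qed

text \<open>\<open>D\<^sub>m\<close> is the limit of the squared norm of a row of \<open>T\<close>.\<close>

lemma D_const_nonneg: "0 \<le> D_const m"
proof -
  have 0: "0 < N0" using N0_pos by simp
  have "tends (\<lambda>N \<omega>. cpair N \<omega> True [] 0 0) (complex_of_real (D_const m))"
    using tends_cpair[OF 0 0, of True "[]"] by (simp add: limit_simps)
  then have lim: "(\<lambda>N. Re (\<integral>\<omega>. cpair N \<omega> True [] 0 0 \<partial>M N)) \<longlonglongrightarrow> Re (complex_of_real (D_const m))"
    by (intro tendsto_Re tends_expectation)
  have "0 \<le> Re (\<integral>\<omega>. cpair N \<omega> True [] 0 0 \<partial>M N)" if N: "N \<ge> N0" for N
  proof -
    interpret wigner_family "M N" N "Z N" K by (rule family[OF N])
    let ?f = "\<lambda>\<omega>. \<Sum>t<N. if t < N0 then 0 else (cmod (wp {..<N} A_word 0 t \<omega>))\<^sup>2"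
    have "cpair N \<omega> True [] 0 0 = complex_of_real (?f \<omega>)" if \<omega>: "\<omega> \<in> space (M N)" for \<omega>
    proof -
      interpret C: corner "entry \<omega>" N N0 m by unfold_locales (rule N)
      have "wp {..<N} A_word t 0 \<omega> = cnj (wp {..<N} A_word 0 t \<omega>)" if "t < N" for t
        using wprod_cnj[OF finite_lessThan hermitian_entry[OF \<omega> order_refl], of 0 t A_word] that N 0 by simp
      then show ?thesis
        unfolding C.cpair_eq[OF 0, symmetric] C.crow_True_Nil of_real_sum
        by (intro sum.cong refl) (auto simp: complex_norm_square[symmetric])
    qed
    then have "(\<integral>\<omega>. cpair N \<omega> True [] 0 0 \<partial>M N) = (\<integral>\<omega>. complex_of_real (?f \<omega>) \<partial>M N)"
      by (intro Bochner_Integration.integral_cong) auto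
    then have "(\<integral>\<omega>. cpair N \<omega> True [] 0 0 \<partial>M N) = complex_of_real (\<integral>\<omega>. ?f \<omega> \<partial>M N)"
      by (simp only: integral_complex_of_real)
    then show ?thesis
      by (simp add: integral_nonneg_AE sum_nonneg)
  qed
  then have "0 \<le> Re (complex_of_real (D_const m))"
    by (intro tendsto_lowerbound[OF lim]) (auto simp: eventually_sequentially)
  then show ?thesis by simp
qed

lemma integral_symmetric_bernoulli_omega:
  "complex_of_real (\<integral>t. t ^ k \<partial>symmetric_bernoulli (omega \<alpha> m)) = prow_limit_even \<alpha> k False"
proof -
  \<comment> \<open>Nonnegativity of D_m is essential here: \<open>sqrt\<close> of a negative number
    would not square back to it.\<close>
  have sq: "(omega \<alpha> m)\<^sup>2 = (cmod \<alpha>)\<^sup>2 * D_const m"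
    using D_const_nonneg by (simp add: omega_def)
  have "(\<integral>t. t ^ k \<partial>symmetric_bernoulli (omega \<alpha> m)) = (omega \<alpha> m ^ k + (- omega \<alpha> m) ^ k) / 2"
    by (rule integral_symmetric_bernoulli) simp
  also have "\<dots> = (if even k then ((cmod \<alpha>)\<^sup>2 * D_const m) ^ (k div 2) else 0)"
    by (auto simp: sq[symmetric] power_mult[symmetric])
  finally show ?thesis
    by (simp add: prow_limit_even_def complex_norm_square[symmetric])
qed

end


section \<open>Joint independence of two arrays\<close>

lemma (in prob_space) indep_vars_prob_all:
  assumes f: "indep_vars (\<lambda>_. borel) f I" and J: "J \<subseteq> I" "finite J" and B: "\<And>e. e \<in> J \<Longrightarrow> B e \<in> sets borel"
  shows "prob {x \<in> space M. \<forall>e\<in>J. f e x \<in> B e} = (\<Prod>e\<in>J. prob (f e -` B e \<inter> space M))"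
proof (cases "J = {}")
  case True
  then show ?thesis by (simp add: prob_space)
next
  case False
  have "{x \<in> space M. \<forall>e\<in>J. f e x \<in> B e} = (\<Inter>e\<in>J. f e -` B e \<inter> space M)"
    using False by auto
  then show ?thesis
    using indep_varsD[OF f False J(2,1), of B] B by simp
qed

text \<open>Independence of the two random elements is tested on cylinder sets, with
  \<open>UNIV\<close> at every coordinate that carries no condition.\<close>

lemma (in prob_space) indep_arrays_prob:
  assumes XY: "indep_arrays N X Y" and I: "I \<subseteq> {..<N} \<times> {..<N}" "J \<subseteq> {..<N} \<times> {..<N}"
    and B: "\<And>e. B e \<in> sets borel" "\<And>e. C e \<in> sets borel"
  shows "prob ({x \<in> space M. \<forall>(i, j)\<in>I. X i j x \<in> B (i, j)} \<inter> {x \<in> space M. \<forall>(i, j)\<in>J. Y i j x \<in> C (i, j)}) =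
    prob {x \<in> space M. \<forall>(i, j)\<in>I. X i j x \<in> B (i, j)} * prob {x \<in> space M. \<forall>(i, j)\<in>J. Y i j x \<in> C (i, j)}"
proof -
  let ?S = "{..<N} \<times> {..<N}"
  let ?F = "\<lambda>X x. \<lambda>(i, j)\<in>?S. X i j x"
  let ?B = "\<Pi>\<^sub>E e\<in>?S. if e \<in> I then B e else UNIV" and ?C = "\<Pi>\<^sub>E e\<in>?S. if e \<in> J then C e else UNIV"
  have "indep_var (\<Pi>\<^sub>M _\<in>?S. borel) (?F X) (\<Pi>\<^sub>M _\<in>?S. borel) (?F Y)"
    using XY by (simp add: indep_arrays_def Let_def)
  moreover have "?B \<in> sets (\<Pi>\<^sub>M _\<in>?S. borel)" "?C \<in> sets (\<Pi>\<^sub>M _\<in>?S. borel)"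
    using B by (auto intro!: sets_PiM_I_finite)
  ultimately have "prob ((\<lambda>x. (?F X x, ?F Y x)) -` (?B \<times> ?C) \<inter> space M) =
      prob (?F X -` ?B \<inter> space M) * prob (?F Y -` ?C \<inter> space M)"
    by (rule indep_varD)
  moreover have "?F X -` ?B \<inter> space M = {x \<in> space M. \<forall>(i, j)\<in>I. X i j x \<in> B (i, j)}"
    using I(1) by (auto simp: PiE_iff split: if_splits)
  moreover have "?F Y -` ?C \<inter> space M = {x \<in> space M. \<forall>(i, j)\<in>J. Y i j x \<in> C (i, j)}"
    using I(2) by (auto simp: PiE_iff split: if_splits)
  moreover have "(\<lambda>x. (?F X x, ?F Y x)) -` (?B \<times> ?C) \<inter> space M =
      (?F X -` ?B \<inter> space M) \<inter> (?F Y -` ?C \<inter> space M)"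
    by auto
  ultimately show ?thesis by simp
qed

text \<open>A finite subfamily is split by letter: independence of the arrays separates the letters,
  and independence within each array does the rest.\<close>

lemma (in prob_space) indep_arrays_indep_vars:
  assumes X: "indep_vars (\<lambda>_. borel) (\<lambda>(i, j). X i j) {(i, j). i \<le> j \<and> j < N}"
    and Y: "indep_vars (\<lambda>_. borel) (\<lambda>(i, j). Y i j) {(i, j). i \<le> j \<and> j < N}"
    and XY: "indep_arrays N X Y"
  shows "indep_vars (\<lambda>_. borel) (\<lambda>(c, i, j). (if c then X else Y) i j) {(c, i, j). i \<le> j \<and> j < N}"
  unfolding indep_vars_def2
proof (intro conjI ballI indep_setsI)
  let ?f = "\<lambda>(c, i, j). (if c then X else Y) i j"
  fix e :: "bool \<times> nat \<times> nat" assume e: "e \<in> {(c, i, j). i \<le> j \<and> j < N}"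
  show rv: "random_variable borel (?f e)"
    using e X Y unfolding indep_vars_def2 by (cases e) (auto simp: Ball_def)
  show "{?f e -` A \<inter> space M |A. A \<in> sets borel} \<subseteq> events"
    using measurable_sets[OF rv] by auto
next
  let ?f = "\<lambda>(c, i, j). (if c then X else Y) i j"
  fix A and J :: "(bool \<times> nat \<times> nat) set" assume J: "J \<noteq> {}" "J \<subseteq> {(c, i, j). i \<le> j \<and> j < N}" "finite J"
    and A: "\<forall>e\<in>J. A e \<in> {?f e -` A \<inter> space M |A. A \<in> sets borel}"
  \<comment> \<open>The sets are chosen for every index, also outside \<open>J\<close>, because
    \<open>indep_arrays_prob\<close> wants Borel sets everywhere.\<close>
  from A have "\<forall>e. \<exists>B. B \<in> sets borel \<and> (e \<in> J \<longrightarrow> A e = ?f e -` B \<inter> space M)" by blast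
  from choice[OF this] obtain B where B: "\<And>e. B e \<in> sets borel" "\<And>e. e \<in> J \<Longrightarrow> A e = ?f e -` B e \<inter> space M"
    by blast
  let ?J = "\<lambda>c. {ij. (c, ij) \<in> J}"
  let ?E = "\<lambda>c V. {x \<in> space M. \<forall>(i, j)\<in>?J c. V i j x \<in> B (c, i, j)}"
  have JU: "J = Pair True ` ?J True \<union> Pair False ` ?J False"
  proof (rule subset_antisym)
    show "J \<subseteq> Pair True ` ?J True \<union> Pair False ` ?J False"
    proof
      fix e assume "e \<in> J"
      then show "e \<in> Pair True ` ?J True \<union> Pair False ` ?J False" by (cases e; cases "fst e") auto
    qed
  qed auto
  have fin: "finite (?J c)" for c
    by (rule finite_vimageI[OF J(3), of "Pair c", unfolded vimage_def]) (simp add: inj_on_def)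
  have sub: "?J c \<subseteq> {(i, j). i \<le> j \<and> j < N}" for c using J(2) by auto
  have "(\<Inter>e\<in>J. A e) = ?E True X \<inter> ?E False Y"
  proof -
    have "x \<in> (\<Inter>e\<in>J. A e) \<longleftrightarrow> x \<in> ?E True X \<inter> ?E False Y" for x
    proof -
      have "x \<in> (\<Inter>e\<in>J. A e) \<longleftrightarrow> x \<in> space M \<and> (\<forall>e\<in>J. ?f e x \<in> B e)"
        using J(1) B(2) by auto
      also have "\<dots> \<longleftrightarrow> x \<in> ?E True X \<inter> ?E False Y"
        by (subst JU) auto
      finally show ?thesis .
    qed
    then show ?thesis by blast
  qed
  also have "prob \<dots> = prob (?E True X) * prob (?E False Y)"
    using indep_arrays_prob[OF XY, of "?J True" "?J False" "\<lambda>e. B (True, e)" "\<lambda>e. B (False, e)"] sub B(1)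
    by (force simp: subset_iff)
  also have "prob (?E True X) = (\<Prod>e\<in>?J True. prob ((\<lambda>(i, j). X i j) e -` B (True, e) \<inter> space M))"
    using indep_vars_prob_all[OF X sub fin, of True "\<lambda>e. B (True, e)"] B(1) by (simp add: case_prod_beta)
  also have "\<dots> = (\<Prod>e\<in>Pair True ` ?J True. prob (A e))"
    by (subst prod.reindex) (auto simp: inj_on_def B(2) intro!: prod.cong)
  also have "prob (?E False Y) = (\<Prod>e\<in>?J False. prob ((\<lambda>(i, j). Y i j) e -` B (False, e) \<inter> space M))"
    using indep_vars_prob_all[OF Y sub fin, of False "\<lambda>e. B (False, e)"] B(1) by (simp add: case_prod_beta)
  also have "\<dots> = (\<Prod>e\<in>Pair False ` ?J False. prob (A e))"
    by (subst prod.reindex) (auto simp: inj_on_def B(2) intro!: prod.cong)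
  also have "(\<Prod>e\<in>Pair True ` ?J True. prob (A e)) * (\<Prod>e\<in>Pair False ` ?J False. prob (A e)) = (\<Prod>e\<in>J. prob (A e))"
  proof -
    have "(\<Prod>e\<in>Pair True ` ?J True \<union> Pair False ` ?J False. prob (A e)) =
        (\<Prod>e\<in>Pair True ` ?J True. prob (A e)) * (\<Prod>e\<in>Pair False ` ?J False. prob (A e))"
      by (rule prod.union_disjoint) (auto simp: fin)
    from trans[OF arg_cong[OF JU, of "prod (\<lambda>e. prob (A e))"] this] show ?thesis
      by (rule sym)
  qed
  finally show "prob (\<Inter>e\<in>J. A e) = (\<Prod>e\<in>J. prob (A e))" .
qed


section \<open>From Wigner sequences to families\<close>

definition moment_sup :: "nat \<Rightarrow> (nat \<Rightarrow> 'a measure) \<Rightarrow> (nat \<Rightarrow> nat \<Rightarrow> nat \<Rightarrow> 'a \<Rightarrow> complex) \<Rightarrow> nat \<Rightarrow> real" where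
  "moment_sup N0 M W l = enn2real (SUP N\<in>{N0..}. SUP (i, j)\<in>{(i, j). i \<le> j \<and> j < N}.
     \<integral>\<^sup>+x. ennreal (cmod (W N i j x) ^ l) \<partial>M N)"

lemma bounded_moments_entry:
  assumes W: "bounded_moments N0 M W" and N: "N \<ge> N0" "i \<le> j" "j < N" and m: "W N i j \<in> borel_measurable (M N)"
  shows "W N i j \<in> all_moments (M N)" "(\<integral>x. cmod (W N i j x) ^ l \<partial>M N) \<le> moment_sup N0 M W l"
proof -
  let ?S = "\<lambda>l. SUP N\<in>{N0..}. SUP (i, j)\<in>{(i, j). i \<le> j \<and> j < N}. \<integral>\<^sup>+x. ennreal (cmod (W N i j x) ^ l) \<partial>M N"
  have fin: "?S l < \<infinity>" for l using W by (simp add: bounded_moments_def)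
  have le: "(\<integral>\<^sup>+x. ennreal (cmod (W N i j x) ^ l) \<partial>M N) \<le> ?S l" for l
    by (rule SUP_upper2[of N], use N in simp, rule SUP_upper2[of "(i, j)"]) (use N in auto)
  have int: "integrable (M N) (\<lambda>x. cmod (W N i j x) ^ l)" for l
  proof (rule integrableI_bounded)
    show "(\<lambda>x. cmod (W N i j x) ^ l) \<in> borel_measurable (M N)" using m by measurable
    show "(\<integral>\<^sup>+x. ennreal (norm (cmod (W N i j x) ^ l)) \<partial>M N) < \<infinity>"
      using order.strict_trans1[OF le fin] by (simp add: norm_power)
  qed
  then show "W N i j \<in> all_moments (M N)" using m by (simp add: all_moments_def)
  have "ennreal (\<integral>x. cmod (W N i j x) ^ l \<partial>M N) \<le> ?S l"
    using le[of l] nn_integral_eq_integral[OF int] by simp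
  then have "enn2real (ennreal (\<integral>x. cmod (W N i j x) ^ l \<partial>M N)) \<le> enn2real (?S l)"
    using fin[of l] by (intro enn2real_mono) auto
  then show "(\<integral>x. cmod (W N i j x) ^ l \<partial>M N) \<le> moment_sup N0 M W l"
    unfolding moment_sup_def by (simp add: integral_nonneg_AE)
qed

text \<open>The hypotheses on moments and independence concern indices i \<le> j; conjugation
  carries the moment properties to the lower triangle.\<close>

lemma wigner_sequence_entry:
  assumes W: "wigner_sequence N0 M s \<kappa> W" and N: "N \<ge> N0" and M: "prob_space (M N)"
  shows "prob_space.indep_vars (M N) (\<lambda>_. borel) (\<lambda>(i, j). W N i j) {(i, j). i \<le> j \<and> j < N}"
    and "i < N \<Longrightarrow> j < N \<Longrightarrow> x \<in> space (M N) \<Longrightarrow> cnj (W N i j x) = W N j i x"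
    and "i < N \<Longrightarrow> j < N \<Longrightarrow> W N i j \<in> all_moments (M N)"
    and "i < N \<Longrightarrow> j < N \<Longrightarrow> (\<integral>x. cmod (W N i j x) ^ l \<partial>M N) \<le> moment_sup N0 M W l"
    and "i < N \<Longrightarrow> j < N \<Longrightarrow> (\<integral>x. W N i j x \<partial>M N) = 0"
    and "i < N \<Longrightarrow> j < N \<Longrightarrow> i \<noteq> j \<Longrightarrow> (\<integral>x. (cmod (W N i j x))\<^sup>2 \<partial>M N) = 1"
proof -
  interpret prob_space "M N" by (rule M)
  have w: "wigner_array N s \<kappa> (W N)"
  proof -
    have "real_wigner_array N s \<kappa> (W N) \<or> complex_wigner_array N s \<kappa> (W N)"
      using W N by (simp add: wigner_sequence_def)
    then show ?thesis by (auto simp: real_wigner_array_def complex_wigner_array_def)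
  qed
  have b: "bounded_moments N0 M W" using W by (simp add: wigner_sequence_def)
  show indep: "indep_vars (\<lambda>_. borel) (\<lambda>(i, j). W N i j) {(i, j). i \<le> j \<and> j < N}"
    using w by (simp add: wigner_array_def)
  have herm: "cnj (W N i j x) = W N j i x" if "i < N" "j < N" "x \<in> space (M N)" for i j x
    using w that unfolding wigner_array_def by (metis complex_cnj_cnj)
  show "cnj (W N i j x) = W N j i x" if "i < N" "j < N" "x \<in> space (M N)"
    using that by (rule herm)
  have meas: "W N i j \<in> borel_measurable (M N)" if "i \<le> j" "j < N" for i j
    using indep that unfolding indep_vars_def2 by auto
  note bm = bounded_moments_entry[OF b N _ _ meas]
  have flip: "W N j i \<in> all_moments (M N) \<Longrightarrow> W N i j \<in> all_moments (M N)"
      "(\<integral>x. cmod (W N i j x) ^ l \<partial>M N) = (\<integral>x. cmod (W N j i x) ^ l \<partial>M N)"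
      "(\<integral>x. W N i j x \<partial>M N) = cnj (\<integral>x. W N j i x \<partial>M N)" if "i < N" "j < N" for i j l
  proof -
    have eq: "W N i j x = cnj (W N j i x)" if "x \<in> space (M N)" for x
      using herm[of j i x] that \<open>i < N\<close> \<open>j < N\<close> by simp
    show "W N i j \<in> all_moments (M N)" if "W N j i \<in> all_moments (M N)"
      using all_moments_cong[of "M N" "W N i j" "\<lambda>x. cnj (W N j i x)"] eq all_moments_cnj[OF that] by blast
    show "(\<integral>x. cmod (W N i j x) ^ l \<partial>M N) = (\<integral>x. cmod (W N j i x) ^ l \<partial>M N)"
      using eq by (intro Bochner_Integration.integral_cong) auto
    show "(\<integral>x. W N i j x \<partial>M N) = cnj (\<integral>x. W N j i x \<partial>M N)"
      unfolding Bochner_Integration.integral_cnj[symmetric]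
      using eq by (intro Bochner_Integration.integral_cong) auto
  qed
  show "W N i j \<in> all_moments (M N)" if "i < N" "j < N"
    using bm(1)[of i j] bm(1)[of j i] flip(1)[OF that] that by (cases "i \<le> j") auto
  show "(\<integral>x. cmod (W N i j x) ^ l \<partial>M N) \<le> moment_sup N0 M W l" if "i < N" "j < N"
    using bm(2)[of i j l] bm(2)[of j i l] flip(2)[OF that, of l] that by (cases "i \<le> j") auto
  have z: "(\<integral>x. W N i j x \<partial>M N) = 0" if "i \<le> j" "j < N" for i j
    using w that unfolding wigner_array_def by (cases "i = j") auto
  show "(\<integral>x. W N i j x \<partial>M N) = 0" if "i < N" "j < N"
    using z[of i j] z[of j i] flip(3)[OF that] that by (cases "i \<le> j") auto
  have o: "(\<integral>x. (cmod (W N i j x))\<^sup>2 \<partial>M N) = 1" if "i < j" "j < N" for i j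
    using w that unfolding wigner_array_def by auto
  show "(\<integral>x. (cmod (W N i j x))\<^sup>2 \<partial>M N) = 1" if "i < N" "j < N" "i \<noteq> j"
    using o[of i j] o[of j i] flip(2)[OF that(1,2), of 2] that by (cases "i < j") auto
qed


section \<open>Matrices\<close>

lemma mat_times_mat:
  "Matrix.mat N N f * Matrix.mat N N g = Matrix.mat N N (\<lambda>(i, j). \<Sum>l<N. f (i, l) * (g (l, j) :: complex))"
  by (intro eq_matI) (auto simp: scalar_prod_def atLeast0LessThan)

lemma mat_power_eq_wprod:
  "Matrix.mat N N (\<lambda>(i, j). z c i j) ^\<^sub>m k = Matrix.mat N N (\<lambda>(i, j). wprod z {..<N} (replicate k c) i j)"
proof (induction k)
  case 0
  show ?case by (intro eq_matI) auto
next
  case (Suc k)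
  show ?case
  proof (rule eq_matI)
    fix i j assume ij: "i < dim_row (Matrix.mat N N (\<lambda>(i, j). wprod z {..<N} (replicate (Suc k) c) i j))"
      "j < dim_col (Matrix.mat N N (\<lambda>(i, j). wprod z {..<N} (replicate (Suc k) c) i j))"
    have single: "wprod z {..<N} [c] l j = z c l j" if "l < N" for l
    proof -
      have "wprod z {..<N} [c] l j = (\<Sum>k<N. if k = j then z c l k else 0)"
        unfolding wprod.simps by (intro sum.cong) auto
      then show ?thesis using ij by simp
    qed
    \<comment> \<open>Matrix powers grow on the right whereas \<open>wprod\<close> consumes a word
      from the left.\<close>
    have "wprod z {..<N} (replicate (Suc k) c) i j = wprod z {..<N} (replicate k c @ [c]) i j"
      by (simp only: replicate_append_same replicate_Suc)
    also have "\<dots> = (\<Sum>l<N. wprod z {..<N} (replicate k c) i l * z c l j)"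
      using ij by (subst wprod_append) (auto simp: single intro!: sum.cong simp del: wprod.simps)
    finally show "(Matrix.mat N N (\<lambda>(i, j). z c i j) ^\<^sub>m Suc k) $$ (i, j) =
        Matrix.mat N N (\<lambda>(i, j). wprod z {..<N} (replicate (Suc k) c) i j) $$ (i, j)"
      unfolding pow_mat.simps Suc mat_times_mat using ij by (simp del: replicate_Suc wprod.simps)
  qed (simp_all add: Suc)
qed

lemma off_diagonal_part_mat:
  assumes "N0 \<le> N"
  shows "off_diagonal_part N0 (Matrix.mat N N (\<lambda>(i, j). f i j)) =
    Matrix.mat N N (\<lambda>(i, j). if (i < N0) \<noteq> (j < N0) then f i j else 0)"
  using assms by (intro eq_matI) (auto simp: off_diagonal_part_def split_block_def Let_def four_block_mat_def)

lemma mat_trace_upper_left_block: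
  assumes "N0 \<le> N"
  shows "mat_trace (upper_left_block N0 (Matrix.mat N N (\<lambda>(i, j). f i j))) = (\<Sum>i<N0. f i i)"
  using assms by (simp add: mat_trace_def upper_left_block_def split_block_def Let_def)

lemma mat_power_eq_prow:
  "Matrix.mat N N (\<lambda>(i, j). p i j) ^\<^sub>m k = Matrix.mat N N (\<lambda>(i, j). prow p N i k j)"
proof (induction k)
  case 0
  show ?case by (intro eq_matI) auto
next
  case (Suc k)
  then show ?case by (simp add: mat_times_mat)
qed

lemma P_mat_eq:
  assumes "N0 \<le> N"
  shows "P_mat N0 m \<alpha> (Matrix.mat N N (\<lambda>(i, j). z True i j)) (Matrix.mat N N (\<lambda>(i, j). z False i j)) =
    Matrix.mat N N (\<lambda>(i, j). corner.P z N N0 m \<alpha> i j)"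
proof -
  interpret corner z N N0 m by unfold_locales (rule assms)
  show ?thesis
    unfolding P_mat_def mat_power_eq_wprod[of N z True] off_diagonal_part_mat[OF assms] mat_times_mat
    by (intro eq_matI) (auto simp: P_def T_def cong: if_cong)
qed

theorem proposition5p2:
  fixes N0 m :: nat
    and \<alpha> :: complex
    and M :: "nat \<Rightarrow> 'a measure"
    and s\<^sub>A \<kappa>\<^sub>A s\<^sub>B \<kappa>\<^sub>B :: real
    and X Y :: "nat \<Rightarrow> nat \<Rightarrow> nat \<Rightarrow> 'a \<Rightarrow> complex"
    and A B P :: "nat \<Rightarrow> 'a \<Rightarrow> complex mat"
  assumes "N0 \<ge> 1"
    and "\<And>N. N \<ge> N0 \<Longrightarrow> prob_space (M N)"
    and "wigner_sequence N0 M s\<^sub>A \<kappa>\<^sub>A X"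
    and "wigner_sequence N0 M s\<^sub>B \<kappa>\<^sub>B Y"
    and "\<And>N. N \<ge> N0 \<Longrightarrow> prob_space.indep_arrays (M N) N (X N) (Y N)"
    and "\<And>N. A N = wigner_mat N (X N)"
    and "\<And>N. B N = wigner_mat N (Y N)"
    and "\<alpha> \<noteq> 0"
    and "\<And>N x. P N x = P_mat N0 m \<alpha> (A N x) (B N x)"
  shows "\<forall>k\<ge>1. (\<lambda>N. prob_space.partial_trace (M N) N0 (\<lambda>x. P N x ^\<^sub>m k))
           \<longlonglongrightarrow> complex_of_real (\<integral>t. t ^ k \<partial>symmetric_bernoulli (omega \<alpha> m))"
proof (intro allI impI)
  fix k :: nat
  define Z where "Z N c = (if c then X N else Y N)" for N c
  \<comment> \<open>The sum of two nonnegative suprema dominates both, so one bound serves both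
    letters.\<close>
  define K where "K l = moment_sup N0 M X l + moment_sup N0 M Y l" for l
  have sup: "0 \<le> moment_sup N0 M W l" for W l by (simp add: moment_sup_def)
  interpret wigner_pair M N0 Z K m
  proof (intro wigner_pair.intro wigner_families.intro prob_sequence.intro wigner_families_axioms.intro wigner_pair_axioms.intro)
    show "prob_space (M N)" if "N \<ge> N0" for N using that by (rule assms(2))
    show "1 \<le> N0" by (rule assms(1))
    show "wigner_family (M N) N (Z N) K" if N: "N \<ge> N0" for N
    proof -
      interpret prob_space "M N" by (rule assms(2)[OF N])
      note x = wigner_sequence_entry[OF assms(3) N assms(2)[OF N]]
      note y = wigner_sequence_entry[OF assms(4) N assms(2)[OF N]]
      show ?thesis
      proof unfold_locales
        show "1 \<le> N" using assms(1) N by simp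
        have "indep_vars (\<lambda>_. borel) (\<lambda>(c, i, j). (if c then X N else Y N) i j) {(c, i, j). i \<le> j \<and> j < N}"
          by (rule indep_arrays_indep_vars[OF x(1) y(1) assms(5)[OF N]])
        then show "indep_vars (\<lambda>_. borel) (\<lambda>(c, i, j). Z N c i j) {(c, i, j). i \<le> j \<and> j < N}"
          by (simp add: Z_def)
        fix c i j assume ij: "i < N" "j < N"
        show "cnj (Z N c i j \<omega>) = Z N c j i \<omega>" if "\<omega> \<in> space (M N)" for \<omega>
          using x(2)[OF ij that] y(2)[OF ij that] by (simp add: Z_def)
        show "Z N c i j \<in> all_moments (M N)"
          using x(3)[OF ij] y(3)[OF ij] by (simp add: Z_def)
        show "expectation (\<lambda>\<omega>. cmod (Z N c i j \<omega>) ^ p) \<le> K p" for p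
          using x(4)[OF ij, of p] y(4)[OF ij, of p] sup[of X p] sup[of Y p] by (simp add: Z_def K_def)
        show "expectation (Z N c i j) = 0"
          using x(5)[OF ij] y(5)[OF ij] by (simp add: Z_def)
        show "expectation (\<lambda>\<omega>. (cmod (Z N c i j \<omega>))\<^sup>2) = 1" if "i \<noteq> j"
          using x(6)[OF ij that] y(6)[OF ij that] by (simp add: Z_def)
      qed
    qed
  qed
  let ?p = "\<lambda>N \<omega>. prow (corner.P (scaled_entry N (Z N) \<omega>) N N0 m \<alpha>) N"
  have "tends (\<lambda>N \<omega>. \<Sum>i<N0. ?p N \<omega> i k i) (\<Sum>i<N0. prow_limit_even \<alpha> k False)"
    by (intro tends_sum tends_prow_diag) simp
  then have "(\<lambda>N. (\<integral>\<omega>. (\<Sum>i<N0. ?p N \<omega> i k i) \<partial>M N) / of_nat N0) \<longlonglongrightarrow>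
      (\<Sum>i<N0. prow_limit_even \<alpha> k False) / of_nat N0"
    using assms(1) by (intro tendsto_divide tends_expectation tendsto_const) auto
  \<comment> \<open>The limit is the same for all \<open>N0\<close> diagonal entries, so their
    average has it too.\<close>
  moreover have "(\<Sum>i<N0. prow_limit_even \<alpha> k False) / of_nat N0 =
      complex_of_real (\<integral>t. t ^ k \<partial>symmetric_bernoulli (omega \<alpha> m))"
    using assms(1) by (simp add: integral_symmetric_bernoulli_omega)
  moreover have "prob_space.partial_trace (M N) N0 (\<lambda>x. P N x ^\<^sub>m k) =
      (\<integral>\<omega>. (\<Sum>i<N0. ?p N \<omega> i k i) \<partial>M N) / of_nat N0" if N: "N \<ge> N0" for N
  proof -
    interpret prob_space "M N" by (rule assms(2)[OF N])
    have "P N \<omega> = Matrix.mat N N (\<lambda>(i, j). corner.P (scaled_entry N (Z N) \<omega>) N N0 m \<alpha> i j)" for \<omega>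
      unfolding assms(6,7,9) P_mat_eq[OF N, symmetric] wigner_mat_def scaled_entry_def Z_def by simp
    then show ?thesis
      by (simp add: partial_trace_def mat_power_eq_prow mat_trace_upper_left_block[OF N])
  qed
  then have "\<forall>\<^sub>F N in sequentially. prob_space.partial_trace (M N) N0 (\<lambda>x. P N x ^\<^sub>m k) =
      (\<integral>\<omega>. (\<Sum>i<N0. ?p N \<omega> i k i) \<partial>M N) / of_nat N0"
    by (auto simp: eventually_sequentially)
  ultimately show "(\<lambda>N. prob_space.partial_trace (M N) N0 (\<lambda>x. P N x ^\<^sub>m k))
      \<longlonglongrightarrow> complex_of_real (\<integral>t. t ^ k \<partial>symmetric_bernoulli (omega \<alpha> m))"
    by (simp add: tendsto_cong)
qed

end
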